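(* Let $\varepsilon\in\mathbb N_0$, let $X$ be a $\mathbb Z$-filtered simplicial complex, and let $\mathcal U=(U_i,\mathcal F_i)_{i\in\Lambda}$ be an $\varepsilon$-acyclic ($\mathbb Z$-filtered) cover of $X$ by subcomplexes, with filtered nerve $\mathcal N$. Let $D=\dim\mathcal N$, $\Delta=\dim X$ and $Q=\min(D,\Delta)$. If $Q<\infty$, then the persistent homologies $H_*(X)$ and $H_*(\mathcal N)$ are $2(Q+1)\varepsilon$-interleaved as graded $\mathbf k[t]$-modules, i.e. $H_n(X)\overset{2(Q+1)\varepsilon}{\sim}H_n(\mathcal N)$ for every $n$.
   Context: Modules and interleavings. Let $\mathbf k$ be a field and let $\mathbf k[t]$ be graded by degree. A $\mathbf k[t]$-module means a $\mathbb Z$-graded module $M=\bigoplus_{j\in\mathbb Z}M^j$ with $tM^j\subseteq M^{j+1}$. For $\eta\in\mathbb N_0$, an $\eta$-morphism $f:M\to N$ is a $\mathbf k[t]$-linear map with $f(M^j)\subseteq N^{j+\eta}$ for all $j$. Let $\mathrm{id}_\eta:M\to M$ be $m\mapsto t^\eta m$. An $\eta$-interleaving of $M$ and $N$ is a pair of $\eta$-morphisms $\phi:M\to N$, $\psi:N\to M$ with $\phi\psi=\mathrm{id}_{2\eta}$ and $\psi\phi=\mathrm{id}_{2\eta}$; if one exists, $M$ and $N$ are $\eta$-interleaved, written $M\overset{\eta}{\sim}N$. Interleavings of graded $\mathbf k[t]$-modules (families $(M_p)_{p\in\mathbb Z}$ of $\mathbf k[t]$-modules) are defined componentwise. $t^a\mathbf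 k[t]$ denotes the free module on one generator of degree $a\in\mathbb Z$. Filtered complexes and covers. A $\mathbb Z$-filtered simplicial complex is an abstract simplicial complex $X$ with subcomplexes $(X^j)_{j\in\mathbb Z}$ such that $X^{j_1}\subseteq X^{j_2}$ for $j_1\le j_2$, $\bigcap_jX^j=\emptyset$ and $\bigcup_jX^j=X$. A filtered cover of $X$ by subcomplexes is an indexed family $\mathcal U=(U_i,\mathcal F_i)_{i\in\Lambda}$ where each $U_i$ is a subcomplex of $X$ with a filtration $\mathcal F_i=(U_i^j)_{j\in\mathbb Z}$ (making it a $\mathbb Z$-filtered simplicial complex), such that $X^j=\bigcup_{i\in\Lambda}U_i^j$ for each $j$. For nonempty finite $I\subseteq\Lambda$, $U_I=\bigcap_{i\in I}U_i$ is filtered by $U_I^j=\bigcap_{i\in I}U_i^j$. The persistent homology $H_q(X)$ is the $\mathbf k[t]$-module $\bigoplus_{j\in\mathbb Z}H_q(X^j;\mathbf k)$, with $t$ acting by the maps induced by $X^j\subseteq X^{j+1}$. Nerve. The nerve $\mathcal N=\mathcal N(\mathcal U)$ is the simplicial complex of nonempty finite $I\subseteq\Lambda$ with $U_I\neq\emptyset$, filtered by the sublevel sets of $g(I)=\min\{j\mid U_I^j\ne\emptyset\}$; $H_*(\mathcal N)$ is its persistent homology. $\varepsilon$-acyclicity. The cover $\mathcal U$ is $\varepsilon$-acyclic if for each $I\in\mathcal N(\mathcal U)$ there is $a\in\mathbb Z$ such that $H_0(U_I)\overset{\varepsilon}{\sim}t^a\mathbf k[t]$ and $H_q(U_I)\overset{\varepsilon}{\sim}0$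 for all $q\ne0$. *)

theory Defs
  imports
    "HOL-Algebra.Module"
    "HOL-Algebra.AbelCoset"
    "HOL-Computational_Algebra.Polynomial"
    "HOL-Library.Poly_Mapping"
    "HOL-Library.Set_Algebras"
    "HOL-Library.Extended"
begin

section \<open>Graded modules over k[t] and interleavings\<close>

text \<open>A commutative ring given by a type class, viewed as a ring record; it is used for the field
  \<open>'k\<close> and for \<open>k[t] = 'k poly\<close>.\<close>

definition type_ring :: "'a::comm_ring_1 ring" where
  "type_ring = \<lparr>carrier = UNIV, monoid.mult = (*), one = 1, zero = 0, add = (+)\<rparr>"

text \<open>The variable \<open>t\<close> of \<open>k[t]\<close>.\<close>

abbreviation tvar :: "'k::field poly" where
  "tvar \<equiv> [:0, 1:]"

text \<open>A \<open>k[t]\<close>-module together with its homogeneous parts \<open>grade M j\<close>. (The multiplicative fields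
  inherited from the record type of rings play no role.)\<close>

record ('k, 'm) gmodule = "('k poly, 'm) module" +
  grade :: "int \<Rightarrow> 'm set"

definition graded_kt_module :: "('k::field, 'm) gmodule \<Rightarrow> bool" where
  "graded_kt_module M \<longleftrightarrow>
     Module.module type_ring M \<and>
     (\<forall>j. additive_subgroup (grade M j) M) \<and>
     (\<forall>j c. \<forall>x\<in>grade M j. [:c:] \<odot>\<^bsub>M\<^esub> x \<in> grade M j) \<and>
     (\<forall>j. \<forall>x\<in>grade M j. tvar \<odot>\<^bsub>M\<^esub> x \<in> grade M (j + 1)) \<and>
     (\<forall>x\<in>carrier M. \<exists>!h. (\<forall>j. h j \<in> grade M j) \<and> finite {j. h j \<noteq> \<zero>\<^bsub>M\<^esub>} \<and>
        x = finsum M h {j. h j \<noteq> \<zero>\<^bsub>M\<^esub>})"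

definition eta_morphism ::
    "nat \<Rightarrow> ('k::field, 'm) gmodule \<Rightarrow> ('k, 'n) gmodule \<Rightarrow> ('m \<Rightarrow> 'n) \<Rightarrow> bool" where
  "eta_morphism \<eta> M N f \<longleftrightarrow>
     f \<in> carrier M \<rightarrow> carrier N \<and>
     (\<forall>x\<in>carrier M. \<forall>y\<in>carrier M. f (x \<oplus>\<^bsub>M\<^esub> y) = f x \<oplus>\<^bsub>N\<^esub> f y) \<and>
     (\<forall>p. \<forall>x\<in>carrier M. f (p \<odot>\<^bsub>M\<^esub> x) = p \<odot>\<^bsub>N\<^esub> f x) \<and>
     (\<forall>j. f ` grade M j \<subseteq> grade N (j + int \<eta>))"

definition interleaving ::
    "nat \<Rightarrow> ('k::field, 'm) gmodule \<Rightarrow> ('k, 'n) gmodule \<Rightarrow> ('m \<Rightarrow> 'n) \<Rightarrow> ('n \<Rightarrow> 'm) \<Rightarrow> bool"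
  where
  "interleaving \<eta> M N \<phi> \<psi> \<longleftrightarrow>
     eta_morphism \<eta> M N \<phi> \<and> eta_morphism \<eta> N M \<psi> \<and>
     (\<forall>y\<in>carrier N. \<phi> (\<psi> y) = tvar ^ (2 * \<eta>) \<odot>\<^bsub>N\<^esub> y) \<and>
     (\<forall>x\<in>carrier M. \<psi> (\<phi> x) = tvar ^ (2 * \<eta>) \<odot>\<^bsub>M\<^esub> x)"

definition interleaved :: "nat \<Rightarrow> ('k::field, 'm) gmodule \<Rightarrow> ('k, 'n) gmodule \<Rightarrow> bool" where
  "interleaved \<eta> M N \<longleftrightarrow> (\<exists>\<phi> \<psi>. interleaving \<eta> M N \<phi> \<psi>)"

text \<open>The zero module.\<close>

definition zero_kt :: "('k::field, unit) gmodule" where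
  "zero_kt = \<lparr>carrier = UNIV, monoid.mult = undefined, one = undefined, zero = (),
     add = (\<lambda>_ _. ()), module.smult = (\<lambda>_ _. ()), grade = (\<lambda>_. UNIV)\<rparr>"

text \<open>The free module \<open>t\<^sup>a k[t]\<close>: the element \<open>t\<^sup>a p\<close> is represented by the polynomial \<open>p\<close>, so the
  generator is \<open>1\<close>, placed in degree \<open>a\<close>.\<close>

definition free_kt :: "int \<Rightarrow> ('k::field, 'k poly) gmodule" where
  "free_kt a = \<lparr>carrier = UNIV, monoid.mult = undefined, one = undefined, zero = 0,
     add = (+), module.smult = (*),
     grade = (\<lambda>j. if a \<le> j then {monom c (nat (j - a)) | c. True} else {0})\<rparr>"

text \<open>The module \<open>\<Oplus>\<^sub>j V\<^sub>j\<close> for a sequence of vector spaces \<open>V\<^sub>j\<close> (over the field \<open>'k\<close>) and linear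
  maps \<open>\<tau>\<^sub>j : V\<^sub>j \<rightarrow> V\<^sub>j\<^sub>+\<^sub>1\<close>: its elements are the finitely supported families, \<open>t\<close> acts by
  \<open>t_shift\<close>, and a polynomial \<open>p\<close> acts as \<open>\<Sum>i\<le>degree p. coeff p i t\<^sup>i\<close>.\<close>

definition t_shift :: "(int \<Rightarrow> 'm \<Rightarrow> 'm) \<Rightarrow> (int \<Rightarrow> 'm) \<Rightarrow> int \<Rightarrow> 'm" where
  "t_shift \<tau> h = (\<lambda>j. \<tau> (j - 1) (h (j - 1)))"

definition direct_sum_carrier :: "(int \<Rightarrow> ('k::field, 'm) module) \<Rightarrow> (int \<Rightarrow> 'm) set" where
  "direct_sum_carrier V = {h. (\<forall>j. h j \<in> carrier (V j)) \<and> finite {j. h j \<noteq> \<zero>\<^bsub>V j\<^esub>}}"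

definition direct_sum_kt ::
    "(int \<Rightarrow> ('k::field, 'm) module) \<Rightarrow> (int \<Rightarrow> 'm \<Rightarrow> 'm) \<Rightarrow> ('k, int \<Rightarrow> 'm) gmodule" where
  "direct_sum_kt V \<tau> =
     \<lparr>carrier = direct_sum_carrier V, monoid.mult = undefined, one = undefined,
      zero = (\<lambda>j. \<zero>\<^bsub>V j\<^esub>),
      add = (\<lambda>g h j. g j \<oplus>\<^bsub>V j\<^esub> h j),
      module.smult = (\<lambda>p h j. finsum (V j) (\<lambda>i. coeff p i \<odot>\<^bsub>V j\<^esub> (t_shift \<tau> ^^ i) h j) {..degree p}),
      grade = (\<lambda>j. {h \<in> direct_sum_carrier V. \<forall>i. i \<noteq> j \<longrightarrow> h i = \<zero>\<^bsub>V i\<^esub>})\<rparr>"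


section \<open>Simplicial homology with coefficients in a field\<close>

definition simplicial_complex :: "'v set set \<Rightarrow> bool" where
  "simplicial_complex K \<longleftrightarrow>
     (\<forall>\<sigma>\<in>K. finite \<sigma> \<and> \<sigma> \<noteq> {}) \<and> (\<forall>\<sigma>\<in>K. \<forall>\<tau>. \<tau> \<subseteq> \<sigma> \<and> \<tau> \<noteq> {} \<longrightarrow> \<tau> \<in> K)"

text \<open>The dimension is \<open>-1\<close> for the empty complex.\<close>

definition complex_dim :: "'v set set \<Rightarrow> int extended" where
  "complex_dim K =
     (if bdd_above (card ` K) then Fin (Max (insert (-1) ((\<lambda>\<sigma>. int (card \<sigma>) - 1) ` K))) else Pinf)"

text \<open>Simplices are oriented by means of one fixed total order on all vertices, so that a chain is
  a finitely supported function on simplices and inclusions of complexes induce inclusions of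
  chain groups.\<close>

definition vertex_order :: "'v rel" where
  "vertex_order = (SOME r. linear_order r)"

definition vertex_index :: "'v \<Rightarrow> 'v set \<Rightarrow> nat" where
  "vertex_index v \<sigma> = card {u \<in> \<sigma>. (u, v) \<in> vertex_order \<and> u \<noteq> v}"

definition chains :: "'v set set \<Rightarrow> nat \<Rightarrow> ('v set \<Rightarrow>\<^sub>0 'k::field) set" where
  "chains K q = {c. Poly_Mapping.keys c \<subseteq> {\<sigma> \<in> K. card \<sigma> = Suc q}}"

text \<open>The linear extension of
  \<open>\<partial>[v\<^sub>0,\<dots>,v\<^sub>q] = \<Sum>i\<le>q. (-1)\<^sup>i [v\<^sub>0,\<dots>,v\<^sub>i\<^sub>-\<^sub>1,v\<^sub>i\<^sub>+\<^sub>1,\<dots>,v\<^sub>q]\<close> for \<open>v\<^sub>0 < \<dots> < v\<^sub>q\<close> and \<open>q > 0\<close>; homology is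
  not reduced.\<close>

definition boundary :: "nat \<Rightarrow> ('v set \<Rightarrow>\<^sub>0 'k::field) \<Rightarrow> ('v set \<Rightarrow>\<^sub>0 'k)" where
  "boundary q c =
     (if q = 0 then 0
      else \<Sum>\<sigma>\<in>Poly_Mapping.keys c. \<Sum>v\<in>\<sigma>.
             Poly_Mapping.single (\<sigma> - {v}) ((-1) ^ vertex_index v \<sigma> * Poly_Mapping.lookup c \<sigma>))"

definition cycles :: "'v set set \<Rightarrow> nat \<Rightarrow> ('v set \<Rightarrow>\<^sub>0 'k::field) set" where
  "cycles K q = {c \<in> chains K q. boundary q c = 0}"

definition boundaries :: "'v set set \<Rightarrow> nat \<Rightarrow> ('v set \<Rightarrow>\<^sub>0 'k::field) set" where
  "boundaries K q = boundary (Suc q) ` chains K (Suc q)"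

abbreviation cscale :: "'k::field \<Rightarrow> ('v set \<Rightarrow>\<^sub>0 'k) \<Rightarrow> ('v set \<Rightarrow>\<^sub>0 'k)" where
  "cscale a \<equiv> Poly_Mapping.map ((*) a)"

text \<open>The vector space \<open>H\<^sub>q(K; k)\<close> of cosets of the boundaries. Adding the boundaries after scaling
  a coset only matters for the scalar \<open>0\<close>.\<close>

definition homology :: "'v set set \<Rightarrow> nat \<Rightarrow> ('k::field, ('v set \<Rightarrow>\<^sub>0 'k) set) module" where
  "homology K q =
     \<lparr>carrier = (\<lambda>z. z +o boundaries K q) ` cycles K q,
      monoid.mult = undefined, one = undefined,
      zero = boundaries K q,
      add = (+),
      module.smult = (\<lambda>a A. cscale a ` A + boundaries K q)\<rparr>"

text \<open>The map \<open>[z] \<mapsto> [z]\<close> into \<open>H\<^sub>q(L; k)\<close> induced by an inclusion of a subcomplex into \<open>L\<close>.\<close>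

definition homology_incl ::
    "'v set set \<Rightarrow> nat \<Rightarrow> ('v set \<Rightarrow>\<^sub>0 'k::field) set \<Rightarrow> ('v set \<Rightarrow>\<^sub>0 'k) set" where
  "homology_incl L q A = A + boundaries L q"


section \<open>Filtered complexes, covers and nerves\<close>

definition filtered_complex :: "'v set set \<Rightarrow> (int \<Rightarrow> 'v set set) \<Rightarrow> bool" where
  "filtered_complex X F \<longleftrightarrow>
     simplicial_complex X \<and>
     (\<forall>j. simplicial_complex (F j) \<and> F j \<subseteq> X) \<and>
     (\<forall>i j. i \<le> j \<longrightarrow> F i \<subseteq> F j) \<and>
     (\<Inter>j. F j) = {} \<and> (\<Union>j. F j) = X"

definition persistent_homology ::
    "(int \<Rightarrow> 'v set set) \<Rightarrow> nat \<Rightarrow> ('k::field, int \<Rightarrow> ('v set \<Rightarrow>\<^sub>0 'k) set) gmodule" where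
  "persistent_homology F q =
     direct_sum_kt (\<lambda>j. homology (F j) q) (\<lambda>j. homology_incl (F (j + 1)) q)"

definition filtered_cover ::
    "'v set set \<Rightarrow> (int \<Rightarrow> 'v set set) \<Rightarrow> 'i set \<Rightarrow> ('i \<Rightarrow> 'v set set) \<Rightarrow>
     ('i \<Rightarrow> int \<Rightarrow> 'v set set) \<Rightarrow> bool" where
  "filtered_cover X F \<Lambda> U FU \<longleftrightarrow>
     (\<forall>i\<in>\<Lambda>. U i \<subseteq> X \<and> filtered_complex (U i) (FU i)) \<and>
     (\<forall>j. F j = (\<Union>i\<in>\<Lambda>. FU i j))"

definition inter_complex :: "('i \<Rightarrow> 'v set set) \<Rightarrow> 'i set \<Rightarrow> 'v set set" where
  "inter_complex U I = (\<Inter>i\<in>I. U i)"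

definition inter_filtration :: "('i \<Rightarrow> int \<Rightarrow> 'v set set) \<Rightarrow> 'i set \<Rightarrow> int \<Rightarrow> 'v set set" where
  "inter_filtration FU I j = (\<Inter>i\<in>I. FU i j)"

definition nerve :: "'i set \<Rightarrow> ('i \<Rightarrow> 'v set set) \<Rightarrow> 'i set set" where
  "nerve \<Lambda> U = {I. finite I \<and> I \<noteq> {} \<and> I \<subseteq> \<Lambda> \<and> inter_complex U I \<noteq> {}}"

text \<open>For an \<open>\<epsilon>\<close>-acyclic cover the minimum exists: \<open>H\<^sub>0(U\<^sub>I)\<close> is \<open>\<epsilon>\<close>-interleaved with some
  \<open>t\<^sup>a k[t]\<close>, so for \<open>j + \<epsilon> < a\<close> the map \<open>H\<^sub>0(U\<^sub>I\<^sup>j) \<rightarrow> H\<^sub>0(U\<^sub>I\<^sup>j\<^sup>+\<^sup>2\<^sup>\<epsilon>)\<close> is zero, which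
  forces \<open>U\<^sub>I\<^sup>j\<close> to be empty.\<close>

definition nerve_entry :: "('i \<Rightarrow> int \<Rightarrow> 'v set set) \<Rightarrow> 'i set \<Rightarrow> int" where
  "nerve_entry FU I = (LEAST j. inter_filtration FU I j \<noteq> {})"

definition nerve_filtration ::
    "'i set \<Rightarrow> ('i \<Rightarrow> 'v set set) \<Rightarrow> ('i \<Rightarrow> int \<Rightarrow> 'v set set) \<Rightarrow> int \<Rightarrow> 'i set set" where
  "nerve_filtration \<Lambda> U FU j = {I \<in> nerve \<Lambda> U. nerve_entry FU I \<le> j}"

text \<open>The first argument only serves to name the coefficient field.\<close>

definition eps_acyclic ::
    "'k::field itself \<Rightarrow> nat \<Rightarrow> 'i set \<Rightarrow> ('i \<Rightarrow> 'v set set) \<Rightarrow>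
     ('i \<Rightarrow> int \<Rightarrow> 'v set set) \<Rightarrow> bool" where
  "eps_acyclic (T :: 'k itself) \<epsilon> \<Lambda> U FU \<longleftrightarrow>
     (\<forall>I\<in>nerve \<Lambda> U. \<exists>a.
        interleaved \<epsilon>
          (persistent_homology (inter_filtration FU I) 0 :: ('k, int \<Rightarrow> ('v set \<Rightarrow>\<^sub>0 'k) set) gmodule)
          (free_kt a) \<and>
        (\<forall>q. q \<noteq> 0 \<longrightarrow>
          interleaved \<epsilon>
            (persistent_homology (inter_filtration FU I) q
              :: ('k, int \<Rightarrow> ('v set \<Rightarrow>\<^sub>0 'k) set) gmodule)
            zero_kt))"


section \<open>Well-formedness of the objects defined above\<close>

text \<open>The boundary map squares to zero, and the persistent homology of a filtration, the free module
  \<open>t\<^sup>a k[t]\<close> and the zero module are graded \<open>k[t]\<close>-modules; this is why \<open>interleaved\<close> does not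
  repeat that requirement.\<close>

lemma cring_type_ring: "cring (type_ring :: 'a::comm_ring_1 ring)"
proof (rule cringI)
  show "abelian_group (type_ring :: 'a ring)"
    by (rule abelian_groupI)
      (auto simp: type_ring_def add.assoc add.commute intro: exI[of _ "- x" for x] left_minus)
  show "Group.comm_monoid (type_ring :: 'a ring)"
    by (rule comm_monoidI) (auto simp: type_ring_def mult_ac)
qed (auto simp: type_ring_def algebra_simps)

lemma linear_order_vertex_order: "linear_order (vertex_order :: 'v rel)"
proof -
  obtain r :: "'v rel" where "well_order_on UNIV r"
    using well_order_on by blast
  then show ?thesis
    unfolding vertex_order_def well_order_on_def by (metis someI)
qed

lemma lookup_cscale [simp]:
  "Poly_Mapping.lookup (cscale a c) \<sigma> = a * Poly_Mapping.lookup c \<sigma>"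
  by transfer (simp add: when_def)

lemma cscale_simps [simp]:
  "cscale 0 c = 0" "cscale 1 c = c" "cscale a 0 = 0"
  "cscale a (c + d) = cscale a c + cscale a d" "cscale (a + b) c = cscale a c + cscale b c"
  "cscale (a * b) c = cscale a (cscale b c)"
  "cscale a (c - d) = cscale a c - cscale a d"
  by (rule poly_mapping_eqI; simp add: algebra_simps lookup_add lookup_minus)+

lemma cscale_sum: "cscale a (sum f A) = (\<Sum>x\<in>A. cscale a (f x))"
  by (induction A rule: infinite_finite_induct) auto

lemma cscale_single [simp]: "cscale a (Poly_Mapping.single \<sigma> b) = Poly_Mapping.single \<sigma> (a * b)"
  by (rule poly_mapping_eqI) (simp add: lookup_single when_def)

abbreviation bterm :: "'v set \<Rightarrow> 'k \<Rightarrow> ('v set \<Rightarrow>\<^sub>0 'k::field)" where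
  "bterm \<sigma> a \<equiv> \<Sum>v\<in>\<sigma>. Poly_Mapping.single (\<sigma> - {v}) ((-1) ^ vertex_index v \<sigma> * a)"

lemma bterm_0 [simp]: "bterm \<sigma> 0 = 0"
  by simp

lemma bterm_add: "bterm \<sigma> (a + b) = bterm \<sigma> a + bterm \<sigma> b"
  by (simp add: distrib_left single_add sum.distrib)

lemma boundary_superset:
  assumes "finite S" "Poly_Mapping.keys c \<subseteq> S" "q \<noteq> 0"
  shows "boundary q c = (\<Sum>\<sigma>\<in>S. bterm \<sigma> (Poly_Mapping.lookup c \<sigma>))"
proof -
  have "(\<Sum>\<sigma>\<in>Poly_Mapping.keys c. bterm \<sigma> (Poly_Mapping.lookup c \<sigma>)) = 
    (\<Sum>\<sigma>\<in>S. bterm \<sigma> (Poly_Mapping.lookup c \<sigma>))"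
    using assms by (intro sum.mono_neutral_left) (auto simp: in_keys_iff)
  then show ?thesis using assms by (simp add: boundary_def)
qed

lemma boundary_zero [simp]: "boundary q 0 = 0"
  by (simp add: boundary_def)

lemma boundary_add: "boundary q (c + d) = boundary q c + boundary q d"
proof (cases "q = 0")
  case False
  let ?S = "Poly_Mapping.keys c \<union> Poly_Mapping.keys d"
  have "Poly_Mapping.keys (c + d) \<subseteq> ?S" by (rule Poly_Mapping.keys_add)
  then have *: "boundary q (c + d) = (\<Sum>\<sigma>\<in>?S. bterm \<sigma> (Poly_Mapping.lookup (c + d) \<sigma>))"
    "boundary q c = (\<Sum>\<sigma>\<in>?S. bterm \<sigma> (Poly_Mapping.lookup c \<sigma>))"
    "boundary q d = (\<Sum>\<sigma>\<in>?S. bterm \<sigma> (Poly_Mapping.lookup d \<sigma>))"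
    using False by (auto intro!: boundary_superset)
  show ?thesis unfolding * lookup_add bterm_add sum.distrib ..
qed (simp add: boundary_def)

lemma boundary_cscale: "boundary q (cscale a c) = cscale a (boundary q c)"
proof (cases "q = 0")
  case False
  have "Poly_Mapping.keys (cscale a c) \<subseteq> Poly_Mapping.keys c"
    by (auto simp: in_keys_iff)
  then have *: "boundary q (cscale a c) =
      (\<Sum>\<sigma>\<in>Poly_Mapping.keys c. bterm \<sigma> (Poly_Mapping.lookup (cscale a c) \<sigma>))"
    using False by (intro boundary_superset) (simp_all del: lookup_cscale)
  show ?thesis unfolding *
    by (simp add: boundary_def False cscale_sum mult.left_commute)
qed (simp add: boundary_def)

lemma boundary_single: "q \<noteq> 0 \<Longrightarrow> boundary q (Poly_Mapping.single \<sigma> a) = bterm \<sigma> a"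
  by (subst boundary_superset[of "{\<sigma>}"]) auto

lemma boundary_sum: "boundary q (sum f A) = (\<Sum>x\<in>A. boundary q (f x))"
  by (induction A rule: infinite_finite_induct) (auto simp: boundary_add)

lemma vertex_index_remove:
  assumes "finite \<sigma>" "v \<in> \<sigma>" "w \<in> \<sigma>" "v \<noteq> w"
  shows "vertex_index w \<sigma> = vertex_index w (\<sigma> - {v}) + (if (v, w) \<in> vertex_order then 1 else 0)"
proof -
  have eq: "{u \<in> \<sigma>. (u, w) \<in> vertex_order \<and> u \<noteq> w} =
     {u \<in> \<sigma> - {v}. (u, w) \<in> vertex_order \<and> u \<noteq> w} \<union> (if (v, w) \<in> vertex_order then {v} else {})"
    using assms by auto
  show ?thesis unfolding vertex_index_def eq
    by (subst card_Un_disjoint) (use assms in auto)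
qed

lemma vertex_order_cases:
  assumes "v \<noteq> w" shows "(v, w) \<in> vertex_order \<longleftrightarrow> (w, v) \<notin> vertex_order"
  using linear_order_vertex_order[where 'v='a] assms
  by (auto simp: linear_order_on_def partial_order_on_def total_on_def antisym_def)

lemma sum_off_diagonal_cancel:
  fixes f :: "'a \<Rightarrow> 'a \<Rightarrow> 'b::ab_group_add"
  assumes "finite A" "\<And>v w. v \<in> A \<Longrightarrow> w \<in> A \<Longrightarrow> v \<noteq> w \<Longrightarrow> f v w + f w v = 0"
  shows "(\<Sum>v\<in>A. \<Sum>w\<in>A - {v}. f v w) = 0"
  using assms
proof (induction A rule: finite_induct)
  case (insert x A)
  have 1: "(\<Sum>w\<in>insert x A - {v}. f v w) = f v x + (\<Sum>w\<in>A - {v}. f v w)" if "v \<in> A" for v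
  proof -
    have "insert x A - {v} = insert x (A - {v})" using that insert by auto
    then show ?thesis using insert by simp
  qed
  have "(\<Sum>v\<in>insert x A. \<Sum>w\<in>insert x A - {v}. f v w)
     = (\<Sum>w\<in>A. f x w) + (\<Sum>v\<in>A. f v x + (\<Sum>w\<in>A - {v}. f v w))"
    using insert by (simp add: 1)
  also have "\<dots> = (\<Sum>v\<in>A. f x v + f v x) + (\<Sum>v\<in>A. \<Sum>w\<in>A - {v}. f v w)"
    by (simp add: sum.distrib add.assoc)
  also have "(\<Sum>v\<in>A. f x v + f v x) = 0"
    using insert by (intro sum.neutral) auto
  also have "(\<Sum>v\<in>A. \<Sum>w\<in>A - {v}. f v w) = 0"
    using insert by auto
  finally show ?case by simp
qed simp

lemma boundary_boundary: "boundary q (boundary (Suc q) c) = 0"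
proof (cases "q = 0")
  case False
  have "boundary q (bterm \<sigma> a) = 0" for \<sigma> :: "'a set" and a :: 'b
  proof (cases "finite \<sigma>")
    case True
    have "boundary q (bterm \<sigma> a) = (\<Sum>v\<in>\<sigma>. \<Sum>w\<in>\<sigma> - {v}. Poly_Mapping.single (\<sigma> - {v} - {w})
      ((-1) ^ vertex_index w (\<sigma> - {v}) * ((-1) ^ vertex_index v \<sigma> * a)))"
      by (simp add: boundary_sum boundary_single False)
    also have "\<dots> = 0"
    proof (rule sum_off_diagonal_cancel)
      fix v w assume vw: "v \<in> \<sigma>" "w \<in> \<sigma>" "v \<noteq> w"
      have "vertex_index w \<sigma> = vertex_index w (\<sigma> - {v}) + (if (v, w) \<in> vertex_order then 1 else 0)"
        "vertex_index v \<sigma> = vertex_index v (\<sigma> - {w}) + (if (v, w) \<in> vertex_order then 0 else 1)"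
        using vw True vertex_index_remove[of \<sigma> v w] vertex_index_remove[of \<sigma> w v]
          vertex_order_cases[of v w] by auto
      moreover have "\<sigma> - {w} - {v} = \<sigma> - {v} - {w}" by auto
      ultimately show "Poly_Mapping.single (\<sigma> - {v} - {w})
          ((-1) ^ vertex_index w (\<sigma> - {v}) * ((-1) ^ vertex_index v \<sigma> * a)) +
        Poly_Mapping.single (\<sigma> - {w} - {v})
          ((-1) ^ vertex_index v (\<sigma> - {w}) * ((-1) ^ vertex_index w \<sigma> * a)) = 0"
        by (simp add: single_add[symmetric] algebra_simps)
    qed fact
    finally show ?thesis .
  qed simp
  then show ?thesis
    by (subst (2) boundary_def) (simp add: boundary_sum)
qed (simp add: boundary_def)

lemma chains_closed:
  "0 \<in> chains K q"
  "c \<in> chains K q \<Longrightarrow> d \<in> chains K q \<Longrightarrow> c + d \<in> chains K q"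
  "c \<in> chains K q \<Longrightarrow> cscale a c \<in> chains K q"
proof -
  show "c \<in> chains K q \<Longrightarrow> d \<in> chains K q \<Longrightarrow> c + d \<in> chains K q"
    using Poly_Mapping.keys_add[of c d] by (auto simp: chains_def)
qed (auto simp: chains_def in_keys_iff)

lemma cycles_closed:
  "0 \<in> cycles K q"
  "c \<in> cycles K q \<Longrightarrow> d \<in> cycles K q \<Longrightarrow> c + d \<in> cycles K q"
  "c \<in> cycles K q \<Longrightarrow> cscale a c \<in> cycles K q"
  by (auto simp: cycles_def chains_closed boundary_add boundary_cscale)

lemma boundaries_closed:
  "0 \<in> boundaries K q"
  "c \<in> boundaries K q \<Longrightarrow> d \<in> boundaries K q \<Longrightarrow> c + d \<in> boundaries K q"
  "c \<in> boundaries K q \<Longrightarrow> cscale a c \<in> boundaries K q"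
proof -
  show "0 \<in> boundaries K q"
    unfolding boundaries_def by (rule image_eqI[of _ _ 0]) (simp_all add: chains_closed)
  show "c \<in> boundaries K q \<Longrightarrow> d \<in> boundaries K q \<Longrightarrow> c + d \<in> boundaries K q"
    unfolding boundaries_def
    by (elim imageE) (simp only: boundary_add[symmetric] chains_closed imageI)
  show "c \<in> boundaries K q \<Longrightarrow> cscale a c \<in> boundaries K q"
    unfolding boundaries_def
    by (elim imageE) (simp only: boundary_cscale[symmetric] chains_closed imageI)
qed

lemma uminus_cscale: "- c = cscale (-1) (c :: 'v set \<Rightarrow>\<^sub>0 'k::field)"
  by (rule poly_mapping_eqI) simp

lemma boundaries_uminus: "c \<in> boundaries K q \<Longrightarrow> - c \<in> boundaries K q"
  by (subst uminus_cscale) (rule boundaries_closed)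

lemma coset_add:
  "(x +o boundaries K q) + (y +o boundaries K q) = (x + y) +o boundaries K q" (is "?l = ?r")
proof
  show "?l \<subseteq> ?r"
  proof
    fix z assume "z \<in> ?l"
    then obtain b d where "b \<in> boundaries K q" "d \<in> boundaries K q" "z = (x + b) + (y + d)"
      by (auto simp: elt_set_plus_def set_plus_def)
    then have "b + d \<in> boundaries K q" "z = (x + y) + (b + d)"
      by (simp_all add: boundaries_closed add_ac)
    then show "z \<in> ?r" unfolding elt_set_plus_def by blast
  qed
  show "?r \<subseteq> ?l"
  proof
    fix z assume "z \<in> ?r"
    then obtain b where "b \<in> boundaries K q" "z = (x + b) + (y + 0)"
      by (auto simp: elt_set_plus_def algebra_simps)
    then show "z \<in> ?l"
      unfolding elt_set_plus_def set_plus_def using boundaries_closed(1) by blast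
  qed
qed

lemma coset_cscale:
  "cscale a ` (x +o boundaries K q) + boundaries K q = cscale a x +o boundaries K q" (is "?l = ?r")
proof
  show "?l \<subseteq> ?r"
  proof
    fix z assume "z \<in> ?l"
    then obtain b d where "b \<in> boundaries K q" "d \<in> boundaries K q" "z = cscale a (x + b) + d"
      by (auto simp: elt_set_plus_def set_plus_def)
    then have "cscale a b + d \<in> boundaries K q" "z = cscale a x + (cscale a b + d)"
      by (simp_all add: boundaries_closed add_ac)
    then show "z \<in> ?r" unfolding elt_set_plus_def by blast
  qed
  show "?r \<subseteq> ?l"
  proof
    fix z assume "z \<in> ?r"
    then obtain b where "b \<in> boundaries K q" "z = cscale a (x + 0) + b"
      by (auto simp: elt_set_plus_def algebra_simps)
    then show "z \<in> ?l"
      unfolding elt_set_plus_def set_plus_def using boundaries_closed(1) by blast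
  qed
qed

lemma zero_coset: "0 +o boundaries K q = boundaries K q"
  by (auto simp: elt_set_plus_def)

lemma homology_simps:
  "carrier (homology K q) = (\<lambda>z. z +o boundaries K q) ` cycles K q"
  "\<zero>\<^bsub>homology K q\<^esub> = 0 +o boundaries K q"
  "A \<oplus>\<^bsub>homology K q\<^esub> B = A + B"
  "a \<odot>\<^bsub>homology K q\<^esub> A = cscale a ` A + boundaries K q"
  by (auto simp: homology_def elt_set_plus_def)

lemma homologyE:
  assumes "A \<in> carrier (homology K q)"
  obtains z where "z \<in> cycles K q" "A = z +o boundaries K q"
  using assms by (auto simp: homology_simps)

lemma module_homology:
  "Module.module type_ring (homology K q :: ('k::field, ('v set \<Rightarrow>\<^sub>0 'k) set) module)"
  (is "Module.module _ ?H")
proof (rule moduleI)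
  show "cring (type_ring :: 'k ring)" by (rule cring_type_ring)
  show "abelian_group (?H)"
  proof (rule abelian_groupI)
    fix x assume "x \<in> carrier (?H)"
    then obtain z where z: "z \<in> cycles K q" "x = z +o boundaries K q" by (rule homologyE)
    have "cscale (-1) z \<in> cycles K q" using z by (intro cycles_closed)
    moreover have "cscale (-1) z + z = 0" by (simp flip: uminus_cscale)
    ultimately show "\<exists>y\<in>carrier (?H). y \<oplus>\<^bsub>?H\<^esub> x = \<zero>\<^bsub>?H\<^esub>"
      unfolding z homology_simps by (metis coset_add imageI)
  next
    fix x y assume "x \<in> carrier (?H)" "y \<in> carrier (?H)"
    then show "x \<oplus>\<^bsub>?H\<^esub> y \<in> carrier (?H)"
      by (elim homologyE) (simp add: homology_simps coset_add cycles_closed)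
  next
    show "\<zero>\<^bsub>?H\<^esub> \<in> carrier (?H)"
      unfolding homology_simps by (intro imageI cycles_closed)
  next
    fix x assume "x \<in> carrier (?H)"
    then obtain z where z: "z \<in> cycles K q" "x = z +o boundaries K q" by (rule homologyE)
    show "\<zero>\<^bsub>?H\<^esub> \<oplus>\<^bsub>?H\<^esub> x = x"
      unfolding z homology_simps coset_add by simp
  qed (simp_all add: homology_simps add_ac)
next
  fix a x assume "x \<in> carrier (?H)"
  then show "a \<odot>\<^bsub>?H\<^esub> x \<in> carrier (?H)"
    by (elim homologyE) (simp add: homology_simps coset_cscale cycles_closed)
next
  fix a b x assume "x \<in> carrier (?H)"
  then obtain z where z: "z \<in> cycles K q" "x = z +o boundaries K q" by (rule homologyE)
  show "(a \<oplus>\<^bsub>type_ring\<^esub> b) \<odot>\<^bsub>?H\<^esub> x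
      = a \<odot>\<^bsub>?H\<^esub> x \<oplus>\<^bsub>?H\<^esub> b \<odot>\<^bsub>?H\<^esub> x"
    unfolding z homology_simps coset_cscale coset_add by (simp add: type_ring_def)
  show "(a \<otimes>\<^bsub>type_ring\<^esub> b) \<odot>\<^bsub>?H\<^esub> x
      = a \<odot>\<^bsub>?H\<^esub> (b \<odot>\<^bsub>?H\<^esub> x)"
    unfolding z homology_simps coset_cscale coset_add by (simp add: type_ring_def)
  show "\<one>\<^bsub>type_ring\<^esub> \<odot>\<^bsub>?H\<^esub> x = x"
    unfolding z homology_simps coset_cscale coset_add by (simp add: type_ring_def)
next
  fix a x y assume "x \<in> carrier (?H)" "y \<in> carrier (?H)"
  then show "a \<odot>\<^bsub>?H\<^esub> (x \<oplus>\<^bsub>?H\<^esub> y)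
      = a \<odot>\<^bsub>?H\<^esub> x \<oplus>\<^bsub>?H\<^esub> a \<odot>\<^bsub>?H\<^esub> y"
    by (elim homologyE) (simp add: homology_simps coset_cscale coset_add)
qed

lemma homology_incl_coset:
  assumes "K \<subseteq> L"
  shows "homology_incl L q (z +o boundaries K q) = z +o boundaries L q" (is "?l = ?r")
proof -
  have sub: "boundaries K q \<subseteq> (boundaries L q :: ('a set \<Rightarrow>\<^sub>0 'b) set)"
    using assms unfolding boundaries_def chains_def by blast
  show ?thesis
  proof
    show "?l \<subseteq> ?r"
    proof
      fix x assume "x \<in> ?l"
      then obtain b d where bd: "b \<in> boundaries K q" "d \<in> boundaries L q" "x = (z + b) + d"
        by (auto simp: homology_incl_def elt_set_plus_def set_plus_def)
      then have "b + d \<in> boundaries L q" "x = z + (b + d)"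
        using sub by (auto simp: add_ac intro!: boundaries_closed)
      then show "x \<in> ?r" unfolding elt_set_plus_def by blast
    qed
    show "?r \<subseteq> ?l"
    proof
      fix x assume "x \<in> ?r"
      then obtain b where "b \<in> boundaries L q" "x = (z + 0) + b"
        by (auto simp: elt_set_plus_def)
      then show "x \<in> ?l"
        unfolding homology_incl_def elt_set_plus_def set_plus_def
        using boundaries_closed(1) by blast
    qed
  qed
qed

definition linear_map :: "('k::field, 'm) module \<Rightarrow> ('k, 'n) module \<Rightarrow> ('m \<Rightarrow> 'n) \<Rightarrow> bool" where
  "linear_map V W f \<longleftrightarrow>
     f \<in> carrier V \<rightarrow> carrier W \<and>
     (\<forall>x\<in>carrier V. \<forall>y\<in>carrier V. f (x \<oplus>\<^bsub>V\<^esub> y) = f x \<oplus>\<^bsub>W\<^esub> f y) \<and>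
     (\<forall>a. \<forall>x\<in>carrier V. f (a \<odot>\<^bsub>V\<^esub> x) = a \<odot>\<^bsub>W\<^esub> f x)"

lemma linear_map_homology_incl:
  assumes "K \<subseteq> L"
  shows "linear_map (homology K q) (homology L q) (homology_incl L q)"
proof -
  have "cycles K q \<subseteq> cycles L q"
    using assms unfolding cycles_def chains_def by blast
  then show ?thesis
    unfolding linear_map_def homology_simps
    by (auto simp: homology_incl_coset[OF assms] coset_add coset_cscale)
qed

locale vs_sequence =
  fixes V :: "int \<Rightarrow> ('k::field, 'm) module" and \<tau> :: "int \<Rightarrow> 'm \<Rightarrow> 'm"
  assumes V: "Module.module type_ring (V j)"
    and tau: "linear_map (V j) (V (j + 1)) (\<tau> j)"
begin

sublocale V: Module.module "type_ring :: 'k ring" "V j" for j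
  by (rule V)

abbreviation "S \<equiv> direct_sum_kt V \<tau>"
abbreviation "C \<equiv> direct_sum_carrier V"
abbreviation "T \<equiv> t_shift \<tau>"

lemma in_type_ring [simp]: "(a::'k) \<in> carrier type_ring"
  by (simp add: type_ring_def)

lemma type_ring_ops [simp]:
  "a \<oplus>\<^bsub>type_ring\<^esub> b = a + b" "a \<otimes>\<^bsub>type_ring\<^esub> b = a * b" "\<one>\<^bsub>type_ring\<^esub> = 1" "\<zero>\<^bsub>type_ring\<^esub> = 0"
  by (simp_all add: type_ring_def)

lemma vzero [simp]: "x \<in> carrier (V j) \<Longrightarrow> 0 \<odot>\<^bsub>V j\<^esub> x = \<zero>\<^bsub>V j\<^esub>"
  using V.smult_l_null[of x j] by simp

lemma tau_zero [simp]: "\<tau> j \<zero>\<^bsub>V j\<^esub> = \<zero>\<^bsub>V (j + 1)\<^esub>"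
proof -
  have "\<tau> j (0 \<odot>\<^bsub>V j\<^esub> \<zero>\<^bsub>V j\<^esub>) = 0 \<odot>\<^bsub>V (j + 1)\<^esub> \<tau> j \<zero>\<^bsub>V j\<^esub>" "\<tau> j \<zero>\<^bsub>V j\<^esub> \<in> carrier (V (j + 1))"
    using tau[of j] V.zero_closed[of j] unfolding linear_map_def by blast+
  then show ?thesis by simp
qed

lemma t_shift_closed:
  assumes "h \<in> C" shows "T h \<in> C"
proof -
  have "{j. T h j \<noteq> \<zero>\<^bsub>V j\<^esub>} \<subseteq> (\<lambda>j. j + 1) ` {j. h j \<noteq> \<zero>\<^bsub>V j\<^esub>}"
  proof
    fix j assume "j \<in> {j. T h j \<noteq> \<zero>\<^bsub>V j\<^esub>}"
    then have "h (j - 1) \<noteq> \<zero>\<^bsub>V (j - 1)\<^esub>" using tau_zero[of "j - 1"] by (auto simp: t_shift_def)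
    then show "j \<in> (\<lambda>j. j + 1) ` {j. h j \<noteq> \<zero>\<^bsub>V j\<^esub>}" by (intro image_eqI[of _ _ "j - 1"]) auto
  qed
  moreover have "T h j \<in> carrier (V j)" for j
  proof -
    have "h (j - 1) \<in> carrier (V (j - 1))" using assms by (auto simp: direct_sum_carrier_def)
    then show ?thesis using tau[of "j - 1"] by (auto simp: t_shift_def linear_map_def)
  qed
  ultimately show ?thesis using assms
    by (auto simp: direct_sum_carrier_def intro: finite_subset)
qed

lemma t_shift_pow_closed: "h \<in> C \<Longrightarrow> (T ^^ i) h \<in> C"
  by (induction i) (auto simp: t_shift_closed)

lemma C_D: "h \<in> C \<Longrightarrow> h j \<in> carrier (V j)"
  by (simp add: direct_sum_carrier_def)

definition vadd where "vadd g h = (\<lambda>j. g j \<oplus>\<^bsub>V j\<^esub> h j)"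
definition vscale where "vscale a h = (\<lambda>j. a \<odot>\<^bsub>V j\<^esub> h j)"
definition vzero' where "vzero' = (\<lambda>j. \<zero>\<^bsub>V j\<^esub>)"

lemma vadd_closed: "g \<in> C \<Longrightarrow> h \<in> C \<Longrightarrow> vadd g h \<in> C"
proof -
  assume *: "g \<in> C" "h \<in> C"
  have "{j. vadd g h j \<noteq> \<zero>\<^bsub>V j\<^esub>} \<subseteq> {j. g j \<noteq> \<zero>\<^bsub>V j\<^esub>} \<union> {j. h j \<noteq> \<zero>\<^bsub>V j\<^esub>}"
    by (auto simp: vadd_def)
  then show ?thesis using *
    by (auto simp: direct_sum_carrier_def vadd_def intro: finite_subset)
qed

lemma vscale_closed: "h \<in> C \<Longrightarrow> vscale a h \<in> C"
proof -
  assume *: "h \<in> C"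
  have "{j. vscale a h j \<noteq> \<zero>\<^bsub>V j\<^esub>} \<subseteq> {j. h j \<noteq> \<zero>\<^bsub>V j\<^esub>}"
    using V.smult_r_null by (auto simp: vscale_def)
  then show ?thesis using *
    by (auto simp: direct_sum_carrier_def vscale_def intro: finite_subset)
qed

lemma vzero_closed: "vzero' \<in> C"
  by (auto simp: direct_sum_carrier_def vzero'_def)

lemma S_simps:
  "carrier S = C" "\<zero>\<^bsub>S\<^esub> = vzero'" "g \<oplus>\<^bsub>S\<^esub> h = vadd g h"
  "grade S j = {h \<in> C. \<forall>i. i \<noteq> j \<longrightarrow> h i = \<zero>\<^bsub>V i\<^esub>}"
  by (auto simp: direct_sum_kt_def vadd_def vzero'_def)

lemma abelian_group_S: "abelian_group S"
proof (rule abelian_groupI)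
  fix x assume "x \<in> carrier S"
  then have x: "x \<in> C" by (simp add: S_simps)
  have "vadd (vscale (-1) x) x = vzero'"
  proof
    fix j
    have "vadd (vscale (-1) x) x j = (-1) \<odot>\<^bsub>V j\<^esub> x j \<oplus>\<^bsub>V j\<^esub> 1 \<odot>\<^bsub>V j\<^esub> x j"
      using C_D[OF x, of j] V.smult_one[of "x j" j] by (simp add: vadd_def vscale_def)
    also have "\<dots> = (-1 + 1) \<odot>\<^bsub>V j\<^esub> x j"
      using C_D[OF x, of j] V.smult_l_distr[of "-1" 1 "x j" j] by simp
    finally show "vadd (vscale (-1) x) x j = vzero' j"
      using C_D[OF x, of j] by (simp add: vzero'_def)
  qed
  then show "\<exists>y\<in>carrier S. y \<oplus>\<^bsub>S\<^esub> x = \<zero>\<^bsub>S\<^esub>"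
    using vscale_closed[OF x] by (auto simp: S_simps)
qed (auto simp: S_simps vadd_closed vzero_closed, (auto simp: vadd_def vzero'_def C_D V.a_ac)+)

sublocale S: abelian_group S by (rule abelian_group_S)

lemma smult_S_upto:
  assumes "h \<in> C" "degree p \<le> n"
  shows "(p \<odot>\<^bsub>S\<^esub> h) j = finsum (V j) (\<lambda>i. coeff p i \<odot>\<^bsub>V j\<^esub> (T ^^ i) h j) {..n}"
proof -
  have "(p \<odot>\<^bsub>S\<^esub> h) j = finsum (V j) (\<lambda>i. coeff p i \<odot>\<^bsub>V j\<^esub> (T ^^ i) h j) {..degree p}"
    by (simp add: direct_sum_kt_def)
  also have "\<dots> = finsum (V j) (\<lambda>i. coeff p i \<odot>\<^bsub>V j\<^esub> (T ^^ i) h j) {..n}"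
    using assms
    by (intro V.add.finprod_mono_neutral_cong_left)
      (auto simp: coeff_eq_0 C_D t_shift_pow_closed)
  finally show ?thesis .
qed

lemma smult_S_pCons:
  assumes "h \<in> C"
  shows "pCons a p \<odot>\<^bsub>S\<^esub> h = vadd (vscale a h) (p \<odot>\<^bsub>S\<^esub> T h)"
proof
  fix j
  have *: "coeff p i \<odot>\<^bsub>V j\<^esub> (T ^^ i) h' j \<in> carrier (V j)" if "h' \<in> C" for h' i and p :: "'k poly"
    using that by (simp add: C_D t_shift_pow_closed)
  have "(pCons a p \<odot>\<^bsub>S\<^esub> h) j
      = finsum (V j) (\<lambda>i. coeff (pCons a p) i \<odot>\<^bsub>V j\<^esub> (T ^^ i) h j) {..Suc (degree p)}"
    using assms by (intro smult_S_upto degree_pCons_le)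
  also have "\<dots> = finsum (V j) (\<lambda>i. coeff (pCons a p) (Suc i) \<odot>\<^bsub>V j\<^esub> (T ^^ Suc i) h j) {..degree p}
      \<oplus>\<^bsub>V j\<^esub> coeff (pCons a p) 0 \<odot>\<^bsub>V j\<^esub> (T ^^ 0) h j"
    by (subst V.finsum_Suc2) (use *[OF assms] in auto)
  also have "\<dots> = (p \<odot>\<^bsub>S\<^esub> T h) j \<oplus>\<^bsub>V j\<^esub> a \<odot>\<^bsub>V j\<^esub> h j"
    by (simp add: smult_S_upto[OF t_shift_closed[OF assms] order.refl] funpow_swap1)
  also have "\<dots> = a \<odot>\<^bsub>V j\<^esub> h j \<oplus>\<^bsub>V j\<^esub> (p \<odot>\<^bsub>S\<^esub> T h) j"
    using assms *[OF t_shift_closed[OF assms]]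
    by (intro V.a_comm)
      (auto simp: smult_S_upto[OF t_shift_closed[OF assms] order.refl] C_D intro!: V.finsum_closed)
  finally show "(pCons a p \<odot>\<^bsub>S\<^esub> h) j = vadd (vscale a h) (p \<odot>\<^bsub>S\<^esub> T h) j"
    by (simp add: vadd_def vscale_def)
qed

lemma smult_S_0: "h \<in> C \<Longrightarrow> 0 \<odot>\<^bsub>S\<^esub> h = vzero'"
proof
  fix j assume "h \<in> C"
  then show "(0 \<odot>\<^bsub>S\<^esub> h) j = vzero' j"
    using smult_S_upto[of h 0 0 j] C_D[of h j] by (simp add: vzero'_def)
qed

lemma t_shift_vadd: "g \<in> C \<Longrightarrow> h \<in> C \<Longrightarrow> T (vadd g h) = vadd (T g) (T h)"
proof
  fix j assume "g \<in> C" "h \<in> C"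
  then show "T (vadd g h) j = vadd (T g) (T h) j"
    using tau[of "j - 1"] C_D[of g "j - 1"] C_D[of h "j - 1"]
    by (simp add: t_shift_def vadd_def linear_map_def)
qed

lemma t_shift_vscale: "h \<in> C \<Longrightarrow> T (vscale a h) = vscale a (T h)"
proof
  fix j assume "h \<in> C"
  then show "T (vscale a h) j = vscale a (T h) j"
    using tau[of "j - 1"] C_D[of h "j - 1"]
    by (simp add: t_shift_def vscale_def linear_map_def)
qed

lemma vscale_simps:
  assumes "g \<in> C" "h \<in> C"
  shows "vscale a (vadd g h) = vadd (vscale a g) (vscale a h)"
    "vscale (a + b) h = vadd (vscale a h) (vscale b h)"
    "vscale (a * b) h = vscale a (vscale b h)"
    "vscale 1 h = h" "vscale 0 h = vzero'" "vscale a vzero' = vzero'"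
  using C_D[OF assms(1)] C_D[OF assms(2)] V.smult_l_distr V.smult_assoc1 V.smult_one V.smult_r_null
  by (auto simp: vscale_def vadd_def vzero'_def V.smult_r_distr fun_eq_iff)

lemma vadd_ac:
  assumes "f \<in> C" "g \<in> C" "h \<in> C"
  shows "vadd (vadd f g) h = vadd f (vadd g h)" "vadd f g = vadd g f"
    "vadd f (vadd g h) = vadd g (vadd f h)" "vadd f vzero' = f" "vadd vzero' f = f"
  using assms S.a_assoc S.a_comm S.a_lcomm S.r_zero S.l_zero unfolding S_simps by auto

lemma smult_S_closed: "h \<in> C \<Longrightarrow> p \<odot>\<^bsub>S\<^esub> h \<in> C"
  by (induction p arbitrary: h)
    (auto simp: smult_S_0 smult_S_pCons vzero_closed vadd_closed vscale_closed t_shift_closed)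

lemmas closed = smult_S_closed vadd_closed vscale_closed t_shift_closed vzero_closed

lemma smult_S_add:
  "h \<in> C \<Longrightarrow> (p + q) \<odot>\<^bsub>S\<^esub> h = vadd (p \<odot>\<^bsub>S\<^esub> h) (q \<odot>\<^bsub>S\<^esub> h)"
  by (induction p q arbitrary: h rule: poly_induct2)
    (auto simp: smult_S_0 smult_S_pCons vadd_ac vscale_simps closed)

lemma t_shift_vzero: "T vzero' = vzero'"
proof
  show "T vzero' j = vzero' j" for j
    using tau_zero[of "j - 1"] by (simp add: t_shift_def vzero'_def)
qed

lemma smult_S_vadd:
  "g \<in> C \<Longrightarrow> h \<in> C \<Longrightarrow> p \<odot>\<^bsub>S\<^esub> (vadd g h) = vadd (p \<odot>\<^bsub>S\<^esub> g) (p \<odot>\<^bsub>S\<^esub> h)"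
  by (induction p arbitrary: g h)
    (auto simp: smult_S_0 smult_S_pCons vadd_ac vscale_simps closed t_shift_vadd)

lemma smult_S_t_shift: "h \<in> C \<Longrightarrow> p \<odot>\<^bsub>S\<^esub> T h = T (p \<odot>\<^bsub>S\<^esub> h)"
  by (induction p arbitrary: h)
    (auto simp: smult_S_0 smult_S_pCons closed t_shift_vadd t_shift_vscale t_shift_vzero)

lemma vscale_commute: "h \<in> C \<Longrightarrow> vscale a (vscale b h) = vscale b (vscale a h)"
  by (metis mult.commute vscale_simps(3))

lemma smult_S_smult: "h \<in> C \<Longrightarrow> Polynomial.smult a p \<odot>\<^bsub>S\<^esub> h = vscale a (p \<odot>\<^bsub>S\<^esub> h)"
  by (induction p arbitrary: h)
    (auto simp: smult_S_0 smult_S_pCons vscale_simps closed)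

lemma smult_S_mult: "h \<in> C \<Longrightarrow> (p * q) \<odot>\<^bsub>S\<^esub> h = p \<odot>\<^bsub>S\<^esub> (q \<odot>\<^bsub>S\<^esub> h)"
  by (induction p arbitrary: h)
    (auto simp: smult_S_0 smult_S_pCons smult_S_add smult_S_smult smult_S_t_shift[symmetric]
      vscale_simps vadd_ac closed)

lemma smult_S_const: "h \<in> C \<Longrightarrow> [:c:] \<odot>\<^bsub>S\<^esub> h = vscale c h"
  by (simp add: smult_S_pCons smult_S_0 vadd_ac closed)

lemma smult_S_one: "h \<in> C \<Longrightarrow> 1 \<odot>\<^bsub>S\<^esub> h = h"
  by (simp add: one_pCons smult_S_const vscale_simps)

lemma smult_S_tvar: "h \<in> C \<Longrightarrow> tvar \<odot>\<^bsub>S\<^esub> h = T h"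
  by (simp add: smult_S_pCons[of h 0] smult_S_const vscale_simps vadd_ac closed)

lemma module_S: "Module.module type_ring S"
proof (rule moduleI)
  show "cring (type_ring :: 'k poly ring)" by (rule cring_type_ring)
qed (unfold S_simps,
  auto simp: type_ring_def abelian_group_S closed smult_S_add smult_S_vadd smult_S_mult smult_S_one)

lemma finsum_S:
  assumes "finite A" "\<And>j. h j \<in> C"
  shows "finsum S h A i = finsum (V i) (\<lambda>j. h j i) A"
  using assms(1)
proof (induction A rule: finite_induct)
  case empty then show ?case by (simp add: S_simps vzero'_def)
next
  case (insert x A)
  have "finsum S h (insert x A) = vadd (h x) (finsum S h A)"
    using insert assms(2) by (subst S.finsum_insert) (auto simp: S_simps)
  moreover have "finsum (V i) (\<lambda>j. h j i) (insert x A) = h x i \<oplus>\<^bsub>V i\<^esub> finsum (V i) (\<lambda>j. h j i) A"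
    using insert assms(2) by (subst V.finsum_insert) (auto simp: C_D)
  ultimately show ?case using insert by (simp add: vadd_def)
qed

lemma finsum_S_grade:
  assumes h: "\<And>j. h j \<in> grade S j" and fin: "finite {j. h j \<noteq> vzero'}"
  shows "finsum S h {j. h j \<noteq> vzero'} i = h i i"
proof -
  let ?A = "{j. h j \<noteq> vzero'}"
  have hC: "\<And>j. h j \<in> C" and h0: "\<And>j. i \<noteq> j \<Longrightarrow> h j i = \<zero>\<^bsub>V i\<^esub>"
    using h unfolding S_simps by blast+
  have "finsum S h ?A i = finsum (V i) (\<lambda>j. h j i) ?A"
    using fin hC by (rule finsum_S)
  also have "\<dots> = finsum (V i) (\<lambda>j. h j i) (insert i ?A)"
    using fin hC by (intro V.add.finprod_mono_neutral_cong_left) (auto simp: C_D vzero'_def)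
  also have "\<dots> = finsum (V i) (\<lambda>j. if i = j then h j i else \<zero>\<^bsub>V i\<^esub>) (insert i ?A)"
    using hC h0 by (intro V.finsum_cong') (auto simp: C_D)
  also have "\<dots> = h i i"
    using fin hC by (intro V.finsum_singleton) (auto simp: C_D)
  finally show ?thesis .
qed

theorem graded_direct_sum: "graded_kt_module S"
proof -
  have "additive_subgroup (grade S j) S" for j
  proof (rule additive_subgroupI, rule S.add.subgroupI)
    show "grade S j \<subseteq> carrier S" by (auto simp: S_simps)
    have "vzero' \<in> grade S j" unfolding S_simps by (simp add: closed) (simp add: vzero'_def)
    then show "grade S j \<noteq> {}" by blast
    show "a \<oplus>\<^bsub>S\<^esub> b \<in> grade S j" if "a \<in> grade S j" "b \<in> grade S j" for a b
      using that by (auto simp: S_simps closed) (auto simp: vadd_def)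
    show "\<ominus>\<^bsub>S\<^esub> a \<in> grade S j" if "a \<in> grade S j" for a
    proof -
      have a: "a \<in> C" using that by (simp add: S_simps)
      have "vadd (vscale (-1) a) a = vadd (vscale (-1) a) (vscale 1 a)"
        using a by (simp add: vscale_simps)
      also have "\<dots> = vscale (-1 + 1) a"
        using a by (simp only: vscale_simps)
      finally have "vadd (vscale (-1) a) a = vzero'" using a by (simp add: vscale_simps)
      then have "\<ominus>\<^bsub>S\<^esub> a = vscale (-1) a"
        using a closed S.minus_equality[of "vscale (-1) a" a] unfolding S_simps by blast
      then show ?thesis using that V.smult_r_null
        by (auto simp: S_simps closed vscale_def[of _ a])
           (auto simp: vscale_def[symmetric] closed)
    qed
  qed
  moreover have "[:c:] \<odot>\<^bsub>S\<^esub> x \<in> grade S j" if "x \<in> grade S j" for c x j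
    using that V.smult_r_null by (auto simp: S_simps smult_S_const closed) (auto simp: vscale_def)
  moreover have "tvar \<odot>\<^bsub>S\<^esub> x \<in> grade S (j + 1)" if "x \<in> grade S j" for x j
  proof -
    have "T x i = \<zero>\<^bsub>V i\<^esub>" if "i \<noteq> j + 1" for i
    proof -
      have "x (i - 1) = \<zero>\<^bsub>V (i - 1)\<^esub>" using \<open>x \<in> grade S j\<close> that by (auto simp: S_simps)
      then show ?thesis using tau_zero[of "i - 1"] by (simp add: t_shift_def)
    qed
    then show ?thesis using that by (auto simp: S_simps smult_S_tvar closed)
  qed
  moreover have "\<exists>!h. (\<forall>j. h j \<in> grade S j) \<and> finite {j. h j \<noteq> \<zero>\<^bsub>S\<^esub>} \<and>
        x = finsum S h {j. h j \<noteq> \<zero>\<^bsub>S\<^esub>}" if "x \<in> carrier S" for x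
  proof (rule ex1I)
    have x: "x \<in> C" using that by (simp add: S_simps)
    define d where "d j = (\<lambda>i. if i = j then x j else \<zero>\<^bsub>V i\<^esub>)" for j
    have "finite {i. d j i \<noteq> \<zero>\<^bsub>V i\<^esub>}" for j
      by (rule finite_subset[of _ "{j}"]) (auto simp: d_def)
    then have d: "d j \<in> grade S j" for j
      using C_D[OF x] by (auto simp: S_simps direct_sum_carrier_def d_def)
    have "{j. d j \<noteq> \<zero>\<^bsub>S\<^esub>} \<subseteq> {j. x j \<noteq> \<zero>\<^bsub>V j\<^esub>}"
      by (auto simp: S_simps d_def vzero'_def fun_eq_iff)
    then have fin: "finite {j. d j \<noteq> \<zero>\<^bsub>S\<^esub>}"
      using x by (auto simp: direct_sum_carrier_def intro: finite_subset)
    have "x = finsum S d {j. d j \<noteq> \<zero>\<^bsub>S\<^esub>}"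
      using finsum_S_grade[of d] d fin unfolding S_simps(2) by (auto simp: fun_eq_iff d_def)
    then show "(\<forall>j. d j \<in> grade S j) \<and> finite {j. d j \<noteq> \<zero>\<^bsub>S\<^esub>} \<and>
        x = finsum S d {j. d j \<noteq> \<zero>\<^bsub>S\<^esub>}"
      using d fin by blast
    fix h assume h: "(\<forall>j. h j \<in> grade S j) \<and> finite {j. h j \<noteq> \<zero>\<^bsub>S\<^esub>} \<and>
        x = finsum S h {j. h j \<noteq> \<zero>\<^bsub>S\<^esub>}"
    then have "x i = h i i" for i
      using finsum_S_grade[of h i] by (simp add: S_simps(2))
    then have "h j i = d j i" for i j
      using h by (auto simp: d_def S_simps(4))
    then show "h = d" by (simp add: fun_eq_iff)
  qed
  ultimately show ?thesis
    unfolding graded_kt_module_def using module_S by blast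
qed

end

lemma graded_persistent_homology:
  assumes "\<And>j. F j \<subseteq> F (j + 1)"
  shows "graded_kt_module (persistent_homology F q)"
  unfolding persistent_homology_def
  by (intro vs_sequence.graded_direct_sum vs_sequence.intro module_homology
      linear_map_homology_incl assms)

lemma graded_zero_kt: "graded_kt_module (zero_kt :: ('k::field, unit) gmodule)"
proof -
  interpret abelian_group "zero_kt :: ('k, unit) gmodule"
    by (rule abelian_groupI) (auto simp: zero_kt_def)
  have "Module.module type_ring (zero_kt :: ('k, unit) gmodule)"
    by (rule moduleI[OF cring_type_ring abelian_group_axioms]) (auto simp: zero_kt_def)
  moreover have "additive_subgroup UNIV (zero_kt :: ('k, unit) gmodule)"
    by (rule additive_subgroupI, rule add.subgroupI) (auto simp: zero_kt_def)
  moreover have "grade (zero_kt :: ('k, unit) gmodule) j = UNIV" for j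
    by (simp add: zero_kt_def)
  ultimately show ?thesis
    unfolding graded_kt_module_def by (auto intro!: ext)
qed

lemma graded_free_kt: "graded_kt_module (free_kt a :: ('k::field, 'k poly) gmodule)"
proof -
  let ?M = "free_kt a :: ('k, 'k poly) gmodule"
  have M: "carrier ?M = UNIV" "\<And>x y. x \<oplus>\<^bsub>?M\<^esub> y = x + y" "\<zero>\<^bsub>?M\<^esub> = 0" "\<And>x y. x \<odot>\<^bsub>?M\<^esub> y = x * y"
    "\<And>j. grade ?M j = (if a \<le> j then {monom c (nat (j - a)) | c. True} else {0})"
    by (simp_all add: free_kt_def)
  interpret abelian_group ?M
    by (rule abelian_groupI) (auto simp: M add_ac intro: exI[of _ "- x" for x] left_minus)
  have module: "Module.module type_ring ?M"
    by (rule moduleI[OF cring_type_ring abelian_group_axioms]) (auto simp: M type_ring_def algebra_simps)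
  have minus: "\<ominus>\<^bsub>?M\<^esub> x = - x" for x
    using minus_equality[of "- x" x] by (simp add: M)
  have subgroup: "additive_subgroup (grade ?M j) ?M" for j
    by (rule additive_subgroupI, rule add.subgroupI)
      (auto simp: M minus add_monom minus_monom)
  have "[:c:] * x \<in> grade ?M j" if "x \<in> grade ?M j" for c x j
    using that by (auto simp: M smult_monom split: if_splits)
  moreover have "tvar * x \<in> grade ?M (j + 1)" if x: "x \<in> grade ?M j" for x j
  proof (cases "a \<le> j")
    case True
    then obtain c where "x = monom c (nat (j - a))" using x by (auto simp: M)
    moreover have "nat (j + 1 - a) = Suc (nat (j - a))" using True by simp
    ultimately show ?thesis using True by (auto simp: M monom_Suc)
  next
    case False
    then have "x = 0" "0 = monom 0 (nat (j + 1 - a))" using x by (auto simp: M)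
    then show ?thesis by (auto simp: M)
  qed
  moreover have "\<exists>!h. (\<forall>j. h j \<in> grade ?M j) \<and> finite {j. h j \<noteq> 0} \<and>
        p = finsum ?M h {j. h j \<noteq> 0}" for p
  proof (rule ex1I)
    have fs: "finsum ?M h A = sum h A" if "finite A" for h :: "int \<Rightarrow> 'k poly" and A
      using that by (induction A rule: finite_induct) (auto simp: M)
    have co: "coeff (sum h {j. h j \<noteq> 0}) n = coeff (h (a + int n)) n"
      if h: "\<And>j. h j \<in> grade ?M j" and fin: "finite {j. h j \<noteq> 0}" for h n
    proof -
      have *: "coeff (h j) n = 0" if "j \<noteq> a + int n" for j
        using h[of j] that by (auto simp: M coeff_monom split: if_splits)
      have "coeff (sum h {j. h j \<noteq> 0}) n = (\<Sum>j\<in>{j. h j \<noteq> 0}. coeff (h j) n)"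
        by (simp add: coeff_sum)
      also have "\<dots> = (\<Sum>j\<in>insert (a + int n) {j. h j \<noteq> 0}. coeff (h j) n)"
        using fin by (intro sum.mono_neutral_left) auto
      also have "\<dots> = (\<Sum>j\<in>{a + int n}. coeff (h j) n)"
        using fin * by (intro sum.mono_neutral_right) auto
      finally show ?thesis by simp
    qed
    define d where "d j = (if a \<le> j then monom (coeff p (nat (j - a))) (nat (j - a)) else 0)" for j
    have d: "\<forall>j. d j \<in> grade ?M j" by (auto simp: M d_def)
    have "{j. d j \<noteq> 0} \<subseteq> {a..a + int (degree p)}"
    proof
      fix j assume "j \<in> {j. d j \<noteq> 0}"
      then have "a \<le> j" "coeff p (nat (j - a)) \<noteq> 0" by (auto simp: d_def split: if_splits)
      with le_degree[of p "nat (j - a)"] show "j \<in> {a..a + int (degree p)}" by auto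
    qed
    then have fin: "finite {j. d j \<noteq> 0}" by (rule finite_subset) simp
    have "p = sum d {j. d j \<noteq> 0}"
      using co[of d] d fin by (intro poly_eqI) (auto simp: d_def)
    with d fin show "(\<forall>j. d j \<in> grade ?M j) \<and> finite {j. d j \<noteq> 0} \<and>
        p = finsum ?M d {j. d j \<noteq> 0}" by (simp add: fs)
    fix h assume h: "(\<forall>j. h j \<in> grade ?M j) \<and> finite {j. h j \<noteq> 0} \<and>
        p = finsum ?M h {j. h j \<noteq> 0}"
    have p: "coeff p n = coeff (h (a + int n)) n" for n
    proof -
      from h have "p = sum h {j. h j \<noteq> 0}" by (metis fs)
      then show ?thesis using co[of h n] h by metis
    qed
    show "h = d"
    proof
      fix j
      show "h j = d j"
      proof (cases "a \<le> j")
        case True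
        have "h j \<in> grade ?M j" using h by blast
        with True obtain c where "h j = monom c (nat (j - a))" by (auto simp: M)
        then show ?thesis using True p[of "nat (j - a)"] by (simp add: d_def)
      next
        case False
        then show ?thesis using h by (auto simp: M d_def split: if_splits)
      qed
    qed
  qed
  ultimately show ?thesis
    unfolding graded_kt_module_def using module subgroup by (simp add: M(1,3,4))
qed

end

theory Submission
  imports Defs
begin

text \<open>
  Write \<open>\<delta> = 2\<epsilon>\<close>, \<open>m = Q + 1\<close> and \<open>N\<close> for the filtered nerve. The interleavings in the definition of an
  \<open>\<epsilon>\<close>-acyclic cover enter through one consequence only (\<open>interleavings_fill\<close>): every cycle of the
  augmented chain complex of \<open>U\<^sub>I\<close> at level \<open>j\<close> bounds at level \<open>j + \<delta>\<close>.

  The space and the nerve are compared inside one filtered chain complex. Its cells are the pairs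
  \<open>(\<sigma>, I)\<close>, where \<open>\<sigma>\<close> is a simplex of \<open>X\<close> or empty, \<open>I\<close> is a simplex of \<open>N\<close> or empty, not both are
  empty, and \<open>\<sigma>\<close> lies in \<open>U\<^sub>I\<close> if neither is. One may think of \<open>(\<sigma>, I)\<close> as the join of \<open>\<sigma>\<close> and \<open>I\<close>: the cells
  \<open>(\<sigma>, {})\<close> form a copy of \<open>X\<close>, the cells \<open>({}, I)\<close> a copy of \<open>N\<close>, and the mixed cells glue the two ends
  together. The differential is the sum of two anticommuting parts, which remove a vertex from \<open>\<sigma>\<close> and
  from \<open>I\<close>. For fixed \<open>I \<noteq> {}\<close> the cells \<open>(\<sigma>, I)\<close> form the augmented chain complex of \<open>U\<^sub>I\<close>, which is
  exact up to the shift \<open>\<delta>\<close>. For fixed \<open>\<sigma> \<noteq> {}\<close> the cells \<open>(\<sigma>, I)\<close> form the augmented chain complex of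
  the full simplex on all \<open>i\<close> with \<open>\<sigma>\<close> in \<open>U\<^sub>i\<close>, which is exact.

  Two facts about such a double complex carry the proof. Solving one column equation after the other
  moves chains from one end to the other (\<open>transfer_map\<close>), by a chain map that is chain homotopic to
  the inclusion of the first end into the double complex. And a cycle of one end that bounds in the double complex
  already bounds in that end at a later level (\<open>bounds_in_end\<close>), because the mixed part of the
  bounding chain can be pushed off layer by layer. Every step costs \<open>\<delta>\<close>, and there are at most \<open>m\<close> of
  them: the steps increase the size of \<open>\<sigma>\<close> and decrease the size of \<open>I\<close>, and one of these sizes is at
  most \<open>m\<close>, which is why the smaller of the two dimensions appears in the bound.

  Applied in both directions, with cost \<open>\<delta>\<close> per step in one and \<open>0\<close> in the other, these facts give chain
  maps \<open>\<Phi>\<close> from \<open>X\<close> to \<open>N\<close> without shift and \<open>\<Psi>\<close> from \<open>N\<close> to \<open>X\<close> with shift \<open>m\<delta>\<close> (\<open>chain_maps\<close>). On cycles,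
  \<open>\<Psi>\<Phi>\<close> and the identity of \<open>X\<close> differ by a boundary after the shift \<open>m\<delta>\<close> for \<open>\<Psi>\<close> and another \<open>m\<delta>\<close> for
  returning from the double complex to \<open>X\<close>; for \<open>\<Phi>\<Psi>\<close> the first of these is enough. Hence \<open>\<Phi>\<close> and \<open>\<Psi>\<close>
  induce an interleaving with parameter \<open>m\<delta> = 2(Q + 1)\<epsilon>\<close>.
\<close>

section \<open>Linear maps on finitely supported chains\<close>

abbreviation pscale :: "'k::field \<Rightarrow> ('b \<Rightarrow>\<^sub>0 'k) \<Rightarrow> ('b \<Rightarrow>\<^sub>0 'k)" where
  "pscale a \<equiv> Poly_Mapping.map ((*) a)"

lemma lookup_pscale [simp]: "Poly_Mapping.lookup (pscale a c) x = a * Poly_Mapping.lookup c x"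
  by transfer (simp add: when_def)

lemma pscale_simps [simp]:
  fixes c d :: "'b \<Rightarrow>\<^sub>0 'k::field"
  shows "pscale 0 c = 0" "pscale 1 c = c" "pscale a 0 = 0"
    "pscale a (- c) = - pscale a c" "pscale a (pscale b c) = pscale (a * b) c"
    "pscale a (Poly_Mapping.single x b) = Poly_Mapping.single x (a * b)"
  by (rule poly_mapping_eqI; simp add: lookup_single when_def)+

lemma pscale_distrib:
  fixes c d :: "'b \<Rightarrow>\<^sub>0 'k::field"
  shows "pscale a (c + d) = pscale a c + pscale a d" "pscale (a + b) c = pscale a c + pscale b c"
  by (rule poly_mapping_eqI; simp add: algebra_simps lookup_add)+

lemma pscale_minus_one: "pscale (-1) c = - (c :: 'b \<Rightarrow>\<^sub>0 'k::field)"
  by (rule poly_mapping_eqI) simp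

lemma pscale_sum: "pscale a (sum f A) = (\<Sum>x\<in>A. pscale (a::'k::field) (f x))"
  by (induction A rule: infinite_finite_induct) (auto simp: pscale_distrib)

abbreviation gen :: "'b \<Rightarrow> ('b \<Rightarrow>\<^sub>0 'k::field)" where
  "gen x \<equiv> Poly_Mapping.single x 1"

text \<open>Linear extension. All maps below are given by their values on generators; this allows the values
  to be chosen by recursion, once for all levels of a filtration.\<close>

definition lext :: "('a \<Rightarrow> ('b \<Rightarrow>\<^sub>0 'k::field)) \<Rightarrow> ('a \<Rightarrow>\<^sub>0 'k) \<Rightarrow> ('b \<Rightarrow>\<^sub>0 'k)" where
  "lext f c = (\<Sum>x\<in>Poly_Mapping.keys c. pscale (Poly_Mapping.lookup c x) (f x))"

lemma lext_superset:
  assumes "finite S" "Poly_Mapping.keys c \<subseteq> S"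
  shows "lext f c = (\<Sum>x\<in>S. pscale (Poly_Mapping.lookup c x) (f x))"
  unfolding lext_def using assms by (intro sum.mono_neutral_left) (auto simp: in_keys_iff)

lemma lext_0 [simp]: "lext f 0 = 0"
  by (simp add: lext_def)

lemma lext_add: "lext f (c + d) = lext f c + lext f d"
proof -
  let ?S = "Poly_Mapping.keys c \<union> Poly_Mapping.keys d"
  have "Poly_Mapping.keys (c + d) \<subseteq> ?S" by (rule Poly_Mapping.keys_add)
  then show ?thesis
    by (simp add: lext_superset[of ?S] lookup_add pscale_distrib sum.distrib)
qed

lemma lext_pscale: "lext f (pscale a c) = pscale a (lext f c)"
proof -
  have "Poly_Mapping.keys (pscale a c) \<subseteq> Poly_Mapping.keys c" by (auto simp: in_keys_iff)
  then show ?thesis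
    by (simp add: lext_superset[of "Poly_Mapping.keys c"] pscale_sum)
qed

lemma lext_uminus: "lext f (- c) = - lext f c"
  using lext_pscale[of f "-1" c] by (simp add: pscale_minus_one)

lemma lext_diff: "lext f (c - d) = lext f c - lext f d"
  using lext_add[of f c "- d"] by (simp add: lext_uminus)

lemma lext_sum: "lext f (sum g A) = (\<Sum>x\<in>A. lext f (g x))"
  by (induction A rule: infinite_finite_induct) (auto simp: lext_add)

lemma lext_single [simp]: "lext f (Poly_Mapping.single x a) = pscale a (f x)"
  by (simp add: lext_superset[of "{x}"])

lemma lext_gen: "lext gen c = c"
  by (rule poly_mapping_eqI)
    (simp add: lext_def lookup_sum lookup_single when_def in_keys_iff)

lemma lext_lext: "lext f (lext g c) = lext (\<lambda>x. lext f (g x)) c"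
  by (simp add: lext_def[of g] lext_sum lext_pscale lext_def[of "\<lambda>x. lext f (g x)"])

lemma lext_cong:
  "(\<And>x. x \<in> Poly_Mapping.keys c \<Longrightarrow> f x = g x) \<Longrightarrow> lext f c = lext g c"
  by (auto simp: lext_def intro: sum.cong)

lemma lext_plus_fun: "lext (\<lambda>x. f x + g x) c = lext f c + lext g c"
  by (simp add: lext_def pscale_distrib sum.distrib)

lemma lext_uminus_fun: "lext (\<lambda>x. - f x) c = - lext f c"
  by (simp add: lext_def sum_negf)

lemma lext_diff_fun: "lext (\<lambda>x. f x - g x) c = lext f c - lext g c"
  using lext_plus_fun[of f "\<lambda>x. - g x" c] by (simp add: lext_uminus_fun)

lemma lext_pscale_fun: "lext (\<lambda>x. pscale a (f x)) c = pscale a (lext f c)"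
  by (simp add: lext_def pscale_sum mult.commute)

definition supp_in :: "'b set \<Rightarrow> ('b \<Rightarrow>\<^sub>0 'k::field) set" where
  "supp_in S = {c. Poly_Mapping.keys c \<subseteq> S}"

lemma supp_in_mono: "c \<in> supp_in S \<Longrightarrow> S \<subseteq> T \<Longrightarrow> c \<in> supp_in T"
  by (auto simp: supp_in_def)

lemma supp_in_0 [simp]: "0 \<in> supp_in S"
  by (simp add: supp_in_def)

lemma supp_in_add: "c \<in> supp_in S \<Longrightarrow> d \<in> supp_in S \<Longrightarrow> c + d \<in> supp_in S"
  using Poly_Mapping.keys_add[of c d] by (auto simp: supp_in_def)

lemma supp_in_pscale: "c \<in> supp_in S \<Longrightarrow> pscale a c \<in> supp_in S"
  by (auto simp: supp_in_def in_keys_iff)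

lemma supp_in_uminus: "c \<in> supp_in S \<Longrightarrow> - c \<in> supp_in S"
  by (simp add: supp_in_def)

lemma supp_in_diff: "c \<in> supp_in S \<Longrightarrow> d \<in> supp_in S \<Longrightarrow> c - d \<in> supp_in S"
  using supp_in_add[of c S "- d"] by (simp add: supp_in_uminus)

lemma supp_in_sum: "(\<And>x. x \<in> A \<Longrightarrow> f x \<in> supp_in S) \<Longrightarrow> sum f A \<in> supp_in S"
  by (induction A rule: infinite_finite_induct) (auto simp: supp_in_add)

lemma supp_in_single: "x \<in> S \<Longrightarrow> Poly_Mapping.single x a \<in> supp_in S"
  by (auto simp: supp_in_def)

lemma supp_in_lext:
  assumes "c \<in> supp_in S" "\<And>x. x \<in> S \<Longrightarrow> f x \<in> supp_in T"
  shows "lext f c \<in> supp_in T"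
  using assms unfolding lext_def
  by (intro supp_in_sum supp_in_pscale) (auto simp: supp_in_def)

lemma supp_in_empty: "c \<in> supp_in {} \<longleftrightarrow> c = 0"
  by (auto simp: supp_in_def)

definition restr :: "'b set \<Rightarrow> ('b \<Rightarrow>\<^sub>0 'k::field) \<Rightarrow> ('b \<Rightarrow>\<^sub>0 'k)" where
  "restr S = lext (\<lambda>x. if x \<in> S then gen x else 0)"

lemma lookup_restr:
  "Poly_Mapping.lookup (restr S c) x = (if x \<in> S then Poly_Mapping.lookup c x else 0)"
proof -
  have "Poly_Mapping.lookup (restr S c) x =
     (\<Sum>y\<in>Poly_Mapping.keys c. if y = x then (if x \<in> S then Poly_Mapping.lookup c x else 0) else 0)"
    unfolding restr_def lext_def lookup_sum
    by (rule sum.cong) (auto simp: lookup_single)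
  then show ?thesis by (simp add: in_keys_iff)
qed

lemma restr_supp: "c \<in> supp_in S \<Longrightarrow> restr T c \<in> supp_in (S \<inter> T)"
  by (auto simp: supp_in_def in_keys_iff lookup_restr split: if_splits)

lemma diff_restr_supp: "c \<in> supp_in S \<Longrightarrow> c - restr T c \<in> supp_in (S - T)"
  by (auto simp: supp_in_def in_keys_iff lookup_restr lookup_minus split: if_splits)

section \<open>Filtered double complexes with almost exact columns\<close>

text \<open>The cells of a double complex carry two sizes, \<open>q\<close> and \<open>p\<close>. They are sizes, not dimensions: the value
  \<open>0\<close> belongs to the augmentation, so the cells with \<open>q = 0\<close> and those with \<open>p = 0\<close> are the two ends.\<close>

definition bichains :: "(int \<Rightarrow> 'b set) \<Rightarrow> ('b \<Rightarrow> nat) \<Rightarrow> ('b \<Rightarrow> nat) \<Rightarrow> int \<Rightarrow> nat \<Rightarrow> nat \<Rightarrow>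
    ('b \<Rightarrow>\<^sub>0 'k::field) set" where
  "bichains J q p j Q P = supp_in {x \<in> J j. q x = Q \<and> p x = P}"

definition totchains :: "(int \<Rightarrow> 'b set) \<Rightarrow> ('b \<Rightarrow> nat) \<Rightarrow> ('b \<Rightarrow> nat) \<Rightarrow> int \<Rightarrow> nat \<Rightarrow>
    ('b \<Rightarrow>\<^sub>0 'k::field) set" where
  "totchains J q p j n = supp_in {x \<in> J j. q x + p x = n}"

lemma bichains_closed:
  "c \<in> bichains J q p j Q P \<Longrightarrow> c' \<in> bichains J q p j Q P \<Longrightarrow> c + c' \<in> bichains J q p j Q P"
  "c \<in> bichains J q p j Q P \<Longrightarrow> - c \<in> bichains J q p j Q P"
  unfolding bichains_def by (rule supp_in_add supp_in_uminus; assumption)+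

lemma bichains_swap: "bichains J p q j P Q = bichains J q p j Q P"
  by (simp add: bichains_def conj_commute)

lemma totchains_swap: "totchains J p q j n = totchains J q p j n"
  by (simp add: totchains_def add.commute)

lemma bichains_tot: "c \<in> bichains J q p j Q P \<Longrightarrow> n = Q + P \<Longrightarrow> c \<in> totchains J q p j n"
  unfolding bichains_def totchains_def by (erule supp_in_mono) auto

text \<open>A column consists of the cells with a fixed value of \<open>p\<close>, and \<open>D1\<close> is its differential. The assumption
  \<open>exact\<close> says that cycles in the columns with \<open>p \<noteq> 0\<close> bound after a shift by \<open>\<delta>\<close>. There is no shift
  at \<open>q = 0\<close>, which for a cover expresses that a nonempty set has a vertex. The first alternative in \<open>bounded\<close>
  covers exact columns, where the number of steps does not matter.\<close>

locale filtered_double_complex =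
  fixes J :: "int \<Rightarrow> 'b set" and q p :: "'b \<Rightarrow> nat"
    and D1 D2 :: "'b \<Rightarrow> ('b \<Rightarrow>\<^sub>0 'k::field)" and \<delta> m :: nat
  assumes J_mono: "i \<le> j \<Longrightarrow> J i \<subseteq> J j"
    and no_empty_cell: "x \<in> J j \<Longrightarrow> q x \<noteq> 0 \<or> p x \<noteq> 0"
    and D1_supp: "x \<in> J j \<Longrightarrow> D1 x \<in> supp_in {y \<in> J j. Suc (q y) = q x \<and> p y = p x}"
    and D2_supp: "x \<in> J j \<Longrightarrow> D2 x \<in> supp_in {y \<in> J j. q y = q x \<and> Suc (p y) = p x}"
    and D1_D1: "lext D1 (lext D1 c) = 0"
    and D2_D2: "lext D2 (lext D2 c) = 0"
    and D1_D2: "lext D1 (lext D2 c) = - lext D2 (lext D1 c)"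
    and entry: "x \<in> J j \<Longrightarrow> q x = 0 \<Longrightarrow> \<exists>e\<le>j. x \<in> J e \<and> (\<forall>i. x \<in> J i \<longrightarrow> e \<le> i)"
    and exact: "z \<in> bichains J q p j Q P \<Longrightarrow> P \<noteq> 0 \<Longrightarrow> lext D1 z = 0 \<Longrightarrow>
      \<exists>y \<in> bichains J q p (if Q = 0 then j else j + int \<delta>) (Suc Q) P. lext D1 y = z"
    and bounded: "\<delta> = 0 \<or> (\<forall>j. \<forall>x\<in>J j. p x \<le> m) \<or> (\<forall>j. \<forall>x\<in>J j. q x \<le> m)"
begin

abbreviation "Ch \<equiv> bichains J q p"
abbreviation "Tot \<equiv> totchains J q p"

definition d :: "('b \<Rightarrow>\<^sub>0 'k) \<Rightarrow> ('b \<Rightarrow>\<^sub>0 'k)" where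
  "d c = lext D1 c + lext D2 c"

lemma d_simps:
  "d 0 = 0" "d (c + c') = d c + d c'" "d (c - c') = d c - d c'" "d (- c) = - d c"
  by (simp_all add: d_def lext_add lext_diff lext_uminus)

lemma d_d: "d (d c) = 0"
  by (simp add: d_def lext_add D1_D1 D2_D2 D1_D2)

lemma d_lext: "d (lext f c) = lext (\<lambda>x. d (f x)) c"
  by (simp add: d_def lext_lext lext_plus_fun)

lemma Ch_mono: "c \<in> Ch i Q P \<Longrightarrow> i \<le> j \<Longrightarrow> c \<in> Ch j Q P"
  unfolding bichains_def using J_mono by (blast intro: supp_in_mono)

lemma Tot_mono: "c \<in> Tot i n \<Longrightarrow> i \<le> j \<Longrightarrow> c \<in> Tot j n"
  unfolding totchains_def using J_mono by (blast intro: supp_in_mono)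

lemma D1_Ch: "c \<in> Ch j (Suc Q) P \<Longrightarrow> lext D1 c \<in> Ch j Q P"
  unfolding bichains_def
  by (erule supp_in_lext) (auto intro!: supp_in_mono[OF D1_supp])

lemma D2_Ch: "c \<in> Ch j Q (Suc P) \<Longrightarrow> lext D2 c \<in> Ch j Q P"
  unfolding bichains_def
  by (erule supp_in_lext) (auto intro!: supp_in_mono[OF D2_supp])

lemma D1_Ch_0: "c \<in> Ch j 0 P \<Longrightarrow> lext D1 c = 0"
  unfolding bichains_def supp_in_empty[symmetric]
  by (erule supp_in_lext) (auto intro!: supp_in_mono[OF D1_supp])

lemma D2_Ch_0: "c \<in> Ch j Q 0 \<Longrightarrow> lext D2 c = 0"
  unfolding bichains_def supp_in_empty[symmetric]
  by (erule supp_in_lext) (auto intro!: supp_in_mono[OF D2_supp])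

lemma d_Ch_0: "c \<in> Ch j 0 P \<Longrightarrow> d c = lext D2 c"
  by (simp add: d_def D1_Ch_0)

lemma lext_Ch:
  assumes "c \<in> Ch j Q P" "\<And>x. x \<in> J j \<Longrightarrow> q x = Q \<Longrightarrow> p x = P \<Longrightarrow> f x \<in> Ch j' Q' P'"
  shows "lext f c \<in> Ch j' Q' P'"
  using assms unfolding bichains_def by (auto intro: supp_in_lext)

definition ent :: "'b \<Rightarrow> int" where
  "ent x = (LEAST i. x \<in> J i)"

lemma ent:
  assumes "x \<in> J j" "q x = 0"
  shows "x \<in> J (ent x)" "ent x \<le> j"
proof -
  obtain e where e: "e \<le> j" "x \<in> J e" "\<forall>i. x \<in> J i \<longrightarrow> e \<le> i"
    using entry[OF assms] by blast
  then have "ent x = e" unfolding ent_def by (intro Least_equality) auto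
  with e show "x \<in> J (ent x)" "ent x \<le> j" by auto
qed

lemma gen_Ch: "x \<in> J j \<Longrightarrow> gen x \<in> Ch j (q x) (p x)"
  by (auto simp: bichains_def intro: supp_in_single)

text \<open>A chain homotopy \<open>K = k\<^sub>1 + k\<^sub>2 + \<dots>\<close> on the end \<open>q = 0\<close>, with \<open>k\<^sub>i b\<close> of size \<open>q = i\<close>, is built so that
  \<open>d K + K d + id\<close> takes values in the end \<open>p = 0\<close>. Comparing the components with \<open>p \<noteq> 0\<close> leaves the
  equations \<open>D1 k\<^sub>1 b = - b\<close> and \<open>D1 k\<^sub>i\<^sub>+\<^sub>1 b = - (D2 k\<^sub>i b + k\<^sub>i D2 b)\<close>, which \<open>exact\<close> solves one after the other,
  the first for free and each of the others at the cost \<open>\<delta>\<close>. Here \<open>zig i\<close> is \<open>k\<^sub>i\<^sub>+\<^sub>1\<close>. The values are taken at the level \<open>ent b\<close> where \<open>b\<close>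
  first appears, so that one choice serves all levels.\<close>

primrec zig :: "nat \<Rightarrow> 'b \<Rightarrow> ('b \<Rightarrow>\<^sub>0 'k)" where
  "zig 0 b = (SOME y. y \<in> Ch (ent b) 1 (p b) \<and> lext D1 y = - gen b)"
| "zig (Suc i) b = (SOME y. y \<in> Ch (ent b + int (Suc i * \<delta>)) (Suc (Suc i)) (p b - Suc i) \<and>
     lext D1 y = - (lext D2 (zig i b) + lext (zig i) (D2 b)))"

lemma D1_gen: "x \<in> J j \<Longrightarrow> q x = 0 \<Longrightarrow> D1 x = 0"
  using D1_Ch_0[of "gen x" j "p x"] gen_Ch[of x j] by simp

lemma D2_gen_Ch:
  assumes "x \<in> J j" "p x = Suc P" shows "D2 x \<in> Ch j (q x) P"
  using D2_Ch[of "gen x" j "q x" P] gen_Ch[OF assms(1)] assms(2) by simp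

text \<open>The equation for \<open>k\<^sub>i\<^sub>+\<^sub>1\<close> is solvable because its right-hand side is a cycle of the column. This follows
  from the equations for \<open>k\<^sub>i\<close> at \<open>b\<close> and at the cells of \<open>D2 b\<close>, since \<open>D1\<close> and \<open>D2\<close> anticommute
  and \<open>D2 D2 = 0\<close>.\<close>

lemma zig_spec:
  assumes "b \<in> J j" "q b = 0" "i < p b"
  shows "zig i b \<in> Ch (ent b + int (i * \<delta>)) (Suc i) (p b - i)"
    and "lext D1 (zig i b) =
      (case i of 0 \<Rightarrow> - gen b | Suc i' \<Rightarrow> - (lext D2 (zig i' b) + lext (zig i') (D2 b)))"
proof -
  have "zig i b \<in> Ch (ent b + int (i * \<delta>)) (Suc i) (p b - i) \<and> lext D1 (zig i b) =
      (case i of 0 \<Rightarrow> - gen b | Suc i' \<Rightarrow> - (lext D2 (zig i' b) + lext (zig i') (D2 b)))"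
    using assms
  proof (induction i arbitrary: b j)
    case 0
    have b: "b \<in> J (ent b)" by (rule ent[OF 0(1,2)])
    have "- gen b \<in> Ch (ent b) 0 (p b)"
      using bichains_closed(2)[OF gen_Ch[OF b]] 0 by simp
    moreover have "lext D1 (- gen b) = 0"
      using D1_gen[OF 0(1,2)] by (simp add: lext_uminus)
    ultimately have "\<exists>y. y \<in> Ch (ent b) 1 (p b) \<and> lext D1 y = - gen b"
      using exact[of "- gen b" "ent b" 0 "p b"] 0 by auto
    from someI_ex[OF this] show ?case by simp
  next
    case (Suc i)
    define e where "e = ent b"
    have b: "b \<in> J e" unfolding e_def by (rule ent[OF Suc.prems(1,2)])
    obtain l where l: "p b = Suc l" "i < l" using Suc.prems by (cases "p b") auto
    have D2b: "D2 b \<in> Ch e 0 l" using D2_gen_Ch[OF b l(1)] Suc.prems by simp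
    have x: "zig i x \<in> Ch (e + int (i * \<delta>)) (Suc i) (l - i)"
      "lext D1 (zig i x) =
        (case i of 0 \<Rightarrow> - gen x | Suc i' \<Rightarrow> - (lext D2 (zig i' x) + lext (zig i') (D2 x)))"
      if "x \<in> J e" "q x = 0" "p x = l" for x
      using Suc.IH[OF that(1,2)] that l ent(2)[OF that(1,2)] by (auto intro: Ch_mono)
    note IH = Suc.IH[OF b]
    have zb: "zig i b \<in> Ch (e + int (i * \<delta>)) (Suc i) (Suc (l - i))"
      using IH Suc.prems l by (auto simp: e_def Suc_diff_le)
    define r where "r = lext D2 (zig i b) + lext (zig i) (D2 b)"
    have "r \<in> Ch (e + int (i * \<delta>)) (Suc i) (l - i)"
      unfolding r_def by (intro bichains_closed D2_Ch[OF zb] lext_Ch[OF D2b] x)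
    moreover have "lext D1 r = 0"
    proof -
      have 1: "lext D1 (lext (zig i) (D2 b)) = lext (\<lambda>x. case i of 0 \<Rightarrow> - gen x
         | Suc i' \<Rightarrow> - (lext D2 (zig i' x) + lext (zig i') (D2 x))) (D2 b)"
        unfolding lext_lext using D2b x(2)
        by (intro lext_cong) (auto simp: bichains_def supp_in_def)
      have 2: "lext D2 (D2 b) = 0" using D2_D2[of "gen b"] by simp
      have 3: "lext D1 (zig i b) =
        (case i of 0 \<Rightarrow> - gen b | Suc i' \<Rightarrow> - (lext D2 (zig i' b) + lext (zig i') (D2 b)))"
        using IH Suc.prems by simp
      show ?thesis
      proof (cases i)
        case 0
        then show ?thesis
          using 1 3 by (simp add: r_def lext_add D1_D2 lext_uminus lext_uminus_fun lext_gen)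
      next
        case (Suc i')
        have "lext (\<lambda>x. - (lext D2 (zig i' x) + lext (zig i') (D2 x))) (D2 b) =
            - (lext D2 (lext (zig i') (D2 b)) + lext (zig i') (lext D2 (D2 b)))"
          by (simp only: lext_uminus_fun lext_plus_fun lext_lext)
        then show ?thesis
          using 1 2 3 Suc by (simp add: r_def lext_add D1_D2 lext_uminus lext_diff D2_D2)
      qed
    qed
    ultimately obtain y where "y \<in> Ch (e + int (i * \<delta>) + int \<delta>) (Suc (Suc i)) (l - i)"
        "lext D1 y = r"
      using exact[of r "e + int (i * \<delta>)" "Suc i" "l - i"] l by auto
    then have "- y \<in> Ch (ent b + int (Suc i * \<delta>)) (Suc (Suc i)) (p b - Suc i)
        \<and> lext D1 (- y) = - (lext D2 (zig i b) + lext (zig i) (D2 b))"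
      by (auto simp: e_def r_def l lext_uminus algebra_simps intro!: bichains_closed)
    then have "\<exists>y. y \<in> Ch (ent b + int (Suc i * \<delta>)) (Suc (Suc i)) (p b - Suc i)
        \<and> lext D1 y = - (lext D2 (zig i b) + lext (zig i) (D2 b))" by blast
    from someI_ex[OF this] show ?case by simp
  qed
  then show "zig i b \<in> Ch (ent b + int (i * \<delta>)) (Suc i) (p b - i)"
    "lext D1 (zig i b) =
      (case i of 0 \<Rightarrow> - gen b | Suc i' \<Rightarrow> - (lext D2 (zig i' b) + lext (zig i') (D2 b)))" by auto
qed

text \<open>The chain \<open>zig i b\<close> has \<open>q = i + 1\<close> and \<open>p = p b - i\<close>. If \<open>p\<close> is bounded by \<open>m\<close>, then \<open>i < m\<close>; if \<open>q\<close> is, then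
  either \<open>i < m\<close> or there are no cells of the required size and the chain vanishes.\<close>

lemma zig_cost:
  assumes "b \<in> J j" "q b = 0" "i < p b"
  shows "zig i b \<in> Ch (j + int (m * \<delta>)) (Suc i) (p b - i)"
proof -
  have z: "zig i b \<in> Ch (j + int (i * \<delta>)) (Suc i) (p b - i)"
    using zig_spec(1)[OF assms] ent(2)[OF assms(1,2)] by (auto intro: Ch_mono)
  consider "\<delta> = 0" | "p b \<le> m" | "\<forall>j. \<forall>x\<in>J j. q x \<le> m"
    using bounded assms(1) by blast
  then show ?thesis
  proof cases
    case 1 then show ?thesis using z by simp
  next
    case 2
    then have "i * \<delta> \<le> m * \<delta>" using assms by (intro mult_right_mono) auto
    then have "int (i * \<delta>) \<le> int (m * \<delta>)" by linarith
    then show ?thesis using z by (auto elim!: Ch_mono simp del: of_nat_mult)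
  next
    case 3
    show ?thesis
    proof (cases "Suc i \<le> m")
      case True
      then have "i * \<delta> \<le> m * \<delta>" by (intro mult_right_mono) auto
      then have "int (i * \<delta>) \<le> int (m * \<delta>)" by linarith
      then show ?thesis using z by (auto elim!: Ch_mono simp del: of_nat_mult)
    next
      case False
      with 3 have "{x \<in> J (j + int (i * \<delta>)). q x = Suc i \<and> p x = p b - i} = {}" by fastforce
      with z have "zig i b = 0" unfolding bichains_def supp_in_empty[symmetric] by metis
      then show ?thesis by (simp add: bichains_def)
    qed
  qed
qed

text \<open>The only part of \<open>d K + K d + id\<close> that the equations for \<open>zig\<close> do not cancel is \<open>D2\<close> of the last
  chain, which has \<open>p = 0\<close>. It is therefore the required map \<open>S\<close>, and \<open>S\<close> commutes with \<open>d\<close> because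
  \<open>d K + K d\<close> does.\<close>

theorem transfer_map:
  obtains S K :: "'b \<Rightarrow> ('b \<Rightarrow>\<^sub>0 'k)" where
    "\<And>j n c. c \<in> Ch j 0 (Suc n) \<Longrightarrow> lext S c \<in> Ch (j + int (m * \<delta>)) (Suc n) 0"
    "\<And>j n c. c \<in> Ch j 0 (Suc n) \<Longrightarrow> lext K c \<in> Tot (j + int (m * \<delta>)) (Suc (Suc n))"
    "\<And>j n c. c \<in> Ch j 0 (Suc n) \<Longrightarrow> lext S c - c = d (lext K c) + lext K (d c)"
    "\<And>j n c. c \<in> Ch j 0 (Suc n) \<Longrightarrow> d (lext S c) = lext S (d c)"
proof
  define S where "S b = lext D2 (zig (p b - 1) b)" for b
  define K where "K b = (\<Sum>i<p b. zig i b)" for b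
  have homot: "S b - gen b = d (K b) + lext K (D2 b)"
    if b: "b \<in> J j" "q b = 0" "p b = Suc l" for b j l
  proof -
    have "lext D1 (K b) = (\<Sum>i<Suc l. lext D1 (zig i b))"
      by (simp only: K_def lext_sum b)
    also have "\<dots> = lext D1 (zig 0 b) + (\<Sum>i<l. lext D1 (zig (Suc i) b))"
      by (rule sum.lessThan_Suc_shift)
    also have "\<dots> = - gen b + (\<Sum>i<l. - (lext D2 (zig i b) + lext (zig i) (D2 b)))"
      using zig_spec(2)[OF b(1,2), of 0] zig_spec(2)[OF b(1,2), of "Suc i" for i] b
      by (intro arg_cong2[where f = plus] sum.cong) auto
    finally have 1: "lext D1 (K b) =
      - gen b - (\<Sum>i<l. lext D2 (zig i b)) - (\<Sum>i<l. lext (zig i) (D2 b))"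
      by (simp add: sum_negf sum.distrib sum_subtractf)
    have 2: "lext D2 (K b) = (\<Sum>i<l. lext D2 (zig i b)) + S b"
      by (simp add: K_def lext_sum b S_def lext_add)
    have "D2 b \<in> Ch j 0 l" using D2_gen_Ch[OF b(1,3)] b by simp
    then have "lext K (D2 b) = lext (\<lambda>x. \<Sum>i<l. zig i x) (D2 b)"
      by (intro lext_cong) (auto simp: bichains_def supp_in_def K_def)
    also have "\<dots> = (\<Sum>i<l. lext (zig i) (D2 b))"
      by (simp add: lext_def pscale_sum) (rule sum.swap)
    finally show ?thesis using 1 2 by (simp add: d_def)
  qed
  have D2_homot: "d (S b) = lext S (D2 b)"
    if b: "b \<in> J j" "q b = 0" "p b = Suc l" for b j l
  proof -
    have D2b: "D2 b \<in> Ch j 0 l" using D2_gen_Ch[OF b(1,3)] b by simp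
    have D22: "lext D2 (D2 b) = 0" using D2_D2[of "gen b"] by simp
    have dg: "d (gen b) = D2 b" using D1_gen[OF b(1,2)] by (simp add: d_def)
    have e: "d (S b) - D2 b = d (lext K (D2 b))"
      using arg_cong[OF homot[OF b], of d] by (simp add: d_simps d_d dg)
    show ?thesis
    proof (cases l)
      case 0
      then have "D2 b \<in> supp_in {}"
        using D2b no_empty_cell unfolding bichains_def by (elim supp_in_mono) blast
      then have "D2 b = 0" by (simp add: supp_in_empty)
      then show ?thesis using e by (simp add: d_simps)
    next
      case (Suc l')
      have "lext (\<lambda>x. S x - gen x) (D2 b) = lext (\<lambda>x. d (K x) + lext K (D2 x)) (D2 b)"
        using D2b homot Suc by (intro lext_cong) (auto simp: bichains_def supp_in_def)
      then have "lext S (D2 b) - D2 b = d (lext K (D2 b)) + lext K (lext D2 (D2 b))"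
        by (simp add: lext_diff_fun lext_gen lext_plus_fun d_lext lext_lext)
      then have "lext S (D2 b) - D2 b = d (S b) - D2 b" using D22 e by simp
      then show ?thesis by simp
    qed
  qed
  fix j n and c :: "'b \<Rightarrow>\<^sub>0 'k" assume c: "c \<in> Ch j 0 (Suc n)"
  have dc: "d c = lext D2 c" using c by (rule d_Ch_0)
  show "lext S c \<in> Ch (j + int (m * \<delta>)) (Suc n) 0"
    using c
  proof (rule lext_Ch)
    fix b assume b: "b \<in> J j" "q b = 0" "p b = Suc n"
    show "S b \<in> Ch (j + int (m * \<delta>)) (Suc n) 0"
      using zig_cost[OF b(1,2), of n] b by (auto simp: S_def intro!: D2_Ch)
  qed
  show "lext K c \<in> Tot (j + int (m * \<delta>)) (Suc (Suc n))"
    unfolding totchains_def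
  proof (rule supp_in_lext)
    show "c \<in> supp_in {x \<in> J j. q x = 0 \<and> p x = Suc n}" using c by (simp add: bichains_def)
    fix b assume b: "b \<in> {x \<in> J j. q x = 0 \<and> p x = Suc n}"
    have "zig i b \<in> Tot (j + int (m * \<delta>)) (Suc (Suc n))" if "i < p b" for i
      using that b zig_cost[of b j i] by (auto intro!: bichains_tot)
    then show "K b \<in> supp_in {x \<in> J (j + int (m * \<delta>)). q x + p x = Suc (Suc n)}"
      unfolding K_def totchains_def by (intro supp_in_sum) auto
  qed
  have "lext S c - c = lext (\<lambda>b. S b - gen b) c" by (simp add: lext_diff_fun lext_gen)
  also have "\<dots> = lext (\<lambda>b. d (K b) + lext K (D2 b)) c"
    using c homot by (intro lext_cong) (auto simp: bichains_def supp_in_def)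
  finally show "lext S c - c = d (lext K c) + lext K (d c)"
    by (simp add: lext_plus_fun d_lext lext_lext dc)
  have "d (lext S c) = lext (\<lambda>b. lext S (D2 b)) c"
    unfolding d_lext using c D2_homot by (intro lext_cong) (auto simp: bichains_def supp_in_def)
  then show "d (lext S c) = lext S (d c)" by (simp add: lext_lext dc)
qed

text \<open>For a total degree reason, the component of \<open>d y\<close> with \<open>q = a - 1\<close> is \<open>D1\<close> of the lowest layer of \<open>y\<close>;
  the other contribution would come from a layer below. Since \<open>d y\<close> lies in the end \<open>p = 0\<close>, that
  component vanishes, and the lowest layer is a cycle of its column.\<close>

lemma d_restr_layer:
  assumes y: "y \<in> Tot j (Suc n)" and dy: "d y \<in> Ch j n 0"
    and low: "y \<in> supp_in {x. p x \<noteq> 0 \<longrightarrow> a \<le> q x}" and an: "a \<le> n"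
  defines "ya \<equiv> restr {x. q x = a} y"
  shows "ya \<in> Ch j a (Suc n - a)" "lext D1 ya = 0"
    "y - ya \<in> supp_in {x. p x \<noteq> 0 \<longrightarrow> Suc a \<le> q x}"
proof -
  show ya: "ya \<in> Ch j a (Suc n - a)"
    using restr_supp[OF y[unfolded totchains_def], of "{x. q x = a}"] unfolding bichains_def ya_def
    by (rule supp_in_mono) auto
  have rest: "y - ya \<in> supp_in {x. p x \<noteq> 0 \<longrightarrow> Suc a \<le> q x}"
    using diff_restr_supp[OF low, of "{x. q x = a}"] unfolding ya_def by (rule supp_in_mono) auto
  then show "y - ya \<in> supp_in {x. p x \<noteq> 0 \<longrightarrow> Suc a \<le> q x}" .
  have yT: "y - ya \<in> Tot j (Suc n)"
    using y bichains_tot[OF ya, of "Suc n"] an unfolding totchains_def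
    by (auto intro: supp_in_diff)
  \<comment> \<open>All cells except those with \<open>p \<noteq> 0\<close> in the layer just below the lowest layer of \<open>y\<close>.\<close>
  let ?B = "{x. \<not> (Suc (q x) = a \<and> p x \<noteq> 0)}"
  show "lext D1 ya = 0"
  proof (cases a)
    case 0
    then show ?thesis using ya D1_Ch_0 by auto
  next
    case (Suc a')
    have "lext D1 ya \<in> Ch j a' (Suc n - a)" using ya Suc by (auto intro: D1_Ch)
    then have A: "lext D1 ya \<in> supp_in (- ?B)"
      using Suc an unfolding bichains_def by (auto elim!: supp_in_mono)
    have "lext D1 (y - ya) \<in> supp_in ?B"
    proof (rule supp_in_lext)
      show "y - ya \<in> supp_in {x \<in> J j. p x \<noteq> 0 \<longrightarrow> Suc a \<le> q x}"
        using rest yT by (auto simp: supp_in_def totchains_def)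
    qed (auto intro!: supp_in_mono[OF D1_supp])
    moreover have "lext D2 y \<in> supp_in ?B"
    proof (rule supp_in_lext)
      show "y \<in> supp_in {x \<in> J j. p x \<noteq> 0 \<longrightarrow> a \<le> q x}"
        using low y by (auto simp: supp_in_def totchains_def)
      fix x assume "x \<in> {x \<in> J j. p x \<noteq> 0 \<longrightarrow> a \<le> q x}"
      then show "D2 x \<in> supp_in ?B"
        by (intro supp_in_mono[OF D2_supp[of x j]]) auto
    qed
    moreover have "d y \<in> supp_in ?B"
      using dy unfolding bichains_def by (rule supp_in_mono) auto
    ultimately have "d y - lext D2 y - lext D1 (y - ya) \<in> supp_in ?B"
      by (intro supp_in_diff)
    then have "lext D1 ya \<in> supp_in ?B" by (simp add: d_def lext_diff)
    with A have "lext D1 ya \<in> supp_in (- ?B \<inter> ?B)" unfolding supp_in_def by blast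
    then show ?thesis by (simp add: supp_in_empty)
  qed
qed

text \<open>If the lowest layer is \<open>D1 w\<close>, then subtracting \<open>d w\<close> replaces it by \<open>- D2 w\<close>, which lies one layer
  higher.\<close>

lemma push_layer:
  assumes y: "y \<in> Tot j (Suc n)" and dy: "d y \<in> Ch j n 0"
    and low: "y \<in> supp_in {x. p x \<noteq> 0 \<longrightarrow> a \<le> q x}" and an: "a \<le> n"
  obtains y' where "y' \<in> Tot (if a = 0 then j else j + int \<delta>) (Suc n)" "d y' = d y"
    "y' \<in> supp_in {x. p x \<noteq> 0 \<longrightarrow> Suc a \<le> q x}"
proof -
  let ?j = "if a = 0 then j else j + int \<delta>"
  define ya where "ya = restr {x. q x = a} y"
  note ya = d_restr_layer[OF assms, folded ya_def]
  have n: "Suc n - a = Suc (n - a)" using an by simp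
  obtain w where w: "w \<in> Ch ?j (Suc a) (Suc (n - a))" "lext D1 w = ya"
    using exact[OF ya(1) _ ya(2)] unfolding n by auto
  have D2w: "lext D2 w \<in> Ch ?j (Suc a) (n - a)" using w by (intro D2_Ch)
  have eq: "y - d w = (y - ya) - lext D2 w" by (simp add: d_def w)
  show thesis
  proof (rule that[of "y - d w"])
    have "y \<in> Tot ?j (Suc n)" using y by (rule Tot_mono) auto
    moreover have "ya \<in> Tot ?j (Suc n)"
      by (rule Tot_mono[OF bichains_tot[OF ya(1)]]) (use an in auto)
    moreover have "lext D2 w \<in> Tot ?j (Suc n)"
      using D2w by (rule bichains_tot) (use an in auto)
    ultimately show "y - d w \<in> Tot ?j (Suc n)"
      unfolding eq totchains_def by (intro supp_in_diff)
    show "d (y - d w) = d y" by (simp add: d_simps d_d)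
    have "lext D2 w \<in> supp_in {x. p x \<noteq> 0 \<longrightarrow> Suc a \<le> q x}"
      using D2w unfolding bichains_def by (rule supp_in_mono) auto
    then show "y - d w \<in> supp_in {x. p x \<noteq> 0 \<longrightarrow> Suc a \<le> q x}"
      unfolding eq using ya(3) by (rule supp_in_diff[rotated])
  qed
qed

text \<open>The last assumption says that mixed cells occur in at most \<open>r\<close> layers from \<open>a\<close> on. The
  layer \<open>q = 0\<close> is excluded because pushing it off costs nothing and must not be counted.\<close>

lemma push_layers:
  assumes "y \<in> Tot j (Suc n)" "d y \<in> Ch j n 0" "y \<in> supp_in {x. p x \<noteq> 0 \<longrightarrow> a \<le> q x}" "0 < a"
    "\<And>j x. x \<in> J j \<Longrightarrow> p x \<noteq> 0 \<Longrightarrow> q x + p x = Suc n \<Longrightarrow> q x < a + r"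
  shows "\<exists>y' \<in> Ch (j + int (r * \<delta>)) (Suc n) 0. d y' = d y"
  using assms
proof (induction r arbitrary: a j y)
  case 0
  then have "y \<in> Ch j (Suc n) 0"
    unfolding bichains_def totchains_def supp_in_def by fastforce
  then show ?case by auto
next
  case (Suc r)
  show ?case
  proof (cases "a \<le> n")
    case True
    obtain y' where y': "y' \<in> Tot (j + int \<delta>) (Suc n)" "d y' = d y"
      "y' \<in> supp_in {x. p x \<noteq> 0 \<longrightarrow> Suc a \<le> q x}"
      using push_layer[OF Suc.prems(1-3) True] Suc.prems(4) by auto
    have "d y' \<in> Ch (j + int \<delta>) n 0" unfolding y' using Suc.prems(2) by (rule Ch_mono) simp
    moreover have "q x < Suc a + r" if "x \<in> J j" "p x \<noteq> 0" "q x + p x = Suc n" for x j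
      using Suc.prems(5)[OF that] by simp
    ultimately obtain y'' where "y'' \<in> Ch (j + int \<delta> + int (r * \<delta>)) (Suc n) 0" "d y'' = d y'"
      using Suc.IH[OF y'(1) _ y'(3)] by auto
    then show ?thesis using y'(2) by (auto simp: algebra_simps intro: rev_bexI)
  next
    case False
    have "y \<in> Ch j (Suc n) 0"
      using Suc.prems(1,3) False unfolding bichains_def totchains_def supp_in_def by fastforce
    then have "y \<in> Ch (j + int (Suc r * \<delta>)) (Suc n) 0" by (rule Ch_mono) simp
    then show ?thesis by auto
  qed
qed

text \<open>After the free layer \<open>q = 0\<close>, the sizes with \<open>q + p = n + 1\<close>, \<open>q \<noteq> 0\<close> and \<open>p \<noteq> 0\<close> remain. If \<open>q \<le> m\<close>, these
  are at most the layers \<open>1, \<dots>, m\<close>; if \<open>p \<le> m\<close>, they are at most the layers from \<open>n + 1 - m\<close> to \<open>n\<close>. In both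
  cases \<open>m\<close> steps are enough.\<close>

theorem bounds_in_end:
  assumes y: "y \<in> Tot j (Suc n)" and dy: "d y \<in> Ch j n 0"
  shows "\<exists>y' \<in> Ch (j + int (m * \<delta>)) (Suc n) 0. d y' = d y"
proof -
  obtain y1 where y1: "y1 \<in> Tot j (Suc n)" "d y1 = d y" "y1 \<in> supp_in {x. p x \<noteq> 0 \<longrightarrow> 1 \<le> q x}"
    using push_layer[OF y dy, of 0] by (auto simp: supp_in_def)
  have dy1: "d y1 \<in> Ch j n 0" using dy y1 by simp
  consider "\<delta> = 0" | "\<forall>j. \<forall>x\<in>J j. p x \<le> m" | "\<forall>j. \<forall>x\<in>J j. q x \<le> m"
    using bounded by blast
  then show ?thesis
  proof cases
    case 1
    show ?thesis using push_layers[OF y1(1) dy1 y1(3), of n] y1(2) 1 by simp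
  next
    case 2
    have *: "n + 1 - m \<le> q x" if "x \<in> J j" "q x + p x = Suc n" for x j
      using that 2 by (metis add.commute add_le_cancel_right le_diff_conv Suc_eq_plus1 nat_add_left_cancel_le)
    \<comment> \<open>The lowest layer that can still contain mixed cells, as the layer \<open>q = 0\<close> has been pushed off.\<close>
    let ?a = "max 1 (n + 1 - m)"
    have "y1 \<in> supp_in {x. p x \<noteq> 0 \<longrightarrow> ?a \<le> q x}"
      using y1(1,3) * by (fastforce simp: supp_in_def totchains_def)
    from push_layers[OF y1(1) dy1 this, of m] show ?thesis using y1(2) by auto
  next
    case 3
    have "q x < 1 + m" if "x \<in> J j" for x j using 3 that by (simp add: le_imp_less_Suc)
    with push_layers[OF y1(1) dy1 y1(3), of m] y1(2) show ?thesis by simp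
  qed
qed

end

section \<open>Augmented simplicial chains\<close>

definition simplex_boundary :: "'v set \<Rightarrow> ('v set \<Rightarrow>\<^sub>0 'k::field)" where
  "simplex_boundary \<sigma> = (\<Sum>v\<in>\<sigma>. Poly_Mapping.single (\<sigma> - {v}) ((-1) ^ vertex_index v \<sigma>))"

text \<open>In contrast to \<open>boundary 0\<close>, this map sends a vertex to the empty simplex, so it computes reduced
  homology. In positive degrees it is the boundary map, whatever the degree is.\<close>

definition aug_boundary :: "('v set \<Rightarrow>\<^sub>0 'k::field) \<Rightarrow> ('v set \<Rightarrow>\<^sub>0 'k)" where
  "aug_boundary = lext simplex_boundary"

lemma boundary_Suc: "boundary (Suc n) c = aug_boundary c"
  by (simp add: aug_boundary_def boundary_def lext_def simplex_boundary_def pscale_sum mult.commute)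

lemma aug_boundary_aug_boundary: "aug_boundary (aug_boundary c) = 0"
  using boundary_boundary[of 1 c] by (simp add: boundary_Suc)

text \<open>Joining with the vertex \<open>a\<close>; the sign makes \<open>I\<close> the face of the cone opposite to \<open>a\<close> with
  coefficient \<open>1\<close>.\<close>

definition cone :: "'i \<Rightarrow> 'i set \<Rightarrow> ('i set \<Rightarrow>\<^sub>0 'k::field)" where
  "cone a I = (if a \<in> I then 0
     else Poly_Mapping.single (insert a I) ((-1) ^ vertex_index a (insert a I)))"

text \<open>In a full simplex the cone is a contracting homotopy. The faces of the cone that contain \<open>a\<close> cancel
  against the cone of the boundary: inserting \<open>a\<close> and removing \<open>v\<close> in either order gives opposite signs, because
  exactly one of \<open>a < v\<close> and \<open>v < a\<close> holds in the vertex order.\<close>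

lemma cone_homotopy:
  assumes "finite I"
  shows "lext simplex_boundary (cone a I) + lext (cone a) (simplex_boundary I) = (gen I :: 'i set \<Rightarrow>\<^sub>0 'k::field)"
proof (cases "a \<in> I")
  case True
  have "lext (cone a) (simplex_boundary I) =
      (\<Sum>v\<in>I. pscale ((-1) ^ vertex_index v I) (cone a (I - {v}) :: 'i set \<Rightarrow>\<^sub>0 'k))"
    by (simp add: simplex_boundary_def lext_sum)
  also have "\<dots> = (\<Sum>v\<in>I. if v = a then gen I else 0)"
    using True
    by (intro sum.cong) (auto simp: cone_def insert_absorb simp flip: power_add)
  also have "\<dots> = gen I" using True assms by simp
  finally show ?thesis using True by (simp add: cone_def)
next
  case False
  let ?J = "insert a I" and ?e = "(-1) ^ vertex_index a (insert a I) :: 'k"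
  have "lext (cone a) (simplex_boundary I) =
      (\<Sum>v\<in>I. pscale ((-1) ^ vertex_index v I) (cone a (I - {v}) :: 'i set \<Rightarrow>\<^sub>0 'k))"
    by (simp add: simplex_boundary_def lext_sum)
  also have "\<dots> = (\<Sum>v\<in>I. - Poly_Mapping.single (?J - {v}) (?e * (-1) ^ vertex_index v ?J))"
  proof (rule sum.cong)
    fix v assume v: "v \<in> I"
    then have va: "v \<noteq> a" using False by auto
    have J: "insert a (I - {v}) = ?J - {v}" "?J - {a} = I" using va False by auto
    have i: "vertex_index v ?J = vertex_index v I + (if (a, v) \<in> vertex_order then 1 else 0)"
      "vertex_index a ?J = vertex_index a (?J - {v}) + (if (a, v) \<in> vertex_order then 0 else 1)"
      using vertex_index_remove[of ?J a v] vertex_index_remove[of ?J v a]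
        vertex_order_cases[of v a] va v assms J by auto
    show "pscale ((-1) ^ vertex_index v I) (cone a (I - {v})) =
        - Poly_Mapping.single (?J - {v}) (?e * (-1) ^ vertex_index v ?J)"
      using False v by (simp add: cone_def J i(2)) (simp add: i(1) power_add single_uminus mult.commute)
  qed simp
  also have "\<dots> = - (\<Sum>v\<in>I. Poly_Mapping.single (?J - {v}) (?e * (-1) ^ vertex_index v ?J))"
    by (rule sum_negf)
  finally have 1: "lext (cone a) (simplex_boundary I) = \<dots>" .
  have Ja: "?J - {a} = I" using False by simp
  have "lext simplex_boundary (cone a I) =
      (\<Sum>v\<in>?J. Poly_Mapping.single (?J - {v}) (?e * (-1) ^ vertex_index v ?J))"
    using False by (simp only: cone_def if_False lext_single simplex_boundary_def pscale_sum pscale_simps)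
  also have "\<dots> = Poly_Mapping.single (?J - {a}) (?e * ?e) +
      (\<Sum>v\<in>I. Poly_Mapping.single (?J - {v}) (?e * (-1) ^ vertex_index v ?J))"
    using False assms by (simp add: sum.insert)
  also have "?e * ?e = 1" by (simp flip: power_add)
  finally show ?thesis using 1 Ja by simp
qed

lemma full_simplex_acyclic:
  assumes u: "u \<in> supp_in {I. finite I \<and> I \<subseteq> L \<and> card I = n}" and "aug_boundary u = 0" and "a \<in> L"
  shows "\<exists>w \<in> supp_in {I. finite I \<and> I \<subseteq> L \<and> card I = Suc n}. aug_boundary w = (u :: 'i set \<Rightarrow>\<^sub>0 'k::field)"
proof
  show "lext (cone a) u \<in> supp_in {I. finite I \<and> I \<subseteq> L \<and> card I = Suc n}"
    using u by (rule supp_in_lext) (auto simp: cone_def intro!: supp_in_single \<open>a \<in> L\<close>)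
  have "lext simplex_boundary (lext (cone a) u) =
      lext (\<lambda>I. gen I - lext (cone a) (simplex_boundary I)) u"
    unfolding lext_lext using u
    by (intro lext_cong)
       (auto simp: supp_in_def eq_diff_eq cone_homotopy)
  also have "\<dots> = u - lext (cone a) (lext simplex_boundary u)"
    by (simp add: lext_diff_fun lext_gen lext_lext)
  finally show "aug_boundary (lext (cone a) u) = u"
    using assms(2) by (simp add: aug_boundary_def)
qed

lemma simplicial_complexD:
  assumes "simplicial_complex K"
  shows "{} \<notin> K" "\<sigma> \<in> K \<Longrightarrow> finite \<sigma>"
    "\<sigma> \<in> K \<Longrightarrow> \<tau> \<subseteq> \<sigma> \<Longrightarrow> \<tau> \<noteq> {} \<Longrightarrow> \<tau> \<in> K"
proof -
  have 1: "\<forall>\<sigma>\<in>K. finite \<sigma> \<and> \<sigma> \<noteq> {}" and 2: "\<forall>\<sigma>\<in>K. \<forall>\<tau>. \<tau> \<subseteq> \<sigma> \<and> \<tau> \<noteq> {} \<longrightarrow> \<tau> \<in> K"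
    using assms unfolding simplicial_complex_def by (rule conjunct1, rule conjunct2)
  show "{} \<notin> K" "\<sigma> \<in> K \<Longrightarrow> finite \<sigma>" using 1 by auto
  show "\<tau> \<in> K" if "\<sigma> \<in> K" "\<tau> \<subseteq> \<sigma>" "\<tau> \<noteq> {}"
    using 2[THEN bspec, OF that(1), THEN spec, of \<tau>] that(2,3) by simp
qed

lemma boundary_chains:
  assumes "simplicial_complex K" "c \<in> chains K (Suc n)"
  shows "boundary (Suc n) c \<in> chains K n"
proof -
  have "lext simplex_boundary c \<in> supp_in {\<sigma> \<in> K. card \<sigma> = Suc n}"
  proof (rule supp_in_lext)
    show "c \<in> supp_in {\<sigma> \<in> K. card \<sigma> = Suc (Suc n)}"
      using assms(2) by (simp add: chains_def supp_in_def)
    fix \<sigma> assume \<sigma>: "\<sigma> \<in> {\<sigma> \<in> K. card \<sigma> = Suc (Suc n)}"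
    show "simplex_boundary \<sigma> \<in> supp_in {\<sigma> \<in> K. card \<sigma> = Suc n}"
      unfolding simplex_boundary_def
    proof (intro supp_in_sum supp_in_single)
      fix v assume "v \<in> \<sigma>"
      then have c: "card (\<sigma> - {v}) = Suc n" using \<sigma> by auto
      then have "\<sigma> - {v} \<noteq> {}" by (metis card.empty nat.distinct(1))
      then have "\<sigma> - {v} \<in> K"
        using simplicial_complexD(3)[OF assms(1), of \<sigma> "\<sigma> - {v}"] \<sigma> by (simp add: Diff_subset)
      with c show "\<sigma> - {v} \<in> {\<sigma> \<in> K. card \<sigma> = Suc n}" by (intro CollectI conjI)
    qed
  qed
  then show ?thesis by (simp add: boundary_Suc aug_boundary_def chains_def supp_in_def)
qed


section \<open>Solving boundary equations column by column\<close>

text \<open>A chain of a double complex is a sum of slices, one for each value of the index \<open>c\<close> that the column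
  differential leaves unchanged, and the differential acts on each slice as the augmented boundary,
  up to a sign. So a cycle bounds as soon as its slices do. The injection \<open>\<iota>\<close> allows the index to be
  either component of a pair, so that the same argument covers both directions.\<close>

lemma column_fill:
  fixes \<iota> :: "'c \<times> 'a set \<Rightarrow> 'b" and D :: "'b \<Rightarrow> ('b \<Rightarrow>\<^sub>0 'k::field)"
  defines "E \<equiv> \<lambda>c. lext (\<lambda>s. gen (\<iota> (c, s)))"
  assumes inj: "inj \<iota>"
    and D: "\<And>c u. c \<in> A \<Longrightarrow> lext D (E c u) = pscale (sg c) (E c (aug_boundary u))"
    and sg: "\<And>c. sg c \<noteq> 0"
    and z: "z \<in> supp_in {\<iota> (c, s) | c s. c \<in> A \<and> s \<in> S c}" "lext D z = 0"
    and fill: "\<And>c u. c \<in> A \<Longrightarrow> u \<in> supp_in (S c) \<Longrightarrow> aug_boundary u = 0 \<Longrightarrow>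
      \<exists>w \<in> supp_in (T c). aug_boundary w = (u :: 'a set \<Rightarrow>\<^sub>0 'k)"
  shows "\<exists>y \<in> supp_in {\<iota> (c, s) | c s. c \<in> A \<and> s \<in> T c}. lext D y = z"
proof -
  have \<iota>_eq: "\<iota> (c, s) = \<iota> (c', s') \<longleftrightarrow> c = c' \<and> s = s'" for c c' s s'
    using inj by (auto dest: injD)
  have E: "Poly_Mapping.lookup (E c u) (\<iota> (c', s)) = (if c = c' then Poly_Mapping.lookup u s else 0)"
    for c c' s and u :: "'a set \<Rightarrow>\<^sub>0 'k"
  proof -
    have "Poly_Mapping.lookup (E c u) (\<iota> (c', s)) = (\<Sum>t\<in>Poly_Mapping.keys u.
        if t = s then (if c = c' then Poly_Mapping.lookup u s else 0) else 0)"
      unfolding E_def lext_def lookup_sum by (rule sum.cong) (auto simp: lookup_single \<iota>_eq when_def)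
    then show ?thesis by (simp add: in_keys_iff)
  qed
  have E_supp: "E c u \<in> supp_in {\<iota> (c, s) | s. s \<in> U}" if "u \<in> supp_in U" for c u U
    unfolding E_def using that by (rule supp_in_lext) (auto intro: supp_in_single)
  define sl where "sl c = Poly_Mapping.map_key (\<lambda>s. \<iota> (c, s)) z" for c
  have "inj (\<lambda>s. \<iota> (c, s))" for c by (auto simp: inj_def \<iota>_eq)
  then have sl: "Poly_Mapping.lookup (sl c) s = Poly_Mapping.lookup z (\<iota> (c, s))" for c s
    by (simp add: sl_def map_key.rep_eq)
  define C where "C = A \<inter> (fst \<circ> inv_into UNIV \<iota>) ` Poly_Mapping.keys z"
  have finC: "finite C" and CA: "c \<in> C \<Longrightarrow> c \<in> A" for c by (auto simp: C_def)
  have inC: "c \<in> C" if "\<iota> (c, s) \<in> Poly_Mapping.keys z" for c s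
  proof -
    have "c \<in> A" using that z(1) by (auto simp: supp_in_def \<iota>_eq)
    moreover have "c = (fst \<circ> inv_into UNIV \<iota>) (\<iota> (c, s))" using inv_f_f[OF inj, of "(c, s)"] by simp
    ultimately show ?thesis using that unfolding C_def by blast
  qed
  have z_sum: "z = (\<Sum>c\<in>C. E c (sl c))"
  proof (rule poly_mapping_eqI)
    fix x
    show "Poly_Mapping.lookup z x = Poly_Mapping.lookup (\<Sum>c\<in>C. E c (sl c)) x"
    proof (cases "x \<in> range \<iota>")
      case True
      then obtain c s where x: "x = \<iota> (c, s)" by auto
      show ?thesis using finC inC[of c s]
        by (auto simp: x lookup_sum E sl in_keys_iff)
    next
      case False
      have "E c (sl c) \<in> supp_in (range \<iota>)" for c
        by (rule supp_in_mono[OF E_supp[of _ UNIV]]) (auto simp: supp_in_def)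
      then have "(\<Sum>c\<in>C. E c (sl c)) \<in> supp_in (range \<iota>)" by (intro supp_in_sum)
      moreover have "z \<in> supp_in (range \<iota>)" using z(1) by (rule supp_in_mono) auto
      ultimately have "x \<notin> Poly_Mapping.keys z" "x \<notin> Poly_Mapping.keys (\<Sum>c\<in>C. E c (sl c))"
        using False unfolding supp_in_def by blast+
      then show ?thesis by (simp add: in_keys_iff)
    qed
  qed
  have sl_cycle: "aug_boundary (sl c) = 0" if c: "c \<in> C" for c
  proof (rule poly_mapping_eqI)
    fix s
    have "lext D z = (\<Sum>c\<in>C. pscale (sg c) (E c (aug_boundary (sl c))))"
      by (subst z_sum) (simp add: lext_sum D CA)
    then have "0 = Poly_Mapping.lookup (\<Sum>c\<in>C. pscale (sg c) (E c (aug_boundary (sl c)))) (\<iota> (c, s))"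
      using z(2) by simp
    also have "\<dots> = (\<Sum>c'\<in>C. if c' = c then sg c * Poly_Mapping.lookup (aug_boundary (sl c)) s else 0)"
      unfolding lookup_sum by (rule sum.cong) (auto simp: E)
    also have "\<dots> = sg c * Poly_Mapping.lookup (aug_boundary (sl c)) s"
      using c finC by simp
    finally show "Poly_Mapping.lookup (aug_boundary (sl c)) s = Poly_Mapping.lookup 0 s"
      using sg[of c] by simp
  qed
  have sl_supp: "sl c \<in> supp_in (S c)" for c
  proof -
    have "s \<in> S c" if "\<iota> (c, s) \<in> Poly_Mapping.keys z" for s
      using that z(1) by (auto simp: supp_in_def \<iota>_eq)
    then show ?thesis by (auto simp: supp_in_def in_keys_iff sl)
  qed
  have "\<exists>w. \<forall>c\<in>C. w c \<in> supp_in (T c) \<and> aug_boundary (w c) = sl c"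
    using fill[OF CA sl_supp sl_cycle] by (intro bchoice) blast
  then obtain w where w: "\<And>c. c \<in> C \<Longrightarrow> w c \<in> supp_in (T c)" "\<And>c. c \<in> C \<Longrightarrow> aug_boundary (w c) = sl c"
    by blast
  show ?thesis
  proof
    let ?y = "\<Sum>c\<in>C. pscale (inverse (sg c)) (E c (w c))"
    show "?y \<in> supp_in {\<iota> (c, s) | c s. c \<in> A \<and> s \<in> T c}"
      by (intro supp_in_sum supp_in_pscale supp_in_mono[OF E_supp[OF w(1)]]) (auto dest: CA)
    show "lext D ?y = z"
      using CA sg w(2) by (subst z_sum) (simp add: lext_sum lext_pscale D)
  qed
qed

section \<open>The double complex of a cover\<close>

text \<open>The pair of two empty sets would be the augmentation of the whole complex. It is replaced by \<open>0\<close>,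
  because the homology to be computed is not reduced.\<close>

definition cell :: "'v set \<Rightarrow> 'i set \<Rightarrow> ('v set \<times> 'i set \<Rightarrow>\<^sub>0 'k::field)" where
  "cell \<sigma> I = (if \<sigma> = {} \<and> I = {} then 0 else gen (\<sigma>, I))"

definition boundary_fst :: "'v set \<times> 'i set \<Rightarrow> ('v set \<times> 'i set \<Rightarrow>\<^sub>0 'k::field)" where
  "boundary_fst x = lext (\<lambda>\<sigma>. cell \<sigma> (snd x)) (simplex_boundary (fst x))"

text \<open>The sign \<open>(-1) ^ card \<sigma>\<close> makes the two differentials anticommute. It is the sign of the join: a
  vertex of \<open>I\<close> comes after all vertices of \<open>\<sigma>\<close>.\<close>

definition boundary_snd :: "'v set \<times> 'i set \<Rightarrow> ('v set \<times> 'i set \<Rightarrow>\<^sub>0 'k::field)" where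
  "boundary_snd x = pscale ((-1) ^ card (fst x)) (lext (cell (fst x)) (simplex_boundary (snd x)))"

definition emb_fst :: "'i set \<Rightarrow> ('v set \<Rightarrow>\<^sub>0 'k::field) \<Rightarrow> ('v set \<times> 'i set \<Rightarrow>\<^sub>0 'k)" where
  "emb_fst I = lext (\<lambda>\<sigma>. cell \<sigma> I)"

definition emb_snd :: "'v set \<Rightarrow> ('i set \<Rightarrow>\<^sub>0 'k::field) \<Rightarrow> ('v set \<times> 'i set \<Rightarrow>\<^sub>0 'k)" where
  "emb_snd \<sigma> = lext (cell \<sigma>)"

lemma simplex_boundary_empty [simp]: "simplex_boundary {} = 0"
  by (simp add: simplex_boundary_def)

lemma boundary_fst_cell: "lext boundary_fst (cell \<sigma> I) = boundary_fst (\<sigma>, I)"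
  by (auto simp: cell_def boundary_fst_def)

lemma boundary_snd_cell: "lext boundary_snd (cell \<sigma> I) = boundary_snd (\<sigma>, I)"
  by (auto simp: cell_def boundary_snd_def)

lemma boundary_fst_emb: "lext boundary_fst (emb_fst I c) = emb_fst I (aug_boundary c)"
  by (simp add: emb_fst_def lext_lext boundary_fst_cell aug_boundary_def boundary_fst_def)

lemma boundary_snd_emb:
  "lext boundary_snd (emb_snd \<sigma> c) = pscale ((-1) ^ card \<sigma>) (emb_snd \<sigma> (aug_boundary c))"
  by (simp add: emb_snd_def lext_lext boundary_snd_cell aug_boundary_def boundary_snd_def
      lext_pscale_fun)

lemma boundary_fst_fst:
  "lext boundary_fst (lext boundary_fst c) = (0 :: 'v set \<times> 'i set \<Rightarrow>\<^sub>0 'k::field)"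
proof -
  have "lext boundary_fst (boundary_fst x) = (0 :: 'v set \<times> 'i set \<Rightarrow>\<^sub>0 'k)" for x
  proof -
    have "lext boundary_fst (boundary_fst x) =
        emb_fst (snd x) (aug_boundary (aug_boundary (gen (fst x))) :: 'v set \<Rightarrow>\<^sub>0 'k)"
      by (simp add: boundary_fst_def boundary_fst_emb[unfolded emb_fst_def] emb_fst_def aug_boundary_def)
    then show ?thesis by (simp only: aug_boundary_aug_boundary emb_fst_def lext_0)
  qed
  then show ?thesis by (simp add: lext_lext) (simp add: lext_def)
qed

lemma boundary_snd_snd:
  "lext boundary_snd (lext boundary_snd c) = (0 :: 'v set \<times> 'i set \<Rightarrow>\<^sub>0 'k::field)"
proof -
  have "lext boundary_snd (boundary_snd x) = (0 :: 'v set \<times> 'i set \<Rightarrow>\<^sub>0 'k)" for x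
  proof -
    have "lext boundary_snd (boundary_snd x) = pscale ((-1) ^ card (fst x) * (-1) ^ card (fst x))
        (emb_snd (fst x) (aug_boundary (aug_boundary (gen (snd x))) :: 'i set \<Rightarrow>\<^sub>0 'k))"
      by (simp add: boundary_snd_def lext_pscale boundary_snd_emb[unfolded emb_snd_def] emb_snd_def
          aug_boundary_def)
    then show ?thesis by (simp only: aug_boundary_aug_boundary emb_snd_def lext_0 pscale_simps)
  qed
  then show ?thesis by (simp add: lext_lext) (simp add: lext_def)
qed

lemma boundary_fst_snd:
  "lext boundary_fst (lext boundary_snd c) =
    - lext boundary_snd (lext boundary_fst c :: 'v set \<times> 'i set \<Rightarrow>\<^sub>0 'k::field)"
proof -
  have "lext boundary_fst (boundary_snd (\<sigma>, I)) =
      - lext boundary_snd (boundary_fst (\<sigma>, I) :: 'v set \<times> 'i set \<Rightarrow>\<^sub>0 'k)" for \<sigma> I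
  proof (cases "finite \<sigma>")
    case True
    let ?s = "\<lambda>v. (-1) ^ vertex_index v \<sigma> :: 'k" and ?t = "\<lambda>i. (-1) ^ vertex_index i I :: 'k"
    let ?c = "\<lambda>v i. cell (\<sigma> - {v}) (I - {i}) :: 'v set \<times> 'i set \<Rightarrow>\<^sub>0 'k"
    have "lext boundary_fst (boundary_snd (\<sigma>, I)) =
      (\<Sum>i\<in>I. \<Sum>v\<in>\<sigma>. pscale ((-1) ^ card \<sigma> * ?t i * ?s v) (?c v i))"
      by (simp add: boundary_snd_def simplex_boundary_def lext_sum lext_pscale pscale_sum
          boundary_fst_cell boundary_fst_def mult.assoc)
    also have "\<dots> = (\<Sum>v\<in>\<sigma>. \<Sum>i\<in>I. pscale ((-1) ^ card \<sigma> * ?t i * ?s v) (?c v i))"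
      by (rule sum.swap)
    also have "\<dots> = - (\<Sum>v\<in>\<sigma>. \<Sum>i\<in>I. pscale (?s v * ((-1) ^ card (\<sigma> - {v}) * ?t i)) (?c v i))"
      unfolding sum_negf[symmetric]
    proof (intro sum.cong refl)
      fix v i assume v: "v \<in> \<sigma>"
      have "card \<sigma> = Suc (card (\<sigma> - {v}))" using card_Suc_Diff1[OF True v] by simp
      then show "pscale ((-1) ^ card \<sigma> * ?t i * ?s v) (?c v i) =
         - pscale (?s v * ((-1) ^ card (\<sigma> - {v}) * ?t i)) (?c v i)"
        by (intro poly_mapping_eqI) (simp add: mult_ac)
    qed
    also have "\<dots> = - lext boundary_snd (boundary_fst (\<sigma>, I))"
      by (simp add: boundary_fst_def simplex_boundary_def lext_sum lext_pscale pscale_sum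
          boundary_snd_cell boundary_snd_def)
    finally show ?thesis .
  next
    case False
    then have "simplex_boundary \<sigma> = (0 :: 'v set \<Rightarrow>\<^sub>0 'k)"
      by (simp add: simplex_boundary_def)
    then have "boundary_fst (\<sigma>, I) = (0 :: 'v set \<times> 'i set \<Rightarrow>\<^sub>0 'k)" for I
      by (simp add: boundary_fst_def)
    then show ?thesis
      by (simp add: boundary_snd_def lext_pscale lext_lext boundary_fst_cell) (simp add: lext_def)
  qed
  then have "lext boundary_fst (boundary_snd x) =
      - lext boundary_snd (boundary_fst x :: 'v set \<times> 'i set \<Rightarrow>\<^sub>0 'k)" for x
    by (cases x) auto
  then show ?thesis by (simp add: lext_lext lext_uminus_fun)
qed

definition proj_fst :: "('v set \<times> 'i set \<Rightarrow>\<^sub>0 'k::field) \<Rightarrow> ('v set \<Rightarrow>\<^sub>0 'k)" where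
  "proj_fst = lext (\<lambda>x. if snd x = {} then gen (fst x) else 0)"

definition proj_snd :: "('v set \<times> 'i set \<Rightarrow>\<^sub>0 'k::field) \<Rightarrow> ('i set \<Rightarrow>\<^sub>0 'k)" where
  "proj_snd = lext (\<lambda>x. if fst x = {} then gen (snd x) else 0)"

lemma proj_emb_fst: "{} \<notin> Poly_Mapping.keys c \<Longrightarrow> proj_fst (emb_fst {} c) = c"
  unfolding proj_fst_def emb_fst_def lext_lext
  by (rule trans[OF lext_cong lext_gen]) (auto simp: cell_def)

lemma proj_emb_snd: "{} \<notin> Poly_Mapping.keys c \<Longrightarrow> proj_snd (emb_snd {} c) = c"
  unfolding proj_snd_def emb_snd_def lext_lext
  by (rule trans[OF lext_cong lext_gen]) (auto simp: cell_def)

lemma emb_proj_fst: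
  assumes "c \<in> supp_in {x. snd x = {} \<and> fst x \<noteq> {}}" shows "emb_fst {} (proj_fst c) = c"
  unfolding proj_fst_def emb_fst_def lext_lext using assms
  by (intro trans[OF lext_cong lext_gen]) (auto simp: cell_def supp_in_def)

lemma emb_proj_snd:
  assumes "c \<in> supp_in {x. fst x = {} \<and> snd x \<noteq> {}}" shows "emb_snd {} (proj_snd c) = c"
  unfolding proj_snd_def emb_snd_def lext_lext using assms
  by (intro trans[OF lext_cong lext_gen]) (auto simp: cell_def supp_in_def)

lemma inter_filtration_mono:
  assumes "\<And>i. i \<in> I \<Longrightarrow> FU i j \<subseteq> FU i j'" "I' \<subseteq> I"
  shows "inter_filtration FU I j \<subseteq> inter_filtration FU I' j'"
  unfolding inter_filtration_def using assms by blast

text \<open>What the argument needs from the cover: the assumption \<open>acyclic\<close> replaces the interleavings by a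
  statement about chains, and \<open>N\<close> is described by the sets \<open>I\<close> with nonempty intersection at the given
  level instead of entry times. The parameter \<open>field_type\<close> only names the field of coefficients.\<close>

locale nerve_cover =
  fixes FU :: "'i \<Rightarrow> int \<Rightarrow> 'v set set" and \<Lambda> :: "'i set"
    and F :: "int \<Rightarrow> 'v set set" and N :: "int \<Rightarrow> 'i set set"
    and \<delta> m :: nat and field_type :: "'k::field itself"
  assumes FU_complex: "i \<in> \<Lambda> \<Longrightarrow> simplicial_complex (FU i j)"
    and FU_mono: "i \<in> \<Lambda> \<Longrightarrow> j \<le> j' \<Longrightarrow> FU i j \<subseteq> FU i j'"
    and F_eq: "F j = (\<Union>i\<in>\<Lambda>. FU i j)"
    and N_eq: "N j = {I. finite I \<and> I \<noteq> {} \<and> I \<subseteq> \<Lambda> \<and> inter_filtration FU I j \<noteq> {}}"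
    and F_entry: "\<sigma> \<in> F j \<Longrightarrow> \<exists>e\<le>j. \<sigma> \<in> F e \<and> (\<forall>i. \<sigma> \<in> F i \<longrightarrow> e \<le> i)"
    and N_entry: "I \<in> N j \<Longrightarrow> \<exists>e\<le>j. I \<in> N e \<and> (\<forall>i. I \<in> N i \<longrightarrow> e \<le> i)"
    and acyclic: "I \<in> N j \<Longrightarrow> u \<in> supp_in {\<sigma> \<in> insert {} (inter_filtration FU I j). card \<sigma> = n} \<Longrightarrow>
      aug_boundary u = 0 \<Longrightarrow>
      \<exists>w \<in> supp_in {\<sigma> \<in> inter_filtration FU I (if n = 0 then j else j + int \<delta>). card \<sigma> = Suc n}.
        aug_boundary w = (u :: 'v set \<Rightarrow>\<^sub>0 'k)"
    and bounded: "(\<forall>j. \<forall>I\<in>N j. card I \<le> m) \<or> (\<forall>j. \<forall>\<sigma>\<in>F j. card \<sigma> \<le> m)"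
begin

abbreviation "G \<equiv> inter_filtration FU"

text \<open>The cells of the join-like complex at level \<open>j\<close>. It is closed under the removal of vertices on either
  side as long as one component stays nonempty.\<close>

definition J :: "int \<Rightarrow> ('v set \<times> 'i set) set" where
  "J j = {(\<sigma>, I). \<sigma> \<in> insert {} (F j) \<and> I \<in> insert {} (N j) \<and> (\<sigma> \<noteq> {} \<or> I \<noteq> {}) \<and>
     (\<sigma> \<noteq> {} \<longrightarrow> I \<noteq> {} \<longrightarrow> \<sigma> \<in> G I j)}"

lemma F_simplex: "\<sigma> \<in> F j \<Longrightarrow> \<sigma> \<noteq> {} \<and> finite \<sigma>"
proof -
  assume "\<sigma> \<in> F j"
  then obtain i where "i \<in> \<Lambda>" "\<sigma> \<in> FU i j" unfolding F_eq by blast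
  then show ?thesis using simplicial_complexD(1,2)[OF FU_complex[of i j]] by metis
qed

lemma N_simplex: "I \<in> N j \<Longrightarrow> I \<noteq> {} \<and> finite I \<and> I \<subseteq> \<Lambda>"
  by (simp add: N_eq)

lemma G_F: "I \<in> N j \<Longrightarrow> \<sigma> \<in> G I j \<Longrightarrow> \<sigma> \<in> F j"
  unfolding N_eq F_eq inter_filtration_def by blast

lemma F_mono: "i \<le> j \<Longrightarrow> F i \<subseteq> F j"
  unfolding F_eq using FU_mono by blast

lemma G_mono: "I \<in> N j \<Longrightarrow> j \<le> j' \<Longrightarrow> I' \<subseteq> I \<Longrightarrow> G I j \<subseteq> G I' j'"
  using N_simplex[of I j] FU_mono by (intro inter_filtration_mono) blast+

lemma N_mono: "i \<le> j \<Longrightarrow> N i \<subseteq> N j"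
proof
  fix I assume "i \<le> j" "I \<in> N i"
  then show "I \<in> N j" using G_mono[of I i j I] unfolding N_eq by blast
qed

lemma N_face: "I \<in> N j \<Longrightarrow> I' \<subseteq> I \<Longrightarrow> I' \<noteq> {} \<Longrightarrow> I' \<in> N j"
  using G_mono[of I j j I'] unfolding N_eq by (auto intro: finite_subset)

lemma F_face: "\<sigma> \<in> F j \<Longrightarrow> \<tau> \<subseteq> \<sigma> \<Longrightarrow> \<tau> \<noteq> {} \<Longrightarrow> \<tau> \<in> F j"
proof -
  assume *: "\<sigma> \<in> F j" "\<tau> \<subseteq> \<sigma>" "\<tau> \<noteq> {}"
  then obtain i where i: "i \<in> \<Lambda>" "\<sigma> \<in> FU i j" unfolding F_eq by blast
  have "\<tau> \<in> FU i j" using simplicial_complexD(3)[OF FU_complex[of i j], of \<sigma> \<tau>] i * by simp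
  then show ?thesis using i unfolding F_eq by blast
qed

lemma G_face:
  assumes "I \<in> N j" "\<sigma> \<in> G I j" "\<tau> \<subseteq> \<sigma>" "\<tau> \<noteq> {}" shows "\<tau> \<in> G I j"
proof -
  have "\<tau> \<in> FU i j" if "i \<in> I" for i
    using simplicial_complexD(3)[OF FU_complex[of i j], of \<sigma> \<tau>] that assms N_simplex[OF assms(1)]
    unfolding inter_filtration_def by blast
  then show ?thesis by (simp add: inter_filtration_def)
qed

lemma F_complex: "simplicial_complex (F j)"
  unfolding simplicial_complex_def by (intro conjI ballI allI impI) (blast dest: F_simplex, blast dest: F_simplex, elim conjE, erule (2) F_face)

lemma N_complex: "simplicial_complex (N j)"
  unfolding simplicial_complex_def by (intro conjI ballI allI impI) (blast dest: N_simplex, blast dest: N_simplex, elim conjE, erule (2) N_face)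

text \<open>Any finite set of cover elements that contain \<open>\<sigma>\<close> at level \<open>j\<close> is a simplex of the nerve at level
  \<open>j\<close>, since \<open>\<sigma>\<close> itself lies in the intersection. Hence the fibre over \<open>\<sigma>\<close> is a full simplex.\<close>

lemma full_fibre:
  assumes "\<sigma> \<noteq> {}" "finite I" "I \<noteq> {}" "I \<subseteq> {i \<in> \<Lambda>. \<sigma> \<in> FU i j}"
  shows "(\<sigma>, I) \<in> J j"
proof -
  have "\<sigma> \<in> G I j" using assms by (auto simp: inter_filtration_def)
  moreover have "\<sigma> \<in> F j" using assms unfolding F_eq by blast
  ultimately show ?thesis using assms by (auto simp: J_def N_eq)
qed

lemma J_cases:
  assumes "(\<sigma>, I) \<in> J j"
  shows "I = {} \<and> \<sigma> \<in> F j \<or> \<sigma> = {} \<and> I \<in> N j \<or> I \<in> N j \<and> \<sigma> \<in> G I j \<and> \<sigma> \<in> F j"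
  using assms unfolding J_def by auto

lemma J_finite: "(\<sigma>, I) \<in> J j \<Longrightarrow> finite \<sigma> \<and> finite I"
  using J_cases F_simplex N_simplex by blast

lemma J_remove_fst:
  assumes "(\<sigma>, I) \<in> J j" "\<tau> \<subseteq> \<sigma>" "\<tau> \<noteq> {} \<or> I \<noteq> {}" shows "(\<tau>, I) \<in> J j"
proof (cases "\<tau> = {}")
  case True
  then show ?thesis using assms by (simp add: J_def)
next
  case False
  then have "\<sigma> \<in> F j" "\<sigma> \<noteq> {}" using assms by (auto simp: J_def)
  then have "\<tau> \<in> F j" "I \<noteq> {} \<Longrightarrow> \<tau> \<in> G I j"
    using False assms(2) F_face[of \<sigma> j \<tau>] G_face[of I j \<sigma> \<tau>] assms(1,2) by (auto simp: J_def)
  then show ?thesis using assms(1,3) by (simp add: J_def)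
qed

lemma J_remove_snd:
  assumes "(\<sigma>, I) \<in> J j" "I' \<subseteq> I" "\<sigma> \<noteq> {} \<or> I' \<noteq> {}" shows "(\<sigma>, I') \<in> J j"
proof (cases "I' = {}")
  case True
  then show ?thesis using assms by (simp add: J_def)
next
  case False
  then have I: "I \<in> N j" "I \<noteq> {}" using assms by (auto simp: J_def)
  then have "I' \<in> N j" "G I j \<subseteq> G I' j"
    using False N_face[of I j I'] G_mono[of I j j I'] assms(2) by auto
  then show ?thesis using assms(1,3) I by (auto simp: J_def)
qed

lemma J_mono: "i \<le> j \<Longrightarrow> J i \<subseteq> J j"
proof
  fix x assume "i \<le> j" "x \<in> J i"
  then show "x \<in> J j"
    using F_mono[of i j] N_mono[of i j] G_mono[of "snd x" i j "snd x"]
    unfolding J_def by (cases x) auto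
qed

lemma boundary_fst_supp:
  assumes x: "x \<in> J j"
  shows "boundary_fst x \<in> supp_in {y \<in> J j. Suc (card (fst y)) = card (fst x) \<and> card (snd y) = card (snd x)}"
proof -
  obtain \<sigma> I where [simp]: "x = (\<sigma>, I)" by (cases x)
  show ?thesis unfolding boundary_fst_def simplex_boundary_def lext_sum
  proof (intro supp_in_sum)
    fix v assume v: "v \<in> fst x"
    then have "Suc (card (\<sigma> - {v})) = card \<sigma>"
      using J_finite x card_Suc_Diff1[of \<sigma> v] by auto
    then show "lext (\<lambda>\<sigma>. cell \<sigma> (snd x)) (Poly_Mapping.single (fst x - {v}) ((- 1) ^ vertex_index v (fst x)))
      \<in> supp_in {y \<in> J j. Suc (card (fst y)) = card (fst x) \<and> card (snd y) = card (snd x)}"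
      using J_remove_fst[of \<sigma> I j "\<sigma> - {v}"] x
      by (auto simp: cell_def intro!: supp_in_single)
  qed
qed

lemma boundary_snd_supp:
  assumes x: "x \<in> J j"
  shows "boundary_snd x \<in> supp_in {y \<in> J j. card (fst y) = card (fst x) \<and> Suc (card (snd y)) = card (snd x)}"
proof -
  obtain \<sigma> I where [simp]: "x = (\<sigma>, I)" by (cases x)
  show ?thesis unfolding boundary_snd_def simplex_boundary_def lext_sum
  proof (intro supp_in_sum supp_in_pscale)
    fix v assume v: "v \<in> snd x"
    then have "Suc (card (I - {v})) = card I"
      using J_finite x card_Suc_Diff1[of I v] by auto
    then show "lext (cell (fst x)) (Poly_Mapping.single (snd x - {v}) ((- 1) ^ vertex_index v (snd x)))
      \<in> supp_in {y \<in> J j. card (fst y) = card (fst x) \<and> Suc (card (snd y)) = card (snd x)}"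
      using J_remove_snd[of \<sigma> I j "I - {v}"] x
      by (auto simp: cell_def intro!: supp_in_single)
  qed
qed

lemma card_J:
  assumes "x \<in> J j"
  shows "card (fst x) = 0 \<longleftrightarrow> fst x = {}" "card (snd x) = 0 \<longleftrightarrow> snd x = {}"
    "fst x \<noteq> {} \<or> snd x \<noteq> {}"
  using J_finite[of "fst x" "snd x" j] assms by (auto simp: J_def)

lemma exact_fst:
  fixes z :: "'v set \<times> 'i set \<Rightarrow>\<^sub>0 'k"
  assumes z: "z \<in> bichains J (card \<circ> fst) (card \<circ> snd) j Q P" "P \<noteq> 0" "lext boundary_fst z = 0"
  shows "\<exists>y \<in> bichains J (card \<circ> fst) (card \<circ> snd) (if Q = 0 then j else j + int \<delta>) (Suc Q) P.
    lext boundary_fst y = z"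
proof -
  let ?A = "{I \<in> N j. card I = P}" and ?S = "\<lambda>I. {\<sigma> \<in> insert {} (G I j). card \<sigma> = Q}"
  let ?j = "if Q = 0 then j else j + int \<delta>"
  let ?T = "\<lambda>I. {\<sigma> \<in> G I ?j. card \<sigma> = Suc Q}"
  have j: "j \<le> ?j" by simp
  have "\<exists>y\<in>supp_in {prod.swap (I, \<sigma>) |I \<sigma>. I \<in> ?A \<and> \<sigma> \<in> ?T I}. lext boundary_fst y = z"
  proof (rule column_fill[where S = ?S and sg = "\<lambda>_. 1"])
    show "inj (prod.swap :: 'i set \<times> 'v set \<Rightarrow> _)" by simp
    fix I and u :: "'v set \<Rightarrow>\<^sub>0 'k" assume I: "I \<in> ?A"
    then have "lext (\<lambda>s. gen (prod.swap (I, s))) c = emb_fst I c" for c :: "'v set \<Rightarrow>\<^sub>0 'k"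
      using N_simplex[of I j] by (auto simp: emb_fst_def cell_def)
    then show "lext boundary_fst (lext (\<lambda>s. gen (prod.swap (I, s))) u) =
        pscale 1 (lext (\<lambda>s. gen (prod.swap (I, s))) (aug_boundary u))"
      by (simp only: boundary_fst_emb pscale_simps)
    show "\<exists>w\<in>supp_in (?T I). aug_boundary w = u" if "u \<in> supp_in (?S I)" "aug_boundary u = 0"
      using acyclic[OF _ that] I by simp
  next
    show "z \<in> supp_in {prod.swap (I, \<sigma>) |I \<sigma>. I \<in> ?A \<and> \<sigma> \<in> ?S I}"
      using z(1) unfolding bichains_def
    proof (rule supp_in_mono, intro subsetI)
      fix x assume "x \<in> {x \<in> J j. (card \<circ> fst) x = Q \<and> (card \<circ> snd) x = P}"
      then have "(fst x, snd x) \<in> J j" "card (fst x) = Q" "card (snd x) = P" by auto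
      then have "snd x \<in> ?A \<and> fst x \<in> ?S (snd x)" using \<open>P \<noteq> 0\<close> J_cases by fastforce
      then show "x \<in> {prod.swap (I, \<sigma>) |I \<sigma>. I \<in> ?A \<and> \<sigma> \<in> ?S I}" by (cases x) auto
    qed
  qed (use z in auto)
  moreover have "{prod.swap (I, \<sigma>) |I \<sigma>. I \<in> ?A \<and> \<sigma> \<in> ?T I}
     \<subseteq> {x \<in> J ?j. (card \<circ> fst) x = Suc Q \<and> (card \<circ> snd) x = P}"
  proof
    fix x assume "x \<in> {prod.swap (I, \<sigma>) |I \<sigma>. I \<in> ?A \<and> \<sigma> \<in> ?T I}"
    then obtain I \<sigma> where x: "x = (\<sigma>, I)" and I: "I \<in> N j" "P = card I"
      and \<sigma>: "\<sigma> \<in> G I ?j" "card \<sigma> = Suc Q" by auto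
    have "I \<in> N ?j" using N_mono[OF j] I(1) by blast
    then have "(\<sigma>, I) \<in> J ?j" using \<sigma> G_F[of I ?j \<sigma>] by (auto simp: J_def)
    then show "x \<in> {x \<in> J ?j. (card \<circ> fst) x = Suc Q \<and> (card \<circ> snd) x = P}"
      using I \<sigma> x by simp
  qed
  ultimately show ?thesis unfolding bichains_def by (meson supp_in_mono)
qed

text \<open>The fibre over \<open>\<sigma>\<close> is nonempty because the cover elements at level \<open>j\<close> exhaust the space at level \<open>j\<close>.\<close>

lemma exact_snd:
  fixes z :: "'v set \<times> 'i set \<Rightarrow>\<^sub>0 'k"
  assumes z: "z \<in> bichains J (card \<circ> snd) (card \<circ> fst) j Q P" "P \<noteq> 0" "lext boundary_snd z = 0"
  shows "\<exists>y \<in> bichains J (card \<circ> snd) (card \<circ> fst) j (Suc Q) P. lext boundary_snd y = z"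
proof -
  let ?L = "\<lambda>\<sigma>. {i \<in> \<Lambda>. \<sigma> \<in> FU i j}" and ?A = "{\<sigma> \<in> F j. card \<sigma> = P}"
  let ?S = "\<lambda>n \<sigma>. {I. finite I \<and> I \<subseteq> ?L \<sigma> \<and> card I = n}"
  have "\<exists>y\<in>supp_in {id (\<sigma>, I) |\<sigma> I. \<sigma> \<in> ?A \<and> I \<in> ?S (Suc Q) \<sigma>}. lext boundary_snd y = z"
  proof (rule column_fill[where S = "?S Q" and sg = "\<lambda>\<sigma>. (-1) ^ card \<sigma>"])
    fix \<sigma> and u :: "'i set \<Rightarrow>\<^sub>0 'k" assume \<sigma>: "\<sigma> \<in> ?A"
    then have "cell \<sigma> = (\<lambda>I. gen (\<sigma>, I) :: 'v set \<times> 'i set \<Rightarrow>\<^sub>0 'k)"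
      using F_simplex[of \<sigma> j] by (simp add: cell_def fun_eq_iff)
    then have "lext (\<lambda>s. gen (id (\<sigma>, s))) c = emb_snd \<sigma> c" for c :: "'i set \<Rightarrow>\<^sub>0 'k"
      by (simp add: emb_snd_def)
    then show "lext boundary_snd (lext (\<lambda>s. gen (id (\<sigma>, s))) u) =
        pscale ((-1) ^ card \<sigma>) (lext (\<lambda>s. gen (id (\<sigma>, s))) (aug_boundary u))"
      by (simp only: boundary_snd_emb)
    obtain a where "a \<in> ?L \<sigma>" using \<sigma> unfolding F_eq by blast
    then show "\<exists>w\<in>supp_in (?S (Suc Q) \<sigma>). aug_boundary w = u"
      if "u \<in> supp_in (?S Q \<sigma>)" "aug_boundary u = 0"
      using full_simplex_acyclic[OF that] by blast
  next
    show "z \<in> supp_in {id (\<sigma>, I) |\<sigma> I. \<sigma> \<in> ?A \<and> I \<in> ?S Q \<sigma>}"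
      using z(1) unfolding bichains_def
    proof (rule supp_in_mono, intro subsetI)
      fix x assume "x \<in> {x \<in> J j. (card \<circ> snd) x = Q \<and> (card \<circ> fst) x = P}"
      then have x: "(fst x, snd x) \<in> J j" "card (snd x) = Q" "card (fst x) = P" by auto
      then have ne: "fst x \<noteq> {}" using \<open>P \<noteq> 0\<close> by auto
      then have "fst x \<in> F j" using J_cases[OF x(1)] by auto
      moreover have "snd x \<subseteq> ?L (fst x)"
        using J_cases[OF x(1)] ne N_simplex[of "snd x" j] by (auto simp: inter_filtration_def)
      ultimately show "x \<in> {id (\<sigma>, I) |\<sigma> I. \<sigma> \<in> ?A \<and> I \<in> ?S Q \<sigma>}"
        using x J_finite[OF x(1)] by (cases x) auto
    qed
  qed (use z in auto)
  moreover have "{id (\<sigma>, I) |\<sigma> I. \<sigma> \<in> ?A \<and> I \<in> ?S (Suc Q) \<sigma>}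
     \<subseteq> {x \<in> J j. (card \<circ> snd) x = Suc Q \<and> (card \<circ> fst) x = P}"
  proof
    fix x assume "x \<in> {id (\<sigma>, I) |\<sigma> I. \<sigma> \<in> ?A \<and> I \<in> ?S (Suc Q) \<sigma>}"
    then obtain I \<sigma> where x: "x = (\<sigma>, I)" and \<sigma>: "\<sigma> \<in> F j" "P = card \<sigma>"
      and I: "finite I" "I \<subseteq> ?L \<sigma>" "card I = Suc Q" by auto
    have "(\<sigma>, I) \<in> J j" using I F_simplex[OF \<sigma>(1)] by (intro full_fibre) auto
    then show "x \<in> {x \<in> J j. (card \<circ> snd) x = Suc Q \<and> (card \<circ> fst) x = P}"
      using I \<sigma> x by simp
  qed
  ultimately show ?thesis unfolding bichains_def by (meson supp_in_mono)
qed


lemma entry_snd: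
  assumes "x \<in> J j" "(card \<circ> fst) x = 0"
  shows "\<exists>e\<le>j. x \<in> J e \<and> (\<forall>i. x \<in> J i \<longrightarrow> e \<le> i)"
proof -
  obtain I where I: "x = ({}, I)" using card_J(1)[OF assms(1)] assms(2) by (cases x) auto
  have "x \<in> J i \<longleftrightarrow> I \<in> N i" for i
    unfolding I J_def using N_simplex by auto
  then show ?thesis using N_entry[of I j] assms(1) by simp
qed

lemma entry_fst:
  assumes "x \<in> J j" "(card \<circ> snd) x = 0"
  shows "\<exists>e\<le>j. x \<in> J e \<and> (\<forall>i. x \<in> J i \<longrightarrow> e \<le> i)"
proof -
  obtain \<sigma> where \<sigma>: "x = (\<sigma>, {})" using card_J(2)[OF assms(1)] assms(2) by (cases x) auto
  have "x \<in> J i \<longleftrightarrow> \<sigma> \<in> F i" for i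
    unfolding \<sigma> J_def using F_simplex by auto
  then show ?thesis using F_entry[of \<sigma> j] assms(1) by simp
qed

lemma J_bounded:
  "(\<forall>j. \<forall>x\<in>J j. (card \<circ> snd) x \<le> m) \<or> (\<forall>j. \<forall>x\<in>J j. (card \<circ> fst) x \<le> m)"
proof -
  have "fst x \<in> insert {} (F j)" "snd x \<in> insert {} (N j)" if "x \<in> J j" for x j
    using that by (auto simp: J_def)
  then show ?thesis using bounded by (metis card.empty comp_apply insertE le0)
qed

text \<open>The double complex is used twice: with the columns \<open>U\<^sub>I\<close>, which are exact up to \<open>\<delta>\<close>, and with the
  full simplices as columns, which are exact. Exchanging the roles of the differentials also exchanges the
  two ends.\<close>

sublocale over_nerve: filtered_double_complex J "card \<circ> fst" "card \<circ> snd"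
  "boundary_fst :: _ \<Rightarrow> _ \<Rightarrow>\<^sub>0 'k" "boundary_snd :: _ \<Rightarrow> _ \<Rightarrow>\<^sub>0 'k" \<delta> m
proof unfold_locales
  show "(card \<circ> fst) x \<noteq> 0 \<or> (card \<circ> snd) x \<noteq> 0" if "x \<in> J j" for x j
    using card_J[OF that] by simp
  show "\<delta> = 0 \<or> (\<forall>j. \<forall>x\<in>J j. (card \<circ> snd) x \<le> m) \<or> (\<forall>j. \<forall>x\<in>J j. (card \<circ> fst) x \<le> m)"
    using J_bounded by blast
qed (use boundary_fst_supp boundary_snd_supp in
    \<open>simp_all add: J_mono boundary_fst_fst boundary_snd_snd boundary_fst_snd entry_snd[unfolded comp_def]
      exact_fst\<close>)

sublocale over_space: filtered_double_complex J "card \<circ> snd" "card \<circ> fst"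
  "boundary_snd :: _ \<Rightarrow> _ \<Rightarrow>\<^sub>0 'k" "boundary_fst :: _ \<Rightarrow> _ \<Rightarrow>\<^sub>0 'k" 0 0
proof unfold_locales
  show "(card \<circ> snd) x \<noteq> 0 \<or> (card \<circ> fst) x \<noteq> 0" if "x \<in> J j" for x j
    using card_J[OF that] by auto
  show "boundary_snd x \<in> supp_in {y \<in> J j. Suc ((card \<circ> snd) y) = (card \<circ> snd) x \<and>
      (card \<circ> fst) y = (card \<circ> fst) x}" if "x \<in> J j" for x j
    using boundary_snd_supp[OF that] by (simp add: conj_commute)
  show "boundary_fst x \<in> supp_in {y \<in> J j. (card \<circ> snd) y = (card \<circ> snd) x \<and>
      Suc ((card \<circ> fst) y) = (card \<circ> fst) x}" if "x \<in> J j" for x j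
    using boundary_fst_supp[OF that] by (simp add: conj_commute)
  show "lext boundary_snd (lext boundary_fst c) = - lext boundary_fst (lext boundary_snd c)"
    for c :: "_ \<Rightarrow>\<^sub>0 'k"
    by (simp add: boundary_fst_snd)
  fix z :: "_ \<Rightarrow>\<^sub>0 'k" and j Q P
  assume "z \<in> bichains J (card \<circ> snd) (card \<circ> fst) j Q P" "P \<noteq> 0" "lext boundary_snd z = 0"
  from exact_snd[OF this]
  show "\<exists>y\<in>bichains J (card \<circ> snd) (card \<circ> fst) (if Q = 0 then j else j + int 0) (Suc Q) P.
      lext boundary_snd y = z" by auto
qed (simp_all add: J_mono boundary_fst_fst boundary_snd_snd entry_fst[unfolded comp_def])

end

section \<open>Chain maps between a space and the nerve of a cover\<close>

context nerve_cover
begin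

lemma emb_fst_chains:
  assumes "(c :: 'v set \<Rightarrow>\<^sub>0 'k) \<in> chains (F j) n"
  shows "emb_fst {} c \<in> over_nerve.Ch j (Suc n) 0" "proj_fst (emb_fst {} c :: 'v set \<times> 'i set \<Rightarrow>\<^sub>0 'k) = c"
    "over_nerve.d (emb_fst {} c) = emb_fst {} (boundary n c)"
proof -
  have c: "c \<in> supp_in {\<sigma> \<in> F j. card \<sigma> = Suc n}"
    using assms by (simp add: chains_def supp_in_def)
  show Ch: "emb_fst {} c \<in> over_nerve.Ch j (Suc n) 0"
    unfolding emb_fst_def bichains_def using c
    by (rule supp_in_lext) (use F_simplex in \<open>auto simp: cell_def J_def intro!: supp_in_single\<close>)
  show "proj_fst (emb_fst {} c :: 'v set \<times> 'i set \<Rightarrow>\<^sub>0 'k) = c"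
    using c F_simplex by (intro proj_emb_fst) (auto simp: supp_in_def)
  have d: "over_nerve.d (emb_fst {} c) = emb_fst {} (aug_boundary c)"
    using Ch by (simp add: over_nerve.d_def over_nerve.D2_Ch_0 boundary_fst_emb)
  show "over_nerve.d (emb_fst {} c) = emb_fst {} (boundary n c)"
  proof (cases n)
    case 0
    have 1: "lext boundary_fst (emb_fst {} c) \<in> over_nerve.Ch j 0 0"
      using Ch 0 by (intro over_nerve.D1_Ch) simp
    have "lext boundary_fst (emb_fst {} c :: 'v set \<times> 'i set \<Rightarrow>\<^sub>0 'k) \<in> supp_in {}"
      using 1 unfolding bichains_def by (rule supp_in_mono) (use over_nerve.no_empty_cell in blast)
    then have "over_nerve.d (emb_fst {} c) = 0"
      unfolding d by (simp add: boundary_fst_emb supp_in_empty)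
    then show ?thesis by (simp add: 0 boundary_def emb_fst_def)
  qed (simp add: d boundary_Suc)
qed

lemma emb_snd_chains:
  assumes "(c :: 'i set \<Rightarrow>\<^sub>0 'k) \<in> chains (N j) n"
  shows "emb_snd {} c \<in> over_nerve.Ch j 0 (Suc n)" "proj_snd (emb_snd {} c :: 'v set \<times> 'i set \<Rightarrow>\<^sub>0 'k) = c"
    "over_nerve.d (emb_snd {} c) = emb_snd {} (boundary n c)"
proof -
  have c: "c \<in> supp_in {I \<in> N j. card I = Suc n}"
    using assms by (simp add: chains_def supp_in_def)
  show Ch: "emb_snd {} c \<in> over_nerve.Ch j 0 (Suc n)"
    unfolding emb_snd_def bichains_def using c
    by (rule supp_in_lext) (use N_simplex in \<open>auto simp: cell_def J_def intro!: supp_in_single\<close>)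
  show "proj_snd (emb_snd {} c :: 'v set \<times> 'i set \<Rightarrow>\<^sub>0 'k) = c"
    using c N_simplex by (intro proj_emb_snd) (auto simp: supp_in_def)
  have d: "over_nerve.d (emb_snd {} c) = emb_snd {} (aug_boundary c)"
    using Ch by (simp add: over_nerve.d_def over_nerve.D1_Ch_0 boundary_snd_emb)
  show "over_nerve.d (emb_snd {} c) = emb_snd {} (boundary n c)"
  proof (cases n)
    case 0
    have 1: "lext boundary_snd (emb_snd {} c) \<in> over_nerve.Ch j 0 0"
      using Ch 0 by (intro over_nerve.D2_Ch) simp
    have "lext boundary_snd (emb_snd {} c :: 'v set \<times> 'i set \<Rightarrow>\<^sub>0 'k) \<in> supp_in {}"
      using 1 unfolding bichains_def by (rule supp_in_mono) (use over_nerve.no_empty_cell in blast)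
    then have "over_nerve.d (emb_snd {} c) = 0"
      unfolding d by (simp add: boundary_snd_emb supp_in_empty)
    then show ?thesis by (simp add: 0 boundary_def emb_snd_def)
  qed (simp add: d boundary_Suc)
qed

lemma proj_fst_chains:
  assumes "c \<in> over_nerve.Ch j (Suc n) 0"
  shows "proj_fst c \<in> chains (F j) n" "emb_fst {} (proj_fst c) = c"
proof -
  have c: "c \<in> supp_in {x \<in> J j. snd x = {} \<and> card (fst x) = Suc n}"
    using assms unfolding bichains_def by (rule supp_in_mono) (use card_J in auto)
  have "proj_fst c \<in> supp_in {\<sigma> \<in> F j. card \<sigma> = Suc n}"
    unfolding proj_fst_def using c
    by (rule supp_in_lext) (auto simp: J_def intro!: supp_in_single)
  then show "proj_fst c \<in> chains (F j) n" by (simp add: chains_def supp_in_def)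
  show "emb_fst {} (proj_fst c) = c"
    by (intro emb_proj_fst supp_in_mono[OF c]) auto
qed

lemma proj_snd_chains:
  assumes "c \<in> over_nerve.Ch j 0 (Suc n)"
  shows "proj_snd c \<in> chains (N j) n" "emb_snd {} (proj_snd c) = c"
proof -
  have c: "c \<in> supp_in {x \<in> J j. fst x = {} \<and> card (snd x) = Suc n}"
    using assms unfolding bichains_def by (rule supp_in_mono) (use card_J in auto)
  have "proj_snd c \<in> supp_in {I \<in> N j. card I = Suc n}"
    unfolding proj_snd_def using c
    by (rule supp_in_lext) (auto simp: J_def intro!: supp_in_single)
  then show "proj_snd c \<in> chains (N j) n" by (simp add: chains_def supp_in_def)
  show "emb_snd {} (proj_snd c) = c"
    by (intro emb_proj_snd supp_in_mono[OF c]) auto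
qed

lemma over_space_d: "over_space.d = over_nerve.d"
  by (simp add: fun_eq_iff over_space.d_def over_nerve.d_def add.commute)

text \<open>Returning from the double complex to \<open>X\<close> costs \<open>m\<delta>\<close>, whereas returning to the nerve is free, because
  only the fibres over the nerve fail to be acyclic.\<close>

lemma fst_boundaries:
  assumes z: "z \<in> chains (F j) n" and y: "y \<in> over_nerve.Tot j (Suc (Suc n))"
    "over_nerve.d y = emb_fst {} (z :: 'v set \<Rightarrow>\<^sub>0 'k)"
  shows "z \<in> boundaries (F (j + int (m * \<delta>))) n"
proof -
  obtain y' where y': "y' \<in> over_nerve.Ch (j + int (m * \<delta>)) (Suc (Suc n)) 0"
      "over_nerve.d y' = emb_fst {} z"
    using over_nerve.bounds_in_end[OF y(1)] y(2) emb_fst_chains(1)[OF z] by auto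
  note p = proj_fst_chains[OF y'(1)]
  have "emb_fst {} (boundary (Suc n) (proj_fst y')) = (emb_fst {} z :: 'v set \<times> 'i set \<Rightarrow>\<^sub>0 'k)"
    using emb_fst_chains(3)[OF p(1)] p(2) y'(2) by simp
  then have "boundary (Suc n) (proj_fst y') = z"
    using emb_fst_chains(2)[OF z] emb_fst_chains(2)[OF boundary_chains[OF F_complex p(1)]] by metis
  then show ?thesis unfolding boundaries_def using p(1) by blast
qed

lemma snd_boundaries:
  assumes z: "z \<in> chains (N j) n" and y: "y \<in> over_nerve.Tot j (Suc (Suc n))"
    "over_nerve.d y = emb_snd {} (z :: 'i set \<Rightarrow>\<^sub>0 'k)"
  shows "z \<in> boundaries (N j) n"
proof -
  obtain y' where y': "y' \<in> over_nerve.Ch j 0 (Suc (Suc n))"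
      "over_nerve.d y' = emb_snd {} z"
    using over_space.bounds_in_end[of y j "Suc n"] y emb_snd_chains(1)[OF z]
    unfolding over_space_d
    by (auto simp: bichains_swap[of J "card \<circ> snd" "card \<circ> fst"]
        totchains_swap[of J "card \<circ> snd" "card \<circ> fst"])
  note p = proj_snd_chains[OF y'(1)]
  have "emb_snd {} (boundary (Suc n) (proj_snd y')) = (emb_snd {} z :: 'v set \<times> 'i set \<Rightarrow>\<^sub>0 'k)"
    using emb_snd_chains(3)[OF p(1)] p(2) y'(2) by simp
  then have "boundary (Suc n) (proj_snd y') = z"
    using emb_snd_chains(2)[OF z] emb_snd_chains(2)[OF boundary_chains[OF N_complex p(1)]] by metis
  then show ?thesis unfolding boundaries_def using p(1) by blast
qed


text \<open>Both composites are homotopic to the identity inside the double complex, where a cycle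
  is homologous to its image under \<open>\<Phi>\<close> or \<open>\<Psi>\<close>. It remains to return to the end in which the difference
  lives.\<close>

theorem chain_maps:
  obtains \<Phi> :: "'v set \<Rightarrow> ('i set \<Rightarrow>\<^sub>0 'k)" and \<Psi> :: "'i set \<Rightarrow> ('v set \<Rightarrow>\<^sub>0 'k)" where
    "\<And>j n c. c \<in> chains (F j) n \<Longrightarrow> lext \<Phi> c \<in> chains (N j) n"
    "\<And>j n c. c \<in> chains (F j) n \<Longrightarrow> boundary n (lext \<Phi> c) = lext \<Phi> (boundary n c)"
    "\<And>j n c. c \<in> chains (N j) n \<Longrightarrow> lext \<Psi> c \<in> chains (F (j + int (m * \<delta>))) n"
    "\<And>j n c. c \<in> chains (N j) n \<Longrightarrow> boundary n (lext \<Psi> c) = lext \<Psi> (boundary n c)"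
    "\<And>j n z. z \<in> cycles (F j) n \<Longrightarrow>
       lext \<Psi> (lext \<Phi> z) - z \<in> boundaries (F (j + int (m * \<delta>) + int (m * \<delta>))) n"
    "\<And>j n z. z \<in> cycles (N j) n \<Longrightarrow>
       lext \<Phi> (lext \<Psi> z) - z \<in> boundaries (N (j + int (m * \<delta>))) n"
proof -
  obtain S K :: "'v set \<times> 'i set \<Rightarrow> ('v set \<times> 'i set \<Rightarrow>\<^sub>0 'k)" where
    S: "\<And>j n c. c \<in> over_nerve.Ch j 0 (Suc n) \<Longrightarrow> lext S c \<in> over_nerve.Ch (j + int (m * \<delta>)) (Suc n) 0"
    and K: "\<And>j n c. c \<in> over_nerve.Ch j 0 (Suc n) \<Longrightarrow>
      lext K c \<in> over_nerve.Tot (j + int (m * \<delta>)) (Suc (Suc n))"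
    and SK: "\<And>j n c. c \<in> over_nerve.Ch j 0 (Suc n) \<Longrightarrow>
      lext S c - c = over_nerve.d (lext K c) + lext K (over_nerve.d c)"
    and dS: "\<And>j n c. c \<in> over_nerve.Ch j 0 (Suc n) \<Longrightarrow>
      over_nerve.d (lext S c) = lext S (over_nerve.d c)"
    using over_nerve.transfer_map by blast
  obtain S' K' :: "'v set \<times> 'i set \<Rightarrow> ('v set \<times> 'i set \<Rightarrow>\<^sub>0 'k)" where
    S'0: "\<And>j n c. c \<in> over_space.Ch j 0 (Suc n) \<Longrightarrow> lext S' c \<in> over_space.Ch (j + int (0 * 0)) (Suc n) 0"
    and K'0: "\<And>j n c. c \<in> over_space.Ch j 0 (Suc n) \<Longrightarrow>
      lext K' c \<in> over_space.Tot (j + int (0 * 0)) (Suc (Suc n))"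
    and SK'0: "\<And>j n c. c \<in> over_space.Ch j 0 (Suc n) \<Longrightarrow>
      lext S' c - c = over_space.d (lext K' c) + lext K' (over_space.d c)"
    and dS'0: "\<And>j n c. c \<in> over_space.Ch j 0 (Suc n) \<Longrightarrow>
      over_space.d (lext S' c) = lext S' (over_space.d c)"
    using over_space.transfer_map by blast
  note swap = over_space_d bichains_swap[of J "card \<circ> snd" "card \<circ> fst"]
    totchains_swap[of J "card \<circ> snd" "card \<circ> fst"]
  have S': "lext S' c \<in> over_nerve.Ch j 0 (Suc n)"
    and K': "lext K' c \<in> over_nerve.Tot j (Suc (Suc n))"
    and SK': "lext S' c - c = over_nerve.d (lext K' c) + lext K' (over_nerve.d c)"
    and dS': "over_nerve.d (lext S' c) = lext S' (over_nerve.d c)"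
    if "c \<in> over_nerve.Ch j (Suc n) 0" for c j n
    using S'0[of c j n] K'0[of c j n] SK'0[of c j n] dS'0[of c j n] that unfolding swap by simp_all
  define \<Phi> where "\<Phi> = (\<lambda>\<sigma>. proj_snd (lext S' (cell \<sigma> {})))"
  define \<Psi> where "\<Psi> = (\<lambda>I. proj_fst (lext S (cell {} I)))"
  have \<Phi>: "lext \<Phi> c = proj_snd (lext S' (emb_fst {} c))" for c
    by (simp add: \<Phi>_def emb_fst_def proj_snd_def lext_lext)
  have \<Psi>: "lext \<Psi> c = proj_fst (lext S (emb_snd {} c))" for c
    by (simp add: \<Psi>_def emb_snd_def proj_fst_def lext_lext)
  have \<Phi>_Ch: "lext \<Phi> c \<in> chains (N j) n" "emb_snd {} (lext \<Phi> c) = lext S' (emb_fst {} c)"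
    if "c \<in> chains (F j) n" for c j n
    using proj_snd_chains[OF S'[OF emb_fst_chains(1)[OF that]]] by (simp_all add: \<Phi>)
  have \<Psi>_Ch: "lext \<Psi> c \<in> chains (F (j + int (m * \<delta>))) n"
    "emb_fst {} (lext \<Psi> c) = lext S (emb_snd {} c)"
    if "c \<in> chains (N j) n" for c j n
    using proj_fst_chains[OF S[OF emb_snd_chains(1)[OF that]]] by (simp_all add: \<Psi>)
  show thesis
  proof (rule that[of \<Phi> \<Psi>])
    fix j n and c :: "'v set \<Rightarrow>\<^sub>0 'k" assume c: "c \<in> chains (F j) n"
    show "lext \<Phi> c \<in> chains (N j) n" by (rule \<Phi>_Ch[OF c])
    show "boundary n (lext \<Phi> c) = lext \<Phi> (boundary n c)"
    proof (cases n)
      case (Suc n')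
      have "emb_snd {} (boundary n (lext \<Phi> c)) = over_nerve.d (lext S' (emb_fst {} c))"
        using emb_snd_chains(3)[OF \<Phi>_Ch(1)[OF c]] \<Phi>_Ch(2)[OF c] by simp
      also have "\<dots> = lext S' (emb_fst {} (boundary n c))"
        using dS'[OF emb_fst_chains(1)[OF c]] emb_fst_chains(3)[OF c] by simp
      finally have "proj_snd (emb_snd {} (boundary n (lext \<Phi> c)) :: 'v set \<times> 'i set \<Rightarrow>\<^sub>0 'k) = lext \<Phi> (boundary n c)"
        by (simp add: \<Phi>)
      then show ?thesis
        using emb_snd_chains(2)[OF boundary_chains[OF N_complex \<Phi>_Ch(1)[OF c, unfolded Suc]]]
        by (simp add: Suc)
    qed (simp add: boundary_def)
  next
    fix j n and c :: "'i set \<Rightarrow>\<^sub>0 'k" assume c: "c \<in> chains (N j) n"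
    show "lext \<Psi> c \<in> chains (F (j + int (m * \<delta>))) n" by (rule \<Psi>_Ch[OF c])
    show "boundary n (lext \<Psi> c) = lext \<Psi> (boundary n c)"
    proof (cases n)
      case (Suc n')
      have "emb_fst {} (boundary n (lext \<Psi> c)) = over_nerve.d (lext S (emb_snd {} c))"
        using emb_fst_chains(3)[OF \<Psi>_Ch(1)[OF c]] \<Psi>_Ch(2)[OF c] by simp
      also have "\<dots> = lext S (emb_snd {} (boundary n c))"
        using dS[OF emb_snd_chains(1)[OF c]] emb_snd_chains(3)[OF c] by simp
      finally have "proj_fst (emb_fst {} (boundary n (lext \<Psi> c)) :: 'v set \<times> 'i set \<Rightarrow>\<^sub>0 'k) = lext \<Psi> (boundary n c)"
        by (simp add: \<Psi>)
      then show ?thesis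
        using emb_fst_chains(2)[OF boundary_chains[OF F_complex \<Psi>_Ch(1)[OF c, unfolded Suc]]]
        by (simp add: Suc)
    qed (simp add: boundary_def)
  next
    fix j n and z :: "'v set \<Rightarrow>\<^sub>0 'k" assume "z \<in> cycles (F j) n"
    then have z: "z \<in> chains (F j) n" "boundary n z = 0" by (auto simp: cycles_def)
    let ?c = "int (m * \<delta>)" and ?z = "emb_fst {} z :: 'v set \<times> 'i set \<Rightarrow>\<^sub>0 'k"
    have dz: "over_nerve.d ?z = 0" using emb_fst_chains(3)[OF z(1)] z(2) by (simp add: emb_fst_def)
    note Z = emb_fst_chains(1)[OF z(1)]
    note W = S'[OF Z] and \<Phi>z = \<Phi>_Ch[OF z(1)]
    have dW: "over_nerve.d (lext S' ?z) = 0" using dS'[OF Z] dz by simp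
    \<comment> \<open>The two homotopies add up to a chain that bounds the difference in the double complex.\<close>
    let ?y = "lext K (lext S' ?z) + lext K' ?z"
    have "lext S (lext S' ?z) - ?z = over_nerve.d ?y"
    proof -
      have "over_nerve.d (lext K (lext S' ?z)) = lext S (lext S' ?z) - lext S' ?z"
        using SK[OF W] dW by simp
      moreover have "over_nerve.d (lext K' ?z) = lext S' ?z - ?z" using SK'[OF Z] dz by simp
      ultimately show ?thesis by (simp add: over_nerve.d_simps)
    qed
    then have "over_nerve.d ?y = emb_fst {} (lext \<Psi> (lext \<Phi> z) - z)"
      using \<Psi>_Ch(2)[OF \<Phi>z(1)] \<Phi>z(2) by (simp add: emb_fst_def lext_diff)
    moreover have "?y \<in> over_nerve.Tot (j + ?c) (Suc (Suc n))"
      using K[OF W] over_nerve.Tot_mono[OF K'[OF Z], of "j + ?c"]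
      unfolding totchains_def by (intro supp_in_add) auto
    moreover have "lext \<Psi> (lext \<Phi> z) - z \<in> chains (F (j + ?c)) n"
    proof -
      have "z \<in> chains (F (j + ?c)) n" using z(1) F_mono[of j "j + ?c"] by (auto simp: chains_def)
      then have "lext \<Psi> (lext \<Phi> z) + cscale (-1) z \<in> chains (F (j + ?c)) n"
        using \<Psi>_Ch(1)[OF \<Phi>z(1)] by (intro chains_closed)
      then show ?thesis by (simp flip: uminus_cscale)
    qed
    ultimately show "lext \<Psi> (lext \<Phi> z) - z \<in> boundaries (F (j + ?c + ?c)) n"
      using fst_boundaries by blast
  next
    fix j n and z :: "'i set \<Rightarrow>\<^sub>0 'k" assume "z \<in> cycles (N j) n"
    then have z: "z \<in> chains (N j) n" "boundary n z = 0" by (auto simp: cycles_def)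
    let ?c = "int (m * \<delta>)" and ?z = "emb_snd {} z :: 'v set \<times> 'i set \<Rightarrow>\<^sub>0 'k"
    have dz: "over_nerve.d ?z = 0" using emb_snd_chains(3)[OF z(1)] z(2) by (simp add: emb_snd_def)
    note Z = emb_snd_chains(1)[OF z(1)]
    note W = S[OF Z] and \<Psi>z = \<Psi>_Ch[OF z(1)]
    have dW: "over_nerve.d (lext S ?z) = 0" using dS[OF Z] dz by simp
    let ?y = "lext K' (lext S ?z) + lext K ?z"
    have "lext S' (lext S ?z) - ?z = over_nerve.d ?y"
    proof -
      have "over_nerve.d (lext K' (lext S ?z)) = lext S' (lext S ?z) - lext S ?z"
        using SK'[OF W] dW by simp
      moreover have "over_nerve.d (lext K ?z) = lext S ?z - ?z" using SK[OF Z] dz by simp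
      ultimately show ?thesis by (simp add: over_nerve.d_simps)
    qed
    then have "over_nerve.d ?y = emb_snd {} (lext \<Phi> (lext \<Psi> z) - z)"
      using \<Phi>_Ch(2)[OF \<Psi>z(1)] \<Psi>z(2) by (simp add: emb_snd_def lext_diff)
    moreover have "?y \<in> over_nerve.Tot (j + ?c) (Suc (Suc n))"
      using K'[OF W] K[OF Z] unfolding totchains_def by (intro supp_in_add)
    moreover have "lext \<Phi> (lext \<Psi> z) - z \<in> chains (N (j + ?c)) n"
    proof -
      have "z \<in> chains (N (j + ?c)) n" using z(1) N_mono[of j "j + ?c"] by (auto simp: chains_def)
      then have "lext \<Phi> (lext \<Psi> z) + cscale (-1) z \<in> chains (N (j + ?c)) n"
        using \<Phi>_Ch(1)[OF \<Psi>z(1)] by (intro chains_closed)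
      then show ?thesis by (simp flip: uminus_cscale)
    qed
    ultimately show "lext \<Phi> (lext \<Psi> z) - z \<in> boundaries (N (j + ?c)) n"
      using snd_boundaries by blast
  qed
qed

end

section \<open>Morphisms of persistent homology\<close>

text \<open>Linearity over the polynomial ring reduces to linearity over the field together with compatibility
  with \<open>t\<close>, by induction on the polynomial.\<close>

lemma eta_morphism_direct_sum:
  fixes V :: "int \<Rightarrow> ('k::field, 'm) module" and W :: "int \<Rightarrow> ('k, 'n) module"
  assumes "vs_sequence V \<tau>" "vs_sequence W \<rho>"
    and f: "\<And>j. linear_map (V j) (W (j + int \<eta>)) (f j)"
    and comm: "\<And>j x. x \<in> carrier (V j) \<Longrightarrow> f (j + 1) (\<tau> j x) = \<rho> (j + int \<eta>) (f j x)"
  shows "eta_morphism \<eta> (direct_sum_kt V \<tau>) (direct_sum_kt W \<rho>)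
    (\<lambda>h j. f (j - int \<eta>) (h (j - int \<eta>)))"
proof -
  interpret A: vs_sequence V \<tau> by fact
  interpret B: vs_sequence W \<rho> by fact
  define \<Phi> where "\<Phi> h = (\<lambda>j. f (j - int \<eta>) (h (j - int \<eta>)))" for h
  have f_closed: "f (j - int \<eta>) x \<in> carrier (W j)" if "x \<in> carrier (V (j - int \<eta>))" for j x
    using f[of "j - int \<eta>"] that by (auto simp: linear_map_def)
  have f_add: "f (j - int \<eta>) (x \<oplus>\<^bsub>V (j - int \<eta>)\<^esub> y) = f (j - int \<eta>) x \<oplus>\<^bsub>W j\<^esub> f (j - int \<eta>) y"
    if "x \<in> carrier (V (j - int \<eta>))" "y \<in> carrier (V (j - int \<eta>))" for j x y
    using f[of "j - int \<eta>"] that by (auto simp: linear_map_def)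
  have f_smult: "f (j - int \<eta>) (a \<odot>\<^bsub>V (j - int \<eta>)\<^esub> x) = a \<odot>\<^bsub>W j\<^esub> f (j - int \<eta>) x"
    if "x \<in> carrier (V (j - int \<eta>))" for j x a
    using f[of "j - int \<eta>"] that by (auto simp: linear_map_def)
  have f_zero: "f (j - int \<eta>) \<zero>\<^bsub>V (j - int \<eta>)\<^esub> = \<zero>\<^bsub>W j\<^esub>" for j
    using f_smult[of "\<zero>\<^bsub>V (j - int \<eta>)\<^esub>" j 0] A.V.zero_closed[of "j - int \<eta>"] B.vzero f_closed
    by simp
  have closed: "\<Phi> h \<in> B.C" if h: "h \<in> A.C" for h
  proof -
    have "{j. \<Phi> h j \<noteq> \<zero>\<^bsub>W j\<^esub>} \<subseteq> (\<lambda>j. j + int \<eta>) ` {j. h j \<noteq> \<zero>\<^bsub>V j\<^esub>}"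
    proof
      fix j assume "j \<in> {j. \<Phi> h j \<noteq> \<zero>\<^bsub>W j\<^esub>}"
      then have "h (j - int \<eta>) \<noteq> \<zero>\<^bsub>V (j - int \<eta>)\<^esub>" using f_zero[of j] by (auto simp: \<Phi>_def)
      then show "j \<in> (\<lambda>j. j + int \<eta>) ` {j. h j \<noteq> \<zero>\<^bsub>V j\<^esub>}"
        by (intro image_eqI[of _ _ "j - int \<eta>"]) auto
    qed
    then show ?thesis using h f_closed
      by (auto simp: direct_sum_carrier_def \<Phi>_def intro: finite_subset)
  qed
  have add: "\<Phi> (A.vadd g h) = B.vadd (\<Phi> g) (\<Phi> h)" if "g \<in> A.C" "h \<in> A.C" for g h
    using that by (auto simp: \<Phi>_def A.vadd_def B.vadd_def fun_eq_iff A.C_D f_add)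
  have scale: "\<Phi> (A.vscale a h) = B.vscale a (\<Phi> h)" if "h \<in> A.C" for a h
    using that by (auto simp: \<Phi>_def A.vscale_def B.vscale_def fun_eq_iff A.C_D f_smult)
  have shift: "\<Phi> (A.T h) = B.T (\<Phi> h)" if "h \<in> A.C" for h
  proof
    fix j
    have i: "j - 1 - int \<eta> = j - int \<eta> - 1" "j - int \<eta> - 1 + int \<eta> = j - 1" by simp_all
    show "\<Phi> (A.T h) j = B.T (\<Phi> h) j"
      using comm[OF A.C_D[OF that], of "j - int \<eta> - 1"] by (simp add: \<Phi>_def t_shift_def i)
  qed
  have smult: "\<Phi> (p \<odot>\<^bsub>A.S\<^esub> h) = p \<odot>\<^bsub>B.S\<^esub> \<Phi> h" if "h \<in> A.C" for p h
    using that
  proof (induction p arbitrary: h)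
    case 0
    have "\<Phi> A.vzero' = B.vzero'" by (simp add: \<Phi>_def A.vzero'_def B.vzero'_def f_zero)
    then show ?case using 0 by (simp add: A.smult_S_0 B.smult_S_0 closed)
  next
    case (pCons a p)
    then show ?case
      by (simp add: A.smult_S_pCons B.smult_S_pCons add scale shift closed A.closed)
  qed
  have "\<Phi> h \<in> grade B.S (j + int \<eta>)" if "h \<in> grade A.S j" for h j
    using that closed f_zero by (auto simp: A.S_simps B.S_simps \<Phi>_def)
  then have "eta_morphism \<eta> A.S B.S \<Phi>"
    unfolding eta_morphism_def A.S_simps(1,3) B.S_simps(1,3)
    using closed add smult by auto
  then show ?thesis unfolding \<Phi>_def[abs_def] .
qed

context vs_sequence
begin

lemma smult_S_tvar_power: "h \<in> C \<Longrightarrow> tvar ^ k \<odot>\<^bsub>S\<^esub> h = (T ^^ k) h"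
  by (induction k)
    (simp_all only: power_0 power_Suc smult_S_one smult_S_mult smult_S_tvar t_shift_pow_closed
      funpow.simps id_apply comp_apply)

end

lemma coset_eq_iff:
  "x +o boundaries K n = y +o boundaries K n \<longleftrightarrow> x - y \<in> boundaries K n"
proof
  assume "x +o boundaries K n = y +o boundaries K n"
  then have "x \<in> y +o boundaries K n"
    using boundaries_closed(1)[of K n] by (auto simp: elt_set_plus_def)
  then show "x - y \<in> boundaries K n" by (auto simp: elt_set_plus_def)
next
  assume *: "x - y \<in> boundaries K n"
  have "(x - y) + b \<in> boundaries K n" "- (x - y) + b \<in> boundaries K n" if "b \<in> boundaries K n" for b
    using that * boundaries_closed(2) boundaries_uminus by blast+
  then show "x +o boundaries K n = y +o boundaries K n"
    unfolding elt_set_plus_def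
    by (safe; metis (no_types, lifting) add_diff_cancel_left' add_diff_eq add.commute diff_add_cancel
        minus_diff_eq uminus_add_conv_diff)
qed

text \<open>The parameter \<open>field_type\<close> only names the field of coefficients.\<close>

locale filtration =
  fixes K :: "int \<Rightarrow> 'v set set" and field_type :: "'k::field itself"
  assumes mono: "i \<le> j \<Longrightarrow> K i \<subseteq> K j"
begin

sublocale H: vs_sequence "\<lambda>j. homology (K j) n :: ('k, ('v set \<Rightarrow>\<^sub>0 'k) set) module"
  "\<lambda>j. homology_incl (K (j + 1)) n" for n
  by (intro vs_sequence.intro module_homology linear_map_homology_incl mono) simp

abbreviation "PH n \<equiv> persistent_homology K n :: ('k, int \<Rightarrow> ('v set \<Rightarrow>\<^sub>0 'k) set) gmodule"

lemma PH_eq: "PH n = H.S n"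
  by (simp add: persistent_homology_def)

text \<open>Multiplication by \<open>t\<^sup>k\<close> keeps the representing cycle and moves it to a later level; this is how an identity
  between powers of \<open>t\<close> becomes a statement about boundaries.\<close>

lemma tvar_power_PH:
  assumes h: "h \<in> carrier (PH n)" and z: "h i = z +o boundaries (K i) n"
  shows "(tvar ^ k \<odot>\<^bsub>PH n\<^esub> h) (i + int k) = z +o boundaries (K (i + int k)) n"
proof -
  have "(H.T n ^^ k) h (i + int k) = z +o boundaries (K (i + int k)) n"
  proof (induction k)
    case (Suc k)
    have i: "i + int (Suc k) - 1 = i + int k" by simp
    have "(H.T n ^^ Suc k) h (i + int (Suc k)) = H.T n ((H.T n ^^ k) h) (i + int (Suc k))" by simp
    also have "\<dots> = homology_incl (K (i + int k + 1)) n (z +o boundaries (K (i + int k)) n)"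
      by (subst t_shift_def) (simp only: i Suc)
    also have "\<dots> = z +o boundaries (K (i + int k + 1)) n"
      by (intro homology_incl_coset mono) simp
    finally show ?case by (simp add: add_ac)
  qed (use z in simp)
  then show ?thesis using h H.smult_S_tvar_power[of h n k] by (simp add: PH_eq H.S_simps)
qed

lemma PH_rep:
  assumes "h \<in> carrier (PH n)"
  obtains z where "z \<in> cycles (K i) n" "h i = z +o boundaries (K i) n"
proof -
  have "h i \<in> carrier (homology (K i) n)" using assms by (simp add: PH_eq H.S_simps H.C_D)
  then show thesis by (rule homologyE) (rule that)
qed

end

lemma chain_map_eta_morphism:
  fixes A :: "int \<Rightarrow> 'v set set" and B :: "int \<Rightarrow> 'w set set" and f :: "'v set \<Rightarrow> ('w set \<Rightarrow>\<^sub>0 'k::field)"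
  assumes A: "\<And>i j. i \<le> j \<Longrightarrow> A i \<subseteq> A j" and B: "\<And>i j. i \<le> j \<Longrightarrow> B i \<subseteq> B j"
    and f: "\<And>j n c. c \<in> chains (A j) n \<Longrightarrow> lext f c \<in> chains (B (j + int \<eta>)) n"
    and comm: "\<And>j n c. c \<in> chains (A j) n \<Longrightarrow> boundary n (lext f c) = lext f (boundary n c)"
  obtains \<Phi> where "eta_morphism \<eta> (persistent_homology A n) (persistent_homology B n) \<Phi>"
    "\<And>h j z. h (j - int \<eta>) = z +o boundaries (A (j - int \<eta>)) n \<Longrightarrow>
       \<Phi> h j = lext f z +o boundaries (B j) n"
proof -
  interpret A: filtration A "TYPE('k)" by standard (rule A)
  interpret B: filtration B "TYPE('k)" by standard (rule B)
  define g where "g j X = lext f ` X + boundaries (B (j + int \<eta>)) n" for j X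
  have bd: "lext f b \<in> boundaries (B (j + int \<eta>)) n" if "b \<in> boundaries (A j) n" for b j
    using that unfolding boundaries_def by (auto simp: comm[symmetric] intro!: imageI f)
  have g: "g j (z +o boundaries (A j) n) = lext f z +o boundaries (B (j + int \<eta>)) n" (is "?l = ?r")
    for j z
  proof
    show "?l \<subseteq> ?r"
    proof
      fix x assume "x \<in> ?l"
      then obtain b b' where b: "b \<in> boundaries (A j) n" "b' \<in> boundaries (B (j + int \<eta>)) n"
          "x = lext f (z + b) + b'"
        by (auto simp: g_def elt_set_plus_def set_plus_def)
      then have "x = lext f z + (lext f b + b')" by (simp add: lext_add)
      then show "x \<in> ?r" using bd[OF b(1)] b(2) boundaries_closed(2) unfolding elt_set_plus_def by blast
    qed
    show "?r \<subseteq> ?l"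
    proof
      fix x assume "x \<in> ?r"
      then obtain b where "b \<in> boundaries (B (j + int \<eta>)) n" "x = lext f (z + 0) + b"
        by (auto simp: elt_set_plus_def)
      then show "x \<in> ?l" unfolding g_def elt_set_plus_def set_plus_def
        using boundaries_closed(1)[of "A j" n] by blast
    qed
  qed
  have cyc: "lext f z \<in> cycles (B (j + int \<eta>)) n" if "z \<in> cycles (A j) n" for z j
    using that by (auto simp: cycles_def f comm)
  have lin: "linear_map (homology (A j) n) (homology (B (j + int \<eta>)) n) (g j)" for j
    unfolding linear_map_def homology_simps
    by (auto simp: g coset_add coset_cscale lext_add lext_pscale cyc)
  have "eta_morphism \<eta> (persistent_homology A n) (persistent_homology B n)
      (\<lambda>h j. g (j - int \<eta>) (h (j - int \<eta>)))"
    unfolding A.PH_eq B.PH_eq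
  proof (rule eta_morphism_direct_sum[OF A.H.vs_sequence_axioms B.H.vs_sequence_axioms lin])
    fix j x assume "x \<in> carrier (homology (A j) n :: ('k, _) module)"
    then obtain z where z: "x = z +o boundaries (A j) n" by (rule homologyE)
    have j: "j + 1 + int \<eta> = j + int \<eta> + 1" by simp
    have "homology_incl (A (j + 1)) n x = z +o boundaries (A (j + 1)) n"
      unfolding z by (intro homology_incl_coset A) simp
    moreover have "homology_incl (B (j + int \<eta> + 1)) n (lext f z +o boundaries (B (j + int \<eta>)) n) =
        lext f z +o boundaries (B (j + int \<eta> + 1)) n"
      by (intro homology_incl_coset B) simp
    ultimately show "g (j + 1) (homology_incl (A (j + 1)) n x) =
        homology_incl (B (j + int \<eta> + 1)) n (g j x)"
      by (simp add: z g j)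
  qed
  moreover have "g (j - int \<eta>) (h (j - int \<eta>)) = lext f z +o boundaries (B j) n"
    if "h (j - int \<eta>) = z +o boundaries (A (j - int \<eta>)) n" for h j z
    using g[of "j - int \<eta>" z] that by simp
  ultimately show thesis by (rule that)
qed

text \<open>The chain maps are defined on all generators at once, so compatibility with the inclusions of levels
  is automatic, and only the two composites have to be compared with the identity on cycles.\<close>

theorem interleaved_by_chain_maps:
  fixes A :: "int \<Rightarrow> 'v set set" and B :: "int \<Rightarrow> 'w set set"
    and f :: "'v set \<Rightarrow> ('w set \<Rightarrow>\<^sub>0 'k::field)" and g :: "'w set \<Rightarrow> ('v set \<Rightarrow>\<^sub>0 'k)"
  assumes A: "\<And>i j. i \<le> j \<Longrightarrow> A i \<subseteq> A j" and B: "\<And>i j. i \<le> j \<Longrightarrow> B i \<subseteq> B j"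
    and f: "\<And>j n c. c \<in> chains (A j) n \<Longrightarrow> lext f c \<in> chains (B (j + int \<eta>)) n"
      "\<And>j n c. c \<in> chains (A j) n \<Longrightarrow> boundary n (lext f c) = lext f (boundary n c)"
    and g: "\<And>j n c. c \<in> chains (B j) n \<Longrightarrow> lext g c \<in> chains (A (j + int \<eta>)) n"
      "\<And>j n c. c \<in> chains (B j) n \<Longrightarrow> boundary n (lext g c) = lext g (boundary n c)"
    and gf: "\<And>j z. z \<in> cycles (A j) n \<Longrightarrow> lext g (lext f z) - z \<in> boundaries (A (j + int (2 * \<eta>))) n"
    and fg: "\<And>j z. z \<in> cycles (B j) n \<Longrightarrow> lext f (lext g z) - z \<in> boundaries (B (j + int (2 * \<eta>))) n"
  shows "interleaved \<eta> (persistent_homology A n :: ('k, _) gmodule) (persistent_homology B n)"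
proof -
  interpret A: filtration A "TYPE('k)" by standard (rule A)
  interpret B: filtration B "TYPE('k)" by standard (rule B)
  obtain \<Phi> where \<Phi>: "eta_morphism \<eta> (A.PH n) (B.PH n) \<Phi>"
    "\<And>h j z. h (j - int \<eta>) = z +o boundaries (A (j - int \<eta>)) n \<Longrightarrow>
       \<Phi> h j = lext f z +o boundaries (B j) n"
    by (rule chain_map_eta_morphism[of A B f \<eta> n]) (erule A, erule B, erule f(1), erule f(2), blast)
  obtain \<Psi> where \<Psi>: "eta_morphism \<eta> (B.PH n) (A.PH n) \<Psi>"
    "\<And>h j z. h (j - int \<eta>) = z +o boundaries (B (j - int \<eta>)) n \<Longrightarrow>
       \<Psi> h j = lext g z +o boundaries (A j) n"
    by (rule chain_map_eta_morphism[of B A g \<eta> n]) (erule B, erule A, erule g(1), erule g(2), blast)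
  have "\<Psi> (\<Phi> h) = tvar ^ (2 * \<eta>) \<odot>\<^bsub>A.PH n\<^esub> h" if h: "h \<in> carrier (A.PH n)" for h
  proof
    fix j
    let ?i = "j - int \<eta> - int \<eta>"
    have j: "?i + int (2 * \<eta>) = j" by simp
    obtain z where z: "z \<in> cycles (A ?i) n" "h ?i = z +o boundaries (A ?i) n"
      using A.PH_rep[OF h] .
    have "\<Psi> (\<Phi> h) j = lext g (lext f z) +o boundaries (A j) n"
      by (intro \<Psi>(2) \<Phi>(2) z)
    also have "\<dots> = z +o boundaries (A j) n"
      using gf[OF z(1)] unfolding j coset_eq_iff .
    finally show "\<Psi> (\<Phi> h) j = (tvar ^ (2 * \<eta>) \<odot>\<^bsub>A.PH n\<^esub> h) j"
      using A.tvar_power_PH[OF h z(2), of "2 * \<eta>"] unfolding j by simp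
  qed
  moreover have "\<Phi> (\<Psi> h) = tvar ^ (2 * \<eta>) \<odot>\<^bsub>B.PH n\<^esub> h" if h: "h \<in> carrier (B.PH n)" for h
  proof
    fix j
    let ?i = "j - int \<eta> - int \<eta>"
    have j: "?i + int (2 * \<eta>) = j" by simp
    obtain z where z: "z \<in> cycles (B ?i) n" "h ?i = z +o boundaries (B ?i) n"
      using B.PH_rep[OF h] .
    have "\<Phi> (\<Psi> h) j = lext f (lext g z) +o boundaries (B j) n"
      by (intro \<Phi>(2) \<Psi>(2) z)
    also have "\<dots> = z +o boundaries (B j) n"
      using fg[OF z(1)] unfolding j coset_eq_iff .
    finally show "\<Phi> (\<Psi> h) j = (tvar ^ (2 * \<eta>) \<odot>\<^bsub>B.PH n\<^esub> h) j"
      using B.tvar_power_PH[OF h z(2), of "2 * \<eta>"] unfolding j by simp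
  qed
  ultimately show ?thesis
    unfolding interleaved_def interleaving_def using \<Phi>(1) \<Psi>(1) by blast
qed

section \<open>Acyclicity of the cover in terms of chains\<close>

context filtration
begin

definition homogeneous_class :: "nat \<Rightarrow> int \<Rightarrow> ('v set \<Rightarrow>\<^sub>0 'k) \<Rightarrow> int \<Rightarrow> ('v set \<Rightarrow>\<^sub>0 'k) set" where
  "homogeneous_class n j z = (\<lambda>i. (if i = j then z else 0) +o boundaries (K i) n)"

lemma homogeneous_class:
  assumes "z \<in> cycles (K j) n"
  shows "homogeneous_class n j z \<in> carrier (PH n)" "homogeneous_class n j z \<in> grade (PH n) j"
proof -
  have "homogeneous_class n j z i \<in> carrier (homology (K i) n)" for i
  proof -
    have "(if i = j then z else 0) \<in> cycles (K i) n" using assms by (simp add: cycles_closed)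
    then show ?thesis unfolding homogeneous_class_def homology_simps by (rule imageI)
  qed
  moreover have "finite {i. homogeneous_class n j z i \<noteq> \<zero>\<^bsub>homology (K i) n\<^esub>}"
    by (rule finite_subset[of _ "{j}"]) (auto simp: homogeneous_class_def homology_simps)
  ultimately have "homogeneous_class n j z \<in> H.C n" by (simp add: direct_sum_carrier_def)
  then show "homogeneous_class n j z \<in> carrier (PH n)" "homogeneous_class n j z \<in> grade (PH n) j"
    by (auto simp: PH_eq H.S_simps homogeneous_class_def homology_simps)
qed

lemma homogeneous_class_lincomb:
  assumes "z \<in> cycles (K j) n" "w \<in> cycles (K j) n"
  shows "homogeneous_class n j (cscale a z + cscale b w) =
    [:a:] \<odot>\<^bsub>PH n\<^esub> homogeneous_class n j z \<oplus>\<^bsub>PH n\<^esub> [:b:] \<odot>\<^bsub>PH n\<^esub> homogeneous_class n j w"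
proof -
  have C: "homogeneous_class n j z \<in> H.C n" "homogeneous_class n j w \<in> H.C n"
    using homogeneous_class(1)[OF assms(1)] homogeneous_class(1)[OF assms(2)] by (simp_all add: PH_eq H.S_simps)
  show ?thesis
    unfolding PH_eq H.S_simps H.smult_S_const[OF C(1)] H.smult_S_const[OF C(2)]
    by (auto simp: H.vadd_def H.vscale_def homogeneous_class_def homology_simps coset_add coset_cscale fun_eq_iff)
qed

text \<open>If \<open>\<phi>\<close> kills a class, then so does \<open>\<psi> \<phi>\<close>, which is multiplication by \<open>t\<^sup>2\<^sup>\<epsilon>\<close>. The vanishing of \<open>\<phi>\<close> is
  expressed by \<open>0 \<odot> y\<close>, the form to which linearity of \<open>\<psi>\<close> applies.\<close>

lemma killed_by_interleaving:
  assumes i: "interleaving \<epsilon> (PH n) M \<phi> \<psi>" and z: "z \<in> cycles (K j) n"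
    and y: "y \<in> carrier M" "\<phi> (homogeneous_class n j z) = 0 \<odot>\<^bsub>M\<^esub> y"
  shows "z \<in> boundaries (K (j + int (2 * \<epsilon>))) n"
proof -
  let ?h = "homogeneous_class n j z" and ?j = "j + int (2 * \<epsilon>)"
  have h: "?h \<in> carrier (PH n)" by (rule homogeneous_class[OF z])
  have "\<psi> y \<in> carrier (PH n)" "\<psi> (0 \<odot>\<^bsub>M\<^esub> y) = 0 \<odot>\<^bsub>PH n\<^esub> \<psi> y"
    using i y(1) by (auto simp: interleaving_def eta_morphism_def)
  then have "\<psi> (\<phi> ?h) = H.vzero' n" by (simp add: y(2) PH_eq H.S_simps H.smult_S_0)
  moreover have "\<psi> (\<phi> ?h) = tvar ^ (2 * \<epsilon>) \<odot>\<^bsub>PH n\<^esub> ?h"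
    using i h by (auto simp: interleaving_def)
  moreover have "(tvar ^ (2 * \<epsilon>) \<odot>\<^bsub>PH n\<^esub> ?h) ?j = z +o boundaries (K ?j) n"
    using h by (rule tvar_power_PH) (simp add: homogeneous_class_def)
  ultimately have "z +o boundaries (K ?j) n = 0 +o boundaries (K ?j) n"
    by (simp add: H.vzero'_def homology_simps)
  then show ?thesis unfolding coset_eq_iff by simp
qed

lemma zero_interleaved_boundaries:
  assumes "interleaved \<epsilon> (PH n) (zero_kt :: ('k, unit) gmodule)"
    and z: "(z :: 'v set \<Rightarrow>\<^sub>0 'k) \<in> cycles (K j) n"
  shows "z \<in> boundaries (K (j + int (2 * \<epsilon>))) n"
proof -
  obtain \<phi> \<psi> where "interleaving \<epsilon> (PH n) (zero_kt :: ('k, unit) gmodule) \<phi> \<psi>"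
    using assms(1) by (auto simp: interleaved_def)
  from killed_by_interleaving[OF this z, of "()"] show ?thesis
    by (simp add: zero_kt_def)
qed

lemma boundaries_0_aug: "z \<in> boundaries L 0 \<Longrightarrow> aug_boundary z = 0"
  unfolding boundaries_def boundary_Suc by (auto simp: aug_boundary_aug_boundary)

lemma aug_vertex: "aug_boundary (gen {v}) \<noteq> (0 :: 'v set \<Rightarrow>\<^sub>0 'k)"
proof
  assume "aug_boundary (gen {v}) = (0 :: 'v set \<Rightarrow>\<^sub>0 'k)"
  then have "Poly_Mapping.lookup (Poly_Mapping.single {} ((-1) ^ vertex_index v {v}) :: 'v set \<Rightarrow>\<^sub>0 'k) {} = 0"
    by (simp add: aug_boundary_def simplex_boundary_def)
  then show False by simp
qed

text \<open>Let \<open>v\<close> be a vertex and \<open>z\<close> a \<open>0\<close>-chain of augmentation \<open>0\<close> at the same level. A graded piece of the free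
  module has dimension at most one, so with \<open>c\<close> and \<open>b\<close> the coefficients of the images of \<open>v\<close> and
  \<open>z\<close>, the combination \<open>c z - b v\<close> is killed by \<open>\<phi>\<close> and bounds after the shift \<open>2\<epsilon>\<close>. Boundaries have
  augmentation \<open>0\<close> and \<open>v\<close> has not. Hence \<open>b = 0\<close>, and \<open>c \<noteq> 0\<close> because otherwise \<open>v\<close> would bound; so \<open>z\<close>
  bounds. As \<open>v\<close> has nonzero image, it cannot lie far below the degree
  of the generator, and the levels with nonempty intersection are bounded below.\<close>

lemma free_interleaved_boundaries:
  assumes int: "interleaved \<epsilon> (PH 0) (free_kt a :: ('k, 'k poly) gmodule)" and v: "{v} \<in> K j"
  shows "a \<le> j + int \<epsilon>"
    and "(z :: 'v set \<Rightarrow>\<^sub>0 'k) \<in> chains (K j) 0 \<Longrightarrow> aug_boundary z = 0 \<Longrightarrow> z \<in> boundaries (K (j + int (2 * \<epsilon>))) 0"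
proof -
  let ?M = "free_kt a :: ('k, 'k poly) gmodule" and ?v = "gen {v} :: 'v set \<Rightarrow>\<^sub>0 'k"
  have M: "carrier ?M = UNIV" "\<And>x y. x \<oplus>\<^bsub>?M\<^esub> y = x + y" "\<And>x y. x \<odot>\<^bsub>?M\<^esub> y = x * y"
    "\<And>j. grade ?M j = (if a \<le> j then {monom c (nat (j - a)) | c. True} else {0})"
    by (simp_all add: free_kt_def)
  obtain \<phi> \<psi> where i: "interleaving \<epsilon> (PH 0) ?M \<phi> \<psi>"
    using int by (auto simp: interleaved_def)
  have kill: "z \<in> boundaries (K (j + int (2 * \<epsilon>))) 0" if "z \<in> cycles (K j) 0" "\<phi> (homogeneous_class 0 j z) = 0" for z
    using killed_by_interleaving[OF i that(1), of 0] that(2) by (simp add: M)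
  have vc: "?v \<in> cycles (K j) 0" using v by (simp add: cycles_def chains_def boundary_def)
  have grade: "\<phi> (homogeneous_class 0 j z) \<in> grade ?M (j + int \<epsilon>)" if "z \<in> cycles (K j) 0" for z
  proof -
    have "\<phi> ` grade (PH 0) j \<subseteq> grade ?M (j + int \<epsilon>)"
      using i by (simp add: interleaving_def eta_morphism_def)
    then show ?thesis using homogeneous_class(2)[OF that] by blast
  qed
  have v_nz: "\<phi> (homogeneous_class 0 j ?v) \<noteq> 0"
    using kill[OF vc] boundaries_0_aug aug_vertex by blast
  then show aj: "a \<le> j + int \<epsilon>" using grade[OF vc] by (auto simp: M split: if_splits)
  assume z: "z \<in> chains (K j) 0" "aug_boundary z = 0"
  then have zc: "z \<in> cycles (K j) 0" by (simp add: cycles_def boundary_def)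
  obtain c where c: "\<phi> (homogeneous_class 0 j ?v) = monom c (nat (j + int \<epsilon> - a))"
    using grade[OF vc] aj by (auto simp: M)
  obtain b where b: "\<phi> (homogeneous_class 0 j z) = monom b (nat (j + int \<epsilon> - a))"
    using grade[OF zc] aj by (auto simp: M)
  have c0: "c \<noteq> 0" using v_nz c by auto
  \<comment> \<open>This combination cancels the images of both chains, which are multiples of one monomial.\<close>
  let ?w = "cscale c z + cscale (- b) ?v"
  have wc: "?w \<in> cycles (K j) 0" using zc vc by (intro cycles_closed)
  have sm: "p \<odot>\<^bsub>PH 0\<^esub> x \<in> carrier (PH 0)" if "x \<in> carrier (PH 0)" for p x
    using that by (simp add: PH_eq H.S_simps H.closed)
  have "\<phi> (homogeneous_class 0 j ?w) = [:c:] * \<phi> (homogeneous_class 0 j z) + [:- b:] * \<phi> (homogeneous_class 0 j ?v)"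
    unfolding homogeneous_class_lincomb[OF zc vc]
    using i sm[OF homogeneous_class(1)[OF zc]] sm[OF homogeneous_class(1)[OF vc]] homogeneous_class(1)[OF zc] homogeneous_class(1)[OF vc]
    by (auto simp: interleaving_def eta_morphism_def M)
  also have "\<dots> = 0" by (simp add: b c smult_monom add_monom)
  finally have wb: "?w \<in> boundaries (K (j + int (2 * \<epsilon>))) 0" by (intro kill wc)
  have "aug_boundary ?w = pscale (- b) (aug_boundary ?v)"
    using z(2) by (simp add: aug_boundary_def lext_add lext_pscale)
  then have "pscale (- b) (aug_boundary ?v) = 0"
    using boundaries_0_aug[OF wb] by simp
  then have "pscale (inverse (- b)) (pscale (- b) (aug_boundary ?v)) = 0" by simp
  then have "b = 0" using aug_vertex by (cases "b = 0") auto
  then have "cscale c z \<in> boundaries (K (j + int (2 * \<epsilon>))) 0" using wb by simp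
  from boundaries_closed(3)[OF this, of "inverse c"]
  show "z \<in> boundaries (K (j + int (2 * \<epsilon>))) 0" using c0 by simp
qed

end

lemma boundaries_fill:
  assumes "u \<in> boundaries K n"
  shows "\<exists>w \<in> supp_in {\<sigma> \<in> K. card \<sigma> = Suc (Suc n)}. aug_boundary w = u"
  using assms unfolding boundaries_def boundary_Suc chains_def supp_in_def by blast

lemma vertex_exists:
  assumes "simplicial_complex K" "K \<noteq> {}"
  obtains v where "{v} \<in> K"
proof -
  obtain \<sigma> v where "\<sigma> \<in> K" "v \<in> \<sigma>"
    using assms(2) simplicial_complexD(1)[OF assms(1)] by (metis all_not_in_conv)
  then show thesis using that simplicial_complexD(3)[OF assms(1), of \<sigma> "{v}"] by simp
qed

text \<open>The case \<open>n = 0\<close> concerns multiples of the empty simplex, which bound because there is a vertex; for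
  \<open>n = 1\<close> the reduced \<open>0\<close>-cycles are treated by the interleaving with the free module, and for larger \<open>n\<close>
  the homology in degree \<open>n - 1\<close> is interleaved with \<open>0\<close>.\<close>

lemma interleavings_fill:
  fixes u :: "'v set \<Rightarrow>\<^sub>0 'k::field"
  assumes mono: "\<And>i j. i \<le> j \<Longrightarrow> K i \<subseteq> K j" and cpx: "simplicial_complex (K j)" and ne: "K j \<noteq> {}"
    and int0: "interleaved \<epsilon> (persistent_homology K 0 :: ('k, int \<Rightarrow> ('v set \<Rightarrow>\<^sub>0 'k) set) gmodule) (free_kt a)"
    and intq: "\<And>q. q \<noteq> 0 \<Longrightarrow>
      interleaved \<epsilon> (persistent_homology K q :: ('k, int \<Rightarrow> ('v set \<Rightarrow>\<^sub>0 'k) set) gmodule) zero_kt"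
    and u: "u \<in> supp_in {\<sigma> \<in> insert {} (K j). card \<sigma> = n}" "aug_boundary u = 0"
  shows "\<exists>w \<in> supp_in {\<sigma> \<in> K (if n = 0 then j else j + int (2 * \<epsilon>)). card \<sigma> = Suc n}. aug_boundary w = u"
proof -
  interpret filtration K "TYPE('k)" by standard (rule mono)
  obtain v where v: "{v} \<in> K j" using vertex_exists[OF cpx ne] .
  have u_chain: "u \<in> chains (K j) q" if "n = Suc q" for q
    using u(1) that by (auto simp: chains_def supp_in_def)
  consider "n = 0" | "n = 1" | q where "n = Suc (Suc q)" by (metis One_nat_def nat.exhaust)
  then show ?thesis
  proof cases
    case 1
    let ?w = "Poly_Mapping.single {v} (Poly_Mapping.lookup u {})"
    have "u \<in> supp_in {{}}"
      using u(1) 1 simplicial_complexD(1,2)[OF cpx] by (auto simp: supp_in_def subset_iff card_eq_0_iff)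
    then have "u = Poly_Mapping.single {} (Poly_Mapping.lookup u {})"
      by (intro poly_mapping_eqI) (auto simp: lookup_single when_def supp_in_def in_keys_iff)
    moreover have "vertex_index v {v} = 0" by (simp add: vertex_index_def)
    ultimately have "aug_boundary ?w = u" by (simp add: aug_boundary_def simplex_boundary_def)
    moreover have "?w \<in> supp_in {\<sigma> \<in> K j. card \<sigma> = Suc n}" using v 1 by (intro supp_in_single) simp
    ultimately show ?thesis using 1 by auto
  next
    case 2
    then show ?thesis
      using boundaries_fill[OF free_interleaved_boundaries(2)[OF int0 v u_chain u(2)]] by simp
  next
    case 3
    have "u \<in> cycles (K j) (Suc q)" using u_chain[OF 3] u(2) by (simp add: cycles_def boundary_Suc)
    then show ?thesis
      using boundaries_fill[OF zero_interleaved_boundaries[OF intq]] 3 by simp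
  qed
qed

section \<open>Dimension, filtrations and entry times\<close>

lemma complex_dim_bound:
  assumes "complex_dim K = Fin Q" "\<sigma> \<in> K"
  shows "card \<sigma> \<le> nat (Q + 1)"
proof -
  have bdd: "bdd_above (card ` K)" and Q: "Q = Max (insert (-1) ((\<lambda>\<sigma>. int (card \<sigma>) - 1) ` K))"
    using assms(1) by (auto simp: complex_dim_def split: if_splits)
  have "finite (card ` K)" using bdd by (simp add: bdd_above_nat)
  then have "finite ((\<lambda>n. int n - 1) ` card ` K)" by (rule finite_imageI)
  then have "finite ((\<lambda>\<sigma>. int (card \<sigma>) - 1) ` K)" by (simp add: image_image)
  then have "int (card \<sigma>) - 1 \<le> Q" unfolding Q using assms(2) by (intro Max_ge) auto
  then show ?thesis by simp
qed

text \<open>The operator \<open>LEAST\<close> is meaningful for integers only if a lower bound is known.\<close>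

lemma int_least:
  fixes P :: "int \<Rightarrow> bool"
  assumes "P j" and "\<And>i. P i \<Longrightarrow> b \<le> i"
  shows "P (LEAST i. P i)" "P i \<Longrightarrow> (LEAST i. P i) \<le> i"
proof -
  define k where "k = (LEAST n. P (b + int n))"
  have "P (b + int (nat (j - b)))" using assms by simp
  then have k: "P (b + int k)" unfolding k_def by (rule LeastI)
  have le: "b + int k \<le> i" if "P i" for i
  proof -
    have "P (b + int (nat (i - b)))" using that assms(2)[OF that] by simp
    then have "k \<le> nat (i - b)" unfolding k_def by (rule Least_le)
    then show ?thesis using assms(2)[OF that] by linarith
  qed
  have L: "(LEAST i. P i) = b + int k" by (rule Least_equality[where P = P, OF k le])
  show "P (LEAST i. P i)" using k L by simp
  show "P i \<Longrightarrow> (LEAST i. P i) \<le> i" using le L by simp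
qed

lemma filtered_complexD:
  assumes "filtered_complex X F"
  shows "simplicial_complex (F j)" "F j \<subseteq> X" "i \<le> j \<Longrightarrow> F i \<subseteq> F j" "\<sigma> \<in> X \<Longrightarrow> \<exists>j. \<sigma> \<in> F j"
    "\<exists>b. \<forall>i. \<sigma> \<in> F i \<longrightarrow> b \<le> i"
proof -
  have F: "\<forall>j. simplicial_complex (F j) \<and> F j \<subseteq> X" "\<forall>i j. i \<le> j \<longrightarrow> F i \<subseteq> F j"
    "(\<Inter>j. F j) = {}" "(\<Union>j. F j) = X"
    using assms unfolding filtered_complex_def by argo+
  show "simplicial_complex (F j)" "F j \<subseteq> X" using F(1) by simp_all
  show "i \<le> j \<Longrightarrow> F i \<subseteq> F j" using F(2) by simp
  show "\<sigma> \<in> X \<Longrightarrow> \<exists>j. \<sigma> \<in> F j" using F(4) by blast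
  obtain b where "\<sigma> \<notin> F b" using F(3) by blast
  then have "\<forall>i. \<sigma> \<in> F i \<longrightarrow> b \<le> i" using F(2) by (meson linorder_le_cases subsetD)
  then show "\<exists>b. \<forall>i. \<sigma> \<in> F i \<longrightarrow> b \<le> i" ..
qed

lemma boundaries_mono: "K \<subseteq> L \<Longrightarrow> boundaries K n \<subseteq> boundaries L n"
  unfolding boundaries_def chains_def by blast

lemma chains_mono: "K \<subseteq> L \<Longrightarrow> chains K n \<subseteq> chains L n"
  unfolding chains_def by blast

text \<open>A common simplex of finitely many cover elements lies in all of them at the largest of its entry
  levels; this is where finiteness of \<open>I\<close> is used.\<close>

lemma inter_filtration_props:
  assumes "I \<noteq> {}" and fc: "\<And>i. i \<in> I \<Longrightarrow> filtered_complex (U i) (FU i)"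
  shows "i \<le> j \<Longrightarrow> inter_filtration FU I i \<subseteq> inter_filtration FU I j"
    and "simplicial_complex (inter_filtration FU I j)"
    and "inter_filtration FU I j \<subseteq> inter_complex U I"
    and "finite I \<Longrightarrow> inter_complex U I \<noteq> {} \<Longrightarrow> \<exists>j. inter_filtration FU I j \<noteq> {}"
proof -
  show "i \<le> j \<Longrightarrow> inter_filtration FU I i \<subseteq> inter_filtration FU I j"
    by (rule inter_filtration_mono) (use filtered_complexD(3)[OF fc] in auto)
  have F: "\<sigma> \<in> FU i j" if "\<sigma> \<in> inter_filtration FU I j" "i \<in> I" for \<sigma> i
    using that by (simp add: inter_filtration_def)
  obtain i0 where i0: "i0 \<in> I" using \<open>I \<noteq> {}\<close> by blast
  show "simplicial_complex (inter_filtration FU I j)"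
    unfolding simplicial_complex_def
  proof (intro conjI ballI allI impI)
    fix \<sigma> assume \<sigma>: "\<sigma> \<in> inter_filtration FU I j"
    note s = simplicial_complexD[OF filtered_complexD(1)[OF fc]]
    show "finite \<sigma>" "\<sigma> \<noteq> {}" using s(2)[OF i0 F[OF \<sigma> i0]] s(1)[OF i0] F[OF \<sigma> i0] by auto
    fix \<tau> assume "\<tau> \<subseteq> \<sigma> \<and> \<tau> \<noteq> {}"
    then show "\<tau> \<in> inter_filtration FU I j"
      using s(3)[OF _ F[OF \<sigma>]] by (simp add: inter_filtration_def)
  qed
  show "inter_filtration FU I j \<subseteq> inter_complex U I"
    unfolding inter_filtration_def inter_complex_def using filtered_complexD(2)[OF fc] by blast
  show "\<exists>j. inter_filtration FU I j \<noteq> {}" if "finite I" and ne: "inter_complex U I \<noteq> {}"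
  proof -
    obtain \<sigma> where "\<And>i. i \<in> I \<Longrightarrow> \<sigma> \<in> U i" using ne by (auto simp: inter_complex_def)
    then have "\<forall>i\<in>I. \<exists>j. \<sigma> \<in> FU i j" using filtered_complexD(4)[OF fc] by blast
    then obtain J where J: "\<And>i. i \<in> I \<Longrightarrow> \<sigma> \<in> FU i (J i)" by (metis bchoice)
    have "\<sigma> \<in> FU i (Max (J ` I))" if "i \<in> I" for i
    proof -
      have "J i \<le> Max (J ` I)" using that \<open>finite I\<close> by simp
      then show ?thesis using filtered_complexD(3)[OF fc[OF that]] J[OF that] by blast
    qed
    then have "\<sigma> \<in> inter_filtration FU I (Max (J ` I))" by (simp add: inter_filtration_def)
    then show ?thesis by blast
  qed
qed

text \<open>The lower bound turns the entry time, which is defined by \<open>LEAST\<close>, into an actual minimum.\<close>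

lemma nerve_filtration_eq:
  assumes fc: "\<And>i. i \<in> \<Lambda> \<Longrightarrow> filtered_complex (U i) (FU i)"
    and bd: "\<And>I. I \<in> nerve \<Lambda> U \<Longrightarrow> \<exists>b. \<forall>j. inter_filtration FU I j \<noteq> {} \<longrightarrow> b \<le> j"
  shows "nerve_filtration \<Lambda> U FU j =
    {I. finite I \<and> I \<noteq> {} \<and> I \<subseteq> \<Lambda> \<and> inter_filtration FU I j \<noteq> {}}"
proof -
  have mem: "I \<in> nerve_filtration \<Lambda> U FU j \<longleftrightarrow> inter_filtration FU I j \<noteq> {}"
    if I: "finite I" "I \<noteq> {}" "I \<subseteq> \<Lambda>" for I
  proof -
    have fcI: "filtered_complex (U i) (FU i)" if "i \<in> I" for i using fc that I by blast
    note p = inter_filtration_props[where U = U and FU = FU, OF I(2) fcI]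
    show ?thesis
    proof (cases "inter_complex U I = {}")
      case True
      then show ?thesis using p(3)[of j] by (simp add: nerve_filtration_def nerve_def)
    next
      case False
      then have n: "I \<in> nerve \<Lambda> U" using I by (simp add: nerve_def)
      obtain j0 where j0: "inter_filtration FU I j0 \<noteq> {}" using p(4)[OF _ I(1) False] by blast
      obtain b where b: "\<And>j. inter_filtration FU I j \<noteq> {} \<Longrightarrow> b \<le> j" using bd[OF n] by blast
      have "nerve_entry FU I \<le> j \<longleftrightarrow> inter_filtration FU I j \<noteq> {}"
        using int_least[where P = "\<lambda>j. inter_filtration FU I j \<noteq> {}", OF j0 b] p(1)[of "nerve_entry FU I" j]
        unfolding nerve_entry_def by blast
      then show ?thesis using n by (simp add: nerve_filtration_def)
    qed
  qed
  have simplex: "finite I" "I \<noteq> {}" "I \<subseteq> \<Lambda>" if "I \<in> nerve_filtration \<Lambda> U FU j" for I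
    using that by (auto simp: nerve_filtration_def nerve_def)
  show ?thesis
  proof (rule Set.set_eqI)
    show "I \<in> nerve_filtration \<Lambda> U FU j \<longleftrightarrow>
        I \<in> {I. finite I \<and> I \<noteq> {} \<and> I \<subseteq> \<Lambda> \<and> inter_filtration FU I j \<noteq> {}}" for I
      unfolding mem_Collect_eq using mem[of I] simplex[of I] by argo
  qed
qed

section \<open>The approximate nerve theorem\<close>

theorem theorem7p2:
  fixes \<epsilon> :: nat
    and X :: "'v set set" and F :: "int \<Rightarrow> 'v set set"
    and \<Lambda> :: "'i set" and U :: "'i \<Rightarrow> 'v set set" and FU :: "'i \<Rightarrow> int \<Rightarrow> 'v set set"
    and D \<Delta> :: "int extended" and Q :: int
  assumes "filtered_complex X F"
    and "filtered_cover X F \<Lambda> U FU"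
    and "eps_acyclic TYPE('k::field) \<epsilon> \<Lambda> U FU"
    and "D = complex_dim (nerve \<Lambda> U)"
    and "\<Delta> = complex_dim X"
    and "min D \<Delta> = Fin Q"
  shows "\<forall>n. interleaved (nat (2 * (Q + 1)) * \<epsilon>)
           (persistent_homology F n :: ('k, int \<Rightarrow> ('v set \<Rightarrow>\<^sub>0 'k) set) gmodule)
           (persistent_homology (nerve_filtration \<Lambda> U FU) n)"
proof
  fix n
  let ?G = "inter_filtration FU" and ?N = "nerve_filtration \<Lambda> U FU"
  let ?m = "nat (Q + 1)"
  have fc: "filtered_complex (U i) (FU i)" if "i \<in> \<Lambda>" for i
    using assms(2) that by (simp add: filtered_cover_def)
  have fcI: "filtered_complex (U i) (FU i)" if "I \<in> nerve \<Lambda> U" "i \<in> I" for I i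
    using fc that by (auto simp: nerve_def)
  have I_ne: "I \<noteq> {}" if "I \<in> nerve \<Lambda> U" for I using that by (simp add: nerve_def)
  note G = inter_filtration_props[where U = U and FU = FU, OF I_ne fcI]
  have fill: "\<exists>w \<in> supp_in {\<sigma> \<in> ?G I (if n = 0 then j else j + int (2 * \<epsilon>)). card \<sigma> = Suc n}. aug_boundary w = u"
    if I: "I \<in> nerve \<Lambda> U" "?G I j \<noteq> {}"
      and u: "u \<in> supp_in {\<sigma> \<in> insert {} (?G I j). card \<sigma> = n}" "aug_boundary u = 0"
    for I j n and u :: "'v set \<Rightarrow>\<^sub>0 'k"
  proof -
    obtain a where "interleaved \<epsilon> (persistent_homology (?G I) 0 :: ('k, int \<Rightarrow> ('v set \<Rightarrow>\<^sub>0 'k) set) gmodule) (free_kt a)"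
      "\<And>q. q \<noteq> 0 \<Longrightarrow>
        interleaved \<epsilon> (persistent_homology (?G I) q :: ('k, int \<Rightarrow> ('v set \<Rightarrow>\<^sub>0 'k) set) gmodule) zero_kt"
      using assms(3) I(1) unfolding eps_acyclic_def by blast
    then show ?thesis
      using G(1)[OF I(1) I(1)] G(2)[OF I(1) I(1)] I(2) u by (intro interleavings_fill) auto
  qed
  have bd: "\<exists>b. \<forall>j. ?G I j \<noteq> {} \<longrightarrow> b \<le> j" if I: "I \<in> nerve \<Lambda> U" for I
  proof -
    obtain a where a: "interleaved \<epsilon>
        (persistent_homology (?G I) 0 :: ('k, int \<Rightarrow> ('v set \<Rightarrow>\<^sub>0 'k) set) gmodule) (free_kt a)"
      using assms(3) I unfolding eps_acyclic_def by blast
    interpret filtration "?G I" "TYPE('k)" by standard (rule G(1)[OF I I])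
    have "a - int \<epsilon> \<le> j" if ne: "?G I j \<noteq> {}" for j
    proof -
      obtain v where "{v} \<in> ?G I j" using vertex_exists[OF G(2)[OF I I] ne] .
      from free_interleaved_boundaries(1)[OF a this] show ?thesis by simp
    qed
    then show ?thesis by blast
  qed
  have nerve_eq: "?N j = {I. finite I \<and> I \<noteq> {} \<and> I \<subseteq> \<Lambda> \<and> ?G I j \<noteq> {}}" for j
    by (rule nerve_filtration_eq) (erule fc, erule bd)
  have N_nerve: "I \<in> nerve \<Lambda> U" if "I \<in> ?N j" for I j
    using that by (simp add: nerve_filtration_def)
  have m: "(\<forall>j. \<forall>I\<in>?N j. card I \<le> ?m) \<or> (\<forall>j. \<forall>\<sigma>\<in>F j. card \<sigma> \<le> ?m)"
  proof -
    have "D = Fin Q \<or> \<Delta> = Fin Q" using assms(6) by (auto simp: min_def split: if_splits)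
    then show ?thesis
    proof
      assume "D = Fin Q"
      then have "card I \<le> ?m" if "I \<in> ?N j" for I j
        using complex_dim_bound[OF _ N_nerve[OF that]] assms(4) by simp
      then show ?thesis by simp
    next
      assume "\<Delta> = Fin Q"
      then have "card \<sigma> \<le> ?m" if "\<sigma> \<in> F j" for \<sigma> j
        using complex_dim_bound[of X Q \<sigma>] assms(5) subsetD[OF filtered_complexD(2)[OF assms(1)] that] by simp
      then show ?thesis by simp
    qed
  qed
  interpret nerve_cover FU \<Lambda> F ?N "2 * \<epsilon>" ?m "TYPE('k)"
  proof
    show "simplicial_complex (FU i j)" if "i \<in> \<Lambda>" for i j
      by (rule filtered_complexD(1)[OF fc[OF that]])
    show "FU i j \<subseteq> FU i j'" if "i \<in> \<Lambda>" "j \<le> j'" for i j j'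
      by (rule filtered_complexD(3)[OF fc[OF that(1)] that(2)])
    show "F j = (\<Union>i\<in>\<Lambda>. FU i j)" for j using assms(2) by (simp add: filtered_cover_def)
    show "\<exists>e\<le>j. \<sigma> \<in> F e \<and> (\<forall>i. \<sigma> \<in> F i \<longrightarrow> e \<le> i)" if \<sigma>: "\<sigma> \<in> F j" for \<sigma> j
    proof -
      obtain b where "\<And>i. \<sigma> \<in> F i \<Longrightarrow> b \<le> i" using filtered_complexD(5)[OF assms(1)] by blast
      from int_least[where P = "\<lambda>i. \<sigma> \<in> F i", OF \<sigma> this] \<sigma> show ?thesis by blast
    qed
    show "\<exists>e\<le>j. I \<in> ?N e \<and> (\<forall>i. I \<in> ?N i \<longrightarrow> e \<le> i)" if "I \<in> ?N j" for I j
      using that by (intro exI[of _ "nerve_entry FU I"]) (auto simp: nerve_filtration_def)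
    show "\<exists>w \<in> supp_in {\<sigma> \<in> ?G I (if n = 0 then j else j + int (2 * \<epsilon>)). card \<sigma> = Suc n}.
        aug_boundary w = u"
      if "I \<in> ?N j" "u \<in> supp_in {\<sigma> \<in> insert {} (?G I j). card \<sigma> = n}" "aug_boundary u = 0"
      for I j n and u :: "'v set \<Rightarrow>\<^sub>0 'k"
    proof -
      have "?G I j \<noteq> {}" using that(1)[unfolded nerve_eq] by simp
      then show ?thesis using that by (intro fill N_nerve)
    qed
  qed (fact nerve_eq, fact m)
  define \<eta> where "\<eta> = ?m * (2 * \<epsilon>)"
  obtain \<Phi> :: "'v set \<Rightarrow> ('i set \<Rightarrow>\<^sub>0 'k)" and \<Psi> :: "'i set \<Rightarrow> ('v set \<Rightarrow>\<^sub>0 'k)" where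
    \<Phi>: "\<And>j n c. c \<in> chains (F j) n \<Longrightarrow> lext \<Phi> c \<in> chains (?N j) n"
      "\<And>j n c. c \<in> chains (F j) n \<Longrightarrow> boundary n (lext \<Phi> c) = lext \<Phi> (boundary n c)"
    and \<Psi>: "\<And>j n c. c \<in> chains (?N j) n \<Longrightarrow> lext \<Psi> c \<in> chains (F (j + int \<eta>)) n"
      "\<And>j n c. c \<in> chains (?N j) n \<Longrightarrow> boundary n (lext \<Psi> c) = lext \<Psi> (boundary n c)"
    and \<Psi>\<Phi>: "\<And>j n z. z \<in> cycles (F j) n \<Longrightarrow>
      lext \<Psi> (lext \<Phi> z) - z \<in> boundaries (F (j + int \<eta> + int \<eta>)) n"
    and \<Phi>\<Psi>: "\<And>j n z. z \<in> cycles (?N j) n \<Longrightarrow>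
      lext \<Phi> (lext \<Psi> z) - z \<in> boundaries (?N (j + int \<eta>)) n"
    unfolding \<eta>_def by (fact chain_maps)
  have le: "j \<le> j + int \<eta>" "j + int \<eta> \<le> j + int (2 * \<eta>)" "j + int \<eta> + int \<eta> = j + int (2 * \<eta>)"
    for j by simp_all
  have "interleaved \<eta>
      (persistent_homology F n :: ('k, int \<Rightarrow> ('v set \<Rightarrow>\<^sub>0 'k) set) gmodule) (persistent_homology ?N n)"
  proof (rule interleaved_by_chain_maps[of F ?N \<Phi> \<eta> \<Psi> n])
    show "lext \<Phi> c \<in> chains (?N (j + int \<eta>)) k" if "c \<in> chains (F j) k" for j k c
      by (rule subsetD[OF chains_mono[OF N_mono[OF le(1)]] \<Phi>(1)[OF that]])
    show "lext \<Phi> (lext \<Psi> z) - z \<in> boundaries (?N (j + int (2 * \<eta>))) n"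
      if "z \<in> cycles (?N j) n" for j z
      by (rule subsetD[OF boundaries_mono[OF N_mono[OF le(2)]] \<Phi>\<Psi>[OF that]])
    show "lext \<Psi> (lext \<Phi> z) - z \<in> boundaries (F (j + int (2 * \<eta>))) n"
      if "z \<in> cycles (F j) n" for j z
      using \<Psi>\<Phi>[OF that] unfolding le(3) .
  qed (fact F_mono N_mono \<Phi>(2) \<Psi>)+
  moreover have "nat (2 * (Q + 1)) = 2 * ?m" by (simp add: nat_mult_distrib)
  then have "nat (2 * (Q + 1)) * \<epsilon> = \<eta>" by (simp only: \<eta>_def mult_ac)
  ultimately show "interleaved (nat (2 * (Q + 1)) * \<epsilon>)
      (persistent_homology F n :: ('k, int \<Rightarrow> ('v set \<Rightarrow>\<^sub>0 'k) set) gmodule) (persistent_homology ?N n)"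
    by simp
qed

end
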